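(* Assume that $\tau$ is in the limit circle case at $a$ and in the limit point case at $b$, and let $\alpha\in(0,\pi)$. The Donoghue $m$-function $M_{T_\alpha,\mathcal N_i}^{Do}(\cdot):\mathbb C\setminus\mathbb R\to\mathcal B(\mathcal N_i)$ for $T_\alpha$ satisfies $$M_{T_\alpha,\mathcal N_i}^{Do}(\pm i)=\pm i\,I_{\mathcal N_i},$$ $$M_{T_\alpha,\mathcal N_i}^{Do}(z)=M_{T_0,\mathcal N_i}^{Do}(z)+(i-z)\,\frac{\widetilde\psi^{\,\prime}(z,a)-\widetilde\psi^{\,\prime}(-i,a)}{\cot(\alpha)+\widetilde\psi^{\,\prime}(z,a)}\,(\psi(\overline z,\cdot),\cdot)_{L^2_r((a,b))}\,\psi(i,\cdot)\Big|_{\mathcal N_i},$$ for $z\in\mathbb C\setminus\mathbb R$, $z\neq\pm i$.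
   Context: Let $(a,b)\subseteq\mathbb R$ (possibly unbounded) and let $p,q,r$ be Lebesgue measurable functions on $(a,b)$ with $r>0$ a.e., $r\in L^1_{loc}((a,b);dx)$; $p>0$ a.e., $1/p\in L^1_{loc}((a,b);dx)$; $q$ real-valued a.e., $q\in L^1_{loc}((a,b);dx)$. Put $\tau f=\frac1r\big[-(pf')'+qf\big]$, $f^{[1]}=pf'$, and $W(f,g)(x)=f(x)g^{[1]}(x)-f^{[1]}(x)g(x)$. Let $L^2_r((a,b))=L^2((a,b);r\,dx)$ with inner product $(\cdot,\cdot)_{L^2_r((a,b))}$ linear in the second argument. The maximal operator is $T_{max}f=\tau f$ with $\mathrm{dom}(T_{max})=\{g\in L^2_r((a,b)) : g,g^{[1]}\in AC_{loc}((a,b)),\ \tau g\in L^2_r((a,b))\}$. The minimal operator $T_{min}$ is the closure of the restriction of $T_{max}$ to those $g\in\mathrm{dom}(T_{max})$ with compact support in $(a,b)$. For $f,g\in\mathrm{dom}(T_{max})$ the limits $W(f,g)(a)=\lim_{x\downarrow a}W(f,g)(x)$ and $W(f,g)(b)=\lim_{x\uparrow b}W(f,g)(x)$ exist. $\tau$ is in the limit circle case at an endpoint if for every $z\in\mathbb C$ all solutions of $\tau u=zu$ are in $L^2_r$ near that endpoint; otherwise it is in the limit point case there. Put $\mathcal N_z=\ker(T_{max}-zI)$; in the present situation $\dim\mathcal N_{\pm i}=1$. Generalized boundary values at $a$: fix real-valued $v_1,v_2\in\mathrm{dom}(T_{max})$ with $W(v_1,v_2)(a)=1$ and, for $g\in\mathrm{dom}(T_{max})$,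 set $\widetilde g(a)=-W(v_2,g)(a)$ and $\widetilde g^{\,\prime}(a)=W(v_1,g)(a)$. (If $T_{min}$ is bounded from below one takes $v_1,v_2$ equal near $a$ to a nonprincipal solution $\widehat u_a(\lambda_0,\cdot)$ and a principal solution $u_a(\lambda_0,\cdot)$, respectively, of $\tau u=\lambda_0u$ at $a$ with $W(\widehat u_a(\lambda_0,\cdot),u_a(\lambda_0,\cdot))=1$, where $\lambda_0\in\mathbb R$ is a lower bound of $T_{min}$.) For $\alpha\in[0,\pi)$, $T_\alpha$ denotes the self-adjoint extension of $T_{min}$ given by restricting $T_{max}$ to $\mathrm{dom}(T_\alpha)=\{g\in\mathrm{dom}(T_{max}) : \cos(\alpha)\widetilde g(a)+\sin(\alpha)\widetilde g^{\,\prime}(a)=0\}$; in particular $\mathrm{dom}(T_0)=\{g\in\mathrm{dom}(T_{max}):\widetilde g(a)=0\}$. For $z\in\rho(T_0)$ (the resolvent set of $T_0$), $\psi(z,\cdot)$ is the unique solution of $\tau y=zy$ with $\psi(z,\cdot)\in L^2_r((a,b))$ and $\widetilde\psi(z,a)=1$; $\widetilde\psi^{\,\prime}(z,a)$ is its second generalized boundary value at $a$. For a self-adjoint extension $T$ of $T_{min}$, the Donoghue $m$-function is $M_{T,\mathcal N_i}^{Do}(z)=zI_{\mathcal N_i}+(z^2+1)P_{\mathcal N_i}(T-zI)^{-1}P_{\mathcal N_i}\big|_{\mathcal N_i}$, $z\in\mathbb C\setminus\mathbb R$, where $P_{\mathcal N_i}$ is the orthogonal projection of $L^2_r((a,b))$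 onto $\mathcal N_i$, $I_{\mathcal N_i}$ is the identity on $\mathcal N_i$, and $\mathcal B(\mathcal N_i)$ is the space of bounded linear operators on $\mathcal N_i$. The symbol $(f,\cdot)_{L^2_r((a,b))}\,h$ denotes the rank-one operator $g\mapsto(f,g)_{L^2_r((a,b))}h$.
   Formalization: The rank-one term is multiplied by 1/‖ψ(i,·)‖² (norm of L²_r); without it the printed formula fails, e.g. on (0,∞) with p=r=1, q=0, α=π/2, where ‖ψ(i,·)‖²=1/√2. *)

theory Defs
  imports "HOL-Analysis.Analysis"
begin

section \<open>Data of the differential expression\<close>

record sl_data =
  left_end :: ereal
  right_end :: ereal
  coeff_p :: "real \<Rightarrow> real"
  coeff_q :: "real \<Rightarrow> real"
  coeff_r :: "real \<Rightarrow> real"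

definition dom_int :: "sl_data \<Rightarrow> real set" where
  "dom_int S = einterval (left_end S) (right_end S)"

definition L1_loc :: "sl_data \<Rightarrow> (real \<Rightarrow> 'a::{banach, second_countable_topology}) \<Rightarrow> bool" where
  "L1_loc S f \<longleftrightarrow>
     (\<forall>c d. c \<in> dom_int S \<longrightarrow> d \<in> dom_int S \<longrightarrow> set_integrable lebesgue {c..d} f)"

definition sl_problem :: "sl_data \<Rightarrow> bool" where
  "sl_problem S \<longleftrightarrow>
     left_end S < right_end S \<and>
     coeff_p S \<in> borel_measurable (lebesgue_on (dom_int S)) \<and>
     coeff_q S \<in> borel_measurable (lebesgue_on (dom_int S)) \<and>
     coeff_r S \<in> borel_measurable (lebesgue_on (dom_int S)) \<and>
     (AE x in lebesgue_on (dom_int S). coeff_r S x > 0) \<and> L1_loc S (coeff_r S) \<and>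
     (AE x in lebesgue_on (dom_int S). coeff_p S x > 0) \<and> L1_loc S (\<lambda>x. 1 / coeff_p S x) \<and>
     L1_loc S (coeff_q S)"

text \<open>
  Local absolute continuity is taken in the Lebesgue form: on every compact subinterval the
  function is an indefinite Lebesgue integral (of its almost everywhere defined derivative).
\<close>

definition AC_loc :: "sl_data \<Rightarrow> (real \<Rightarrow> complex) \<Rightarrow> bool" where
  "AC_loc S f \<longleftrightarrow>
     (\<exists>h. L1_loc S h \<and>
        (\<forall>c\<in>dom_int S. \<forall>d\<in>dom_int S. c \<le> d \<longrightarrow> f d - f c = (LINT t:{c..d}|lebesgue. h t)))"

text \<open>
  The product of \<open>p\<close> and the derivative of \<open>f\<close> is only defined almost everywhere, so
  membership of the quasi-derivative in \<open>AC_loc\<close> means that it has a representative there.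
  That representative is continuous, hence determined at every point of the interval; it is the
  one used for pointwise values, in particular in the Wronskian. Functions are total on the
  real line; their values off the interval play no role anywhere below.
\<close>

definition is_quasi_deriv :: "sl_data \<Rightarrow> (real \<Rightarrow> complex) \<Rightarrow> (real \<Rightarrow> complex) \<Rightarrow> bool" where
  "is_quasi_deriv S f h \<longleftrightarrow>
     AC_loc S h \<and>
     (AE x in lebesgue_on (dom_int S). h x = of_real (coeff_p S x) * vector_derivative f (at x))"

definition quasi_deriv :: "sl_data \<Rightarrow> (real \<Rightarrow> complex) \<Rightarrow> (real \<Rightarrow> complex)" where
  "quasi_deriv S f = (SOME h. is_quasi_deriv S f h)"

definition tau :: "sl_data \<Rightarrow> (real \<Rightarrow> complex) \<Rightarrow> (real \<Rightarrow> complex)" where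
  "tau S f = (\<lambda>x. 1 / of_real (coeff_r S x) *
     (- vector_derivative (quasi_deriv S f) (at x) + of_real (coeff_q S x) * f x))"

definition tau_regular :: "sl_data \<Rightarrow> (real \<Rightarrow> complex) \<Rightarrow> bool" where
  "tau_regular S f \<longleftrightarrow> AC_loc S f \<and> (\<exists>h. is_quasi_deriv S f h)"

definition wronskian :: "sl_data \<Rightarrow> (real \<Rightarrow> complex) \<Rightarrow> (real \<Rightarrow> complex) \<Rightarrow> real \<Rightarrow> complex" where
  "wronskian S f g x = f x * quasi_deriv S g x - quasi_deriv S f x * g x"

definition wronskian_left :: "sl_data \<Rightarrow> (real \<Rightarrow> complex) \<Rightarrow> (real \<Rightarrow> complex) \<Rightarrow> complex" where
  "wronskian_left S f g =
     Lim (at_right (left_end S)) (\<lambda>e. wronskian S f g (real_of_ereal e))"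

definition is_solution :: "sl_data \<Rightarrow> complex \<Rightarrow> (real \<Rightarrow> complex) \<Rightarrow> bool" where
  "is_solution S z u \<longleftrightarrow>
     tau_regular S u \<and> (AE x in lebesgue_on (dom_int S). tau S u x = z * u x)"

section \<open>The weighted Hilbert space\<close>

text \<open>
  Elements of the Hilbert space are represented by functions, and equality of elements is
  \<open>L2_eq\<close>. The inner product is linear in its second argument.
\<close>

definition weighted :: "sl_data \<Rightarrow> real measure" where
  "weighted S = density (lebesgue_on (dom_int S)) (\<lambda>x. ennreal (coeff_r S x))"

definition L2_r :: "sl_data \<Rightarrow> (real \<Rightarrow> complex) set" where
  "L2_r S = {f \<in> borel_measurable (weighted S). integrable (weighted S) (\<lambda>x. (cmod (f x))\<^sup>2)}"

definition L2_eq :: "sl_data \<Rightarrow> (real \<Rightarrow> complex) \<Rightarrow> (real \<Rightarrow> complex) \<Rightarrow> bool" where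
  "L2_eq S f g \<longleftrightarrow> (AE x in weighted S. f x = g x)"

definition L2_inner :: "sl_data \<Rightarrow> (real \<Rightarrow> complex) \<Rightarrow> (real \<Rightarrow> complex) \<Rightarrow> complex" where
  "L2_inner S f g = (LINT x|weighted S. cnj (f x) * g x)"

definition L2_norm :: "sl_data \<Rightarrow> (real \<Rightarrow> complex) \<Rightarrow> real" where
  "L2_norm S f = sqrt (LINT x|weighted S. (cmod (f x))\<^sup>2)"

definition limit_circle_left :: "sl_data \<Rightarrow> bool" where
  "limit_circle_left S \<longleftrightarrow>
     (\<forall>z u. is_solution S z u \<longrightarrow>
        (\<exists>c\<in>dom_int S. set_integrable (weighted S) {..c} (\<lambda>x. (cmod (u x))\<^sup>2)))"

definition limit_circle_right :: "sl_data \<Rightarrow> bool" where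
  "limit_circle_right S \<longleftrightarrow>
     (\<forall>z u. is_solution S z u \<longrightarrow>
        (\<exists>c\<in>dom_int S. set_integrable (weighted S) {c..} (\<lambda>x. (cmod (u x))\<^sup>2)))"

definition limit_point_right :: "sl_data \<Rightarrow> bool" where
  "limit_point_right S \<longleftrightarrow> \<not> limit_circle_right S"

section \<open>Operators\<close>

text \<open>
  An operator in the Hilbert space is given by its graph. Since functions stand for their
  almost-everywhere classes, the graph of the restriction of \<open>\<tau>\<close> to a set of (locally
  absolutely continuous) functions is saturated under \<open>L2_eq\<close>.
\<close>

type_synonym l2_operator = "((real \<Rightarrow> complex) \<times> (real \<Rightarrow> complex)) set"

definition tau_on :: "sl_data \<Rightarrow> (real \<Rightarrow> complex) set \<Rightarrow> l2_operator" where
  "tau_on S D =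
     {(f, h). f \<in> L2_r S \<and> h \<in> L2_r S \<and> (\<exists>g\<in>D. L2_eq S f g \<and> L2_eq S h (tau S g))}"

definition dom_T_max :: "sl_data \<Rightarrow> (real \<Rightarrow> complex) set" where
  "dom_T_max S = {g \<in> L2_r S. tau_regular S g \<and> tau S g \<in> L2_r S}"

definition T_max :: "sl_data \<Rightarrow> l2_operator" where
  "T_max S = tau_on S (dom_T_max S)"

definition deficiency_space :: "sl_data \<Rightarrow> complex \<Rightarrow> (real \<Rightarrow> complex) set" where
  "deficiency_space S z = {g. (g, \<lambda>x. z * g x) \<in> T_max S}"

definition boundary_frame :: "sl_data \<Rightarrow> (real \<Rightarrow> complex) \<Rightarrow> (real \<Rightarrow> complex) \<Rightarrow> bool" where
  "boundary_frame S v1 v2 \<longleftrightarrow>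
     v1 \<in> dom_T_max S \<and> v2 \<in> dom_T_max S \<and>
     (\<forall>x\<in>dom_int S. v1 x \<in> \<real> \<and> v2 x \<in> \<real>) \<and> wronskian_left S v1 v2 = 1"

definition bv0 :: "sl_data \<Rightarrow> (real \<Rightarrow> complex) \<Rightarrow> (real \<Rightarrow> complex) \<Rightarrow> complex" where
  "bv0 S v2 g = - wronskian_left S v2 g"

definition bv1 :: "sl_data \<Rightarrow> (real \<Rightarrow> complex) \<Rightarrow> (real \<Rightarrow> complex) \<Rightarrow> complex" where
  "bv1 S v1 g = wronskian_left S v1 g"

definition dom_T_alpha ::
  "sl_data \<Rightarrow> (real \<Rightarrow> complex) \<Rightarrow> (real \<Rightarrow> complex) \<Rightarrow> real \<Rightarrow> (real \<Rightarrow> complex) set" where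
  "dom_T_alpha S v1 v2 \<alpha> =
     {g \<in> dom_T_max S. of_real (cos \<alpha>) * bv0 S v2 g + of_real (sin \<alpha>) * bv1 S v1 g = 0}"

definition T_alpha ::
  "sl_data \<Rightarrow> (real \<Rightarrow> complex) \<Rightarrow> (real \<Rightarrow> complex) \<Rightarrow> real \<Rightarrow> l2_operator" where
  "T_alpha S v1 v2 \<alpha> = tau_on S (dom_T_alpha S v1 v2 \<alpha>)"

text \<open>
  Meaningful for \<open>z\<close> in the resolvent set of the extension with \<open>\<alpha> = 0\<close>, which contains all
  nonreal \<open>z\<close>; there it picks the unique such solution (unique on the interval). It is
  normalized by its boundary value and not by its norm, so the orthogonal projection onto the
  span of \<open>\<psi>(\<i>, \<cdot>)\<close> is \<open>(\<psi>(\<i>, \<cdot>), \<cdot>) \<psi>(\<i>, \<cdot>)\<close> divided by its squared norm.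
\<close>

definition psi ::
  "sl_data \<Rightarrow> (real \<Rightarrow> complex) \<Rightarrow> complex \<Rightarrow> (real \<Rightarrow> complex)" where
  "psi S v2 z = (SOME y. is_solution S z y \<and> y \<in> L2_r S \<and> bv0 S v2 y = 1)"

section \<open>Donoghue m-functions\<close>

text \<open>
  The two choices below are unique up to \<open>L2_eq\<close>: the orthogonal projection onto a closed
  subspace, and, for \<open>z\<close> in the resolvent set of \<open>T\<close>, the inverse of \<open>T - z I\<close>.
\<close>

definition orth_proj ::
  "sl_data \<Rightarrow> (real \<Rightarrow> complex) set \<Rightarrow> (real \<Rightarrow> complex) \<Rightarrow> (real \<Rightarrow> complex)" where
  "orth_proj S N f = (SOME h. h \<in> N \<and> (\<forall>u\<in>N. L2_inner S u (\<lambda>x. f x - h x) = 0))"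

definition resolvent ::
  "l2_operator \<Rightarrow> complex \<Rightarrow> (real \<Rightarrow> complex) \<Rightarrow> (real \<Rightarrow> complex)" where
  "resolvent T z f = (SOME g. (g, \<lambda>x. f x + z * g x) \<in> T)"

definition donoghue ::
  "sl_data \<Rightarrow> l2_operator \<Rightarrow> complex \<Rightarrow> (real \<Rightarrow> complex) \<Rightarrow> (real \<Rightarrow> complex)" where
  "donoghue S T z g =
     (let P = orth_proj S (deficiency_space S \<i>)
      in (\<lambda>x. z * g x + (z\<^sup>2 + 1) * P (resolvent T z (P g)) x))"

definition bounded_operator_on ::
  "sl_data \<Rightarrow> (real \<Rightarrow> complex) set \<Rightarrow> ((real \<Rightarrow> complex) \<Rightarrow> (real \<Rightarrow> complex)) \<Rightarrow> bool" where
  "bounded_operator_on S N A \<longleftrightarrow>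
     (\<forall>f\<in>N. A f \<in> N) \<and>
     (\<forall>f\<in>N. \<forall>g\<in>N. \<forall>c d.
        L2_eq S (A (\<lambda>x. c * f x + d * g x)) (\<lambda>x. c * A f x + d * A g x)) \<and>
     (\<exists>C. \<forall>f\<in>N. L2_norm S (A f) \<le> C * L2_norm S f)"

end

theory Submission
  imports Defs
begin

text \<open>
  The deficiency space \<open>N\<^sub>i\<close> is a line, so the Donoghue function only sees the resolvent on
  multiples of one function, where it can be written down. Everything rests on Green's formula.
  Since \<open>b\<close> is limit point, the Wronskian of two functions of the maximal domain tends to zero at
  \<open>b\<close> (\<open>limit_point_wronskian_vanishes\<close>): two functions with a nonzero Wronskian at \<open>b\<close> would
  serve as a basis, in which the coordinates of any solution of \<open>\<tau> u = z u\<close>, for any \<open>z\<close>, stay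
  bounded, and all solutions would be square integrable. Hence only the boundary term at \<open>a\<close> is left in
  Green's formula, and there it is the symplectic form of the two generalized boundary values
  (\<open>wronskian_left_boundary_values\<close>, a Pluecker identity).

  Consequently a square integrable solution for a nonreal \<open>z\<close> that satisfies a real boundary condition
  at \<open>a\<close> has norm zero (\<open>L2_sol_boundary_condition_zero\<close>). Weyl's compactness argument produces a
  solution that is square integrable near \<open>b\<close> (\<open>weyl_solution\<close>), and the limit circle case makes it
  square integrable near \<open>a\<close>. So for nonreal \<open>z\<close> the square integrable solutions form the line spanned
  by \<open>\<psi>(z)\<close>, the symmetry \<open>\<psi>(cnj z) = cnj \<psi>(z)\<close> holds, and no boundary form of \<open>\<psi>(z)\<close> vanishes.

  With \<open>m(z)\<close> for the second boundary value of \<open>\<psi>(z)\<close>, Green's formula evaluates two inner products: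
  \<open>(z + \<i>) (\<psi>(\<i>), \<psi>(z)) = m(z) - m(-\<i>)\<close> and \<open>(z - \<i>) (\<psi>(cnj z), \<psi>(\<i>)) = m(z) - m(\<i>)\<close>. Because
  \<open>(\<tau> - z) \<psi>(\<i>) = (\<i> - z) \<psi>(\<i>)\<close>, the resolvent of the extension with parameter \<open>\<beta>\<close> maps
  \<open>\<psi>(\<i>)\<close> to \<open>(\<psi>(\<i>) - c \<psi>(z)) / (\<i> - z)\<close>, where \<open>c\<close> is the quotient of the boundary forms of
  \<open>\<psi>(\<i>)\<close> and \<open>\<psi>(z)\<close>, equal to 1 for \<open>\<beta> = 0\<close>. Thus the Donoghue function is multiplication by an
  explicit scalar, and the difference of the scalars for \<open>\<alpha>\<close> and \<open>0\<close> is the asserted rank-one term.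
  At \<open>z = \<plusminus>\<i>\<close> the factor \<open>z\<^sup>2 + 1\<close> vanishes.
\<close>

section \<open>Locally absolutely continuous functions\<close>

text \<open>
  A density is carried along explicitly, since the pointwise derivative of an indefinite integral
  exists only almost everywhere.
\<close>

definition ac_primitive :: "real set \<Rightarrow> (real \<Rightarrow> 'a::euclidean_space) \<Rightarrow> (real \<Rightarrow> 'a) \<Rightarrow> bool" where
  "ac_primitive I F f \<longleftrightarrow> (\<forall>c\<in>I. \<forall>d\<in>I. c \<le> d \<longrightarrow>
     f absolutely_integrable_on {c..d} \<and> (f has_integral (F d - F c)) {c..d})"

definition loc_int :: "real set \<Rightarrow> (real \<Rightarrow> 'a::euclidean_space) \<Rightarrow> bool" where
  "loc_int I f \<longleftrightarrow> (\<forall>c\<in>I. \<forall>d\<in>I. f absolutely_integrable_on {c..d})"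

lemma Icc_subset: "is_interval I \<Longrightarrow> c \<in> I \<Longrightarrow> d \<in> I \<Longrightarrow> {c..d} \<subseteq> (I::real set)"
  by (rule subsetI, rule mem_is_interval_1_I[of I c d]) simp_all

lemma ac_primitive_loc_int: "ac_primitive I F f \<Longrightarrow> loc_int I f"
  unfolding loc_int_def
proof (intro ballI)
  fix c d assume F: "ac_primitive I F f" and cd: "c \<in> I" "d \<in> I"
  show "f absolutely_integrable_on {c..d}"
  proof (cases "c \<le> d")
    case True then show ?thesis using F cd unfolding ac_primitive_def by blast
  qed (simp add: set_integrable_def)
qed

lemma ac_primitive_int: "ac_primitive I F f \<Longrightarrow> c \<in> I \<Longrightarrow> d \<in> I \<Longrightarrow> c \<le> d \<Longrightarrow> (f has_integral (F d - F c)) {c..d}"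
  unfolding ac_primitive_def by blast

lemma loc_int_D: "loc_int I f \<Longrightarrow> c \<in> I \<Longrightarrow> d \<in> I \<Longrightarrow> f absolutely_integrable_on {c..d}"
  unfolding loc_int_def by blast

lemma loc_int_integrable: "loc_int I f \<Longrightarrow> c \<in> I \<Longrightarrow> d \<in> I \<Longrightarrow> f integrable_on {c..d}"
  using loc_int_D set_lebesgue_integral_eq_integral(1) by blast

lemma ac_primitiveI:
  assumes "loc_int I f" "\<And>c d. c \<in> I \<Longrightarrow> d \<in> I \<Longrightarrow> c \<le> d \<Longrightarrow> integral {c..d} f = F d - F c"
  shows "ac_primitive I F f"
  unfolding ac_primitive_def using assms
  by (metis integrable_integral loc_int_D loc_int_integrable)

lemma AC_loc_iff: "AC_loc S F \<longleftrightarrow> (\<exists>f. ac_primitive (dom_int S) F f)"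
proof -
  have "(L1_loc S f \<and> (\<forall>c\<in>dom_int S. \<forall>d\<in>dom_int S. c \<le> d \<longrightarrow> F d - F c = (LINT t:{c..d}|lebesgue. f t)))
     \<longleftrightarrow> ac_primitive (dom_int S) F f" for f
  proof
    assume L: "L1_loc S f \<and> (\<forall>c\<in>dom_int S. \<forall>d\<in>dom_int S. c \<le> d \<longrightarrow> F d - F c = (LINT t:{c..d}|lebesgue. f t))"
    then have l: "loc_int (dom_int S) f" by (auto simp: loc_int_def L1_loc_def)
    show "ac_primitive (dom_int S) F f"
      apply (rule ac_primitiveI[OF l])
      using L set_lebesgue_integral_eq_integral(2)[OF loc_int_D[OF l]] by metis
  next
    assume R: "ac_primitive (dom_int S) F f"
    note l = ac_primitive_loc_int[OF R]
    have "L1_loc S f" using l by (auto simp: loc_int_def L1_loc_def)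
    moreover have "F d - F c = (LINT t:{c..d}|lebesgue. f t)" if "c \<in> dom_int S" "d \<in> dom_int S" "c \<le> d" for c d
      using set_lebesgue_integral_eq_integral(2)[OF loc_int_D[OF l that(1,2)]]
        ac_primitive_int[OF R that] by (metis integral_unique)
    ultimately show "L1_loc S f \<and> (\<forall>c\<in>dom_int S. \<forall>d\<in>dom_int S. c \<le> d \<longrightarrow> F d - F c = (LINT t:{c..d}|lebesgue. f t))"
      by blast
  qed
  then show ?thesis unfolding AC_loc_def by blast
qed

lemma AE_lebesgue_on_iff: "S \<in> sets lebesgue \<Longrightarrow> (AE x in lebesgue_on S. P x) \<longleftrightarrow> (AE x in lebesgue. x \<in> S \<longrightarrow> P x)"
  by (simp add: AE_restrict_space_iff)

lemma AE_negligible: "(AE x in lebesgue. P x) \<longleftrightarrow> (\<exists>N. negligible N \<and> (\<forall>x. x \<notin> N \<longrightarrow> P x))"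
  unfolding eventually_ae_filter negligible_iff_null_sets by auto

text \<open>
  This is the Lebesgue differentiation theorem from the right. The function is extended by zero, because
  that theorem concerns functions that are integrable on every box.
\<close>

lemma right_difference_quotient_ae:
  fixes f :: "real \<Rightarrow> 'a::euclidean_space"
  assumes "f absolutely_integrable_on {c..d}"
  obtains N where "negligible N"
    "\<And>x e. \<lbrakk>x \<notin> N; 0 < e; c < x; x < d\<rbrakk> \<Longrightarrow> \<exists>\<delta>>0. \<forall>h. 0 < h \<and> h < \<delta> \<longrightarrow>
        norm (integral {x..x+h} f - h *\<^sub>R f x) \<le> e * h"
proof -
  define g where "g = (\<lambda>x. if x \<in> {c..d} then f x else 0)"
  have "g integrable_on cbox a b" for a b
  proof -
    have "g integrable_on UNIV"
      using set_lebesgue_integral_eq_integral(1)[OF assms] unfolding g_def by (simp only: integrable_restrict_UNIV)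
    then show ?thesis using integrable_on_subcbox by blast
  qed
  then obtain N where N: "negligible N" and
    *: "\<And>x e. \<lbrakk>x \<notin> N; 0 < e\<rbrakk> \<Longrightarrow> \<exists>\<delta>>0. \<forall>h. 0 < h \<and> h < \<delta> \<longrightarrow>
         norm(integral (cbox x (x + h *\<^sub>R One)) g /\<^sub>R h ^ DIM(real) - g x) < e"
    using integrable_ccontinuous_explicit by blast
  show ?thesis
  proof (rule that[OF N])
    fix x e :: real assume x: "x \<notin> N" "0 < e" "c < x" "x < d"
    from *[OF x(1,2)] obtain \<delta> where \<delta>: "\<delta> > 0" "\<And>h. 0 < h \<Longrightarrow> h < \<delta> \<Longrightarrow> norm(integral {x..x+h} g /\<^sub>R h - g x) < e"
      by (auto simp: )
    show "\<exists>\<delta>>0. \<forall>h. 0 < h \<and> h < \<delta> \<longrightarrow> norm (integral {x..x+h} f - h *\<^sub>R f x) \<le> e * h"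
    proof (intro exI conjI allI impI)
      show "min \<delta> (d - x) > 0" using \<delta> x by auto
      fix h assume h: "0 < h \<and> h < min \<delta> (d - x)"
      have "integral {x..x+h} f = integral {x..x+h} g"
        by (rule integral_cong) (use h x in \<open>auto simp: g_def\<close>)
      moreover have "g x = f x" using x by (auto simp: g_def)
      moreover have "norm(h *\<^sub>R (integral {x..x+h} g /\<^sub>R h - g x)) \<le> h * e"
        using \<delta>(2)[of h] h by (simp only: norm_scaleR) (auto simp: intro!: mult_left_mono)
      moreover have "h *\<^sub>R (integral {x..x+h} g /\<^sub>R h - g x) = integral {x..x+h} g - h *\<^sub>R g x"
        using h by (simp add: scaleR_diff_right)
      ultimately show "norm (integral {x..x+h} f - h *\<^sub>R f x) \<le> e * h" by (simp only: mult.commute[of e h])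
    qed
  qed
qed

text \<open>
  The difference quotients from the left are those from the right of the reflected function
  \<open>f (- x)\<close>.
\<close>

lemma primitive_differentiable_ae_Icc:
  fixes f :: "real \<Rightarrow> 'a::euclidean_space"
  assumes I: "is_interval I" and F: "ac_primitive I F f" and c: "c \<in> I" and d: "d \<in> I"
  shows "AE x in lebesgue. c < x \<and> x < d \<longrightarrow> (F has_vector_derivative f x) (at x)"
proof -
  have sub: "{c..d} \<subseteq> I" using Icc_subset I c d by blast
  have ai: "f absolutely_integrable_on {c..d}"
    using ac_primitive_loc_int[OF F] c d by (rule loc_int_D)
  then have ai': "(\<lambda>x. f (- x)) absolutely_integrable_on {-d..-c}"
    by (simp add: absolutely_integrable_reflect_real)
  obtain N where N: "negligible N"
    "\<And>x e. \<lbrakk>x \<notin> N; 0 < e; c < x; x < d\<rbrakk> \<Longrightarrow> \<exists>\<delta>>0. \<forall>h. 0 < h \<and> h < \<delta> \<longrightarrow>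
        norm (integral {x..x+h} f - h *\<^sub>R f x) \<le> e * h"
    using right_difference_quotient_ae[OF ai] by metis
  obtain N' where N': "negligible N'"
    "\<And>x e. \<lbrakk>x \<notin> N'; 0 < e; -d < x; x < -c\<rbrakk> \<Longrightarrow> \<exists>\<delta>>0. \<forall>h. 0 < h \<and> h < \<delta> \<longrightarrow>
        norm (integral {x..x+h} (\<lambda>x. f (-x)) - h *\<^sub>R f (-x)) \<le> e * h"
    using right_difference_quotient_ae[OF ai'] by metis
  have neg: "negligible (N \<union> uminus ` N')"
    using N N' by (auto intro!: negligible_Un negligible_differentiable_image_negligible differentiable_on_minus differentiable_on_ident)
  have "(F has_vector_derivative f x) (at x)" if x: "x \<notin> N \<union> uminus ` N'" "c < x" "x < d" for x
    unfolding has_vector_derivative_def has_derivative_at_alt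
  proof (intro conjI allI impI)
    show "bounded_linear (\<lambda>h. h *\<^sub>R f x)" by (rule bounded_linear_scaleR_left)
    fix e::real assume e: "0 < e"
    have "-x \<notin> N'" using x by (metis UnI2 image_eqI minus_minus)
    then obtain \<delta>' where \<delta>': "\<delta>' > 0" "\<And>h. 0 < h \<Longrightarrow> h < \<delta>' \<Longrightarrow> norm (integral {-x..-x+h} (\<lambda>x. f (-x)) - h *\<^sub>R f x) \<le> e * h"
      using N'(2)[of "-x" e] x e by (auto simp: )
    obtain \<delta> where \<delta>: "\<delta> > 0" "\<And>h. 0 < h \<Longrightarrow> h < \<delta> \<Longrightarrow> norm (integral {x..x+h} f - h *\<^sub>R f x) \<le> e * h"
      using N(2)[of "x" e] x e by (auto simp: )
    show "\<exists>\<eta>>0. \<forall>y. norm (y - x) < \<eta> \<longrightarrow> norm (F y - F x - (y - x) *\<^sub>R f x) \<le> e * norm (y - x)"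
    proof (intro exI conjI allI impI)
      define \<eta> where "\<eta> = Min {\<delta>, \<delta>', x - c, d - x}"
      show "\<eta> > 0" using \<delta> \<delta>' x by (auto simp: \<eta>_def)
      fix y assume y: "norm (y - x) < \<eta>"
      then have y': "c < y" "y < d" "\<bar>y - x\<bar> < \<delta>" "\<bar>y - x\<bar> < \<delta>'"
        by (auto simp: \<eta>_def)
      then have yI: "y \<in> I" "x \<in> I" using sub x by (auto intro!: subsetD[OF sub])
      consider "y = x" | "x < y" | "y < x" by linarith
      then show "norm (F y - F x - (y - x) *\<^sub>R f x) \<le> e * norm (y - x)"
      proof cases
        case 2
        then have "integral {x..y} f = F y - F x"
          using ac_primitive_int[OF F yI(2) yI(1)] by (simp add: integral_unique)
        then show ?thesis using \<delta>(2)[of "y - x"] 2 y' by simp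
      next
        case 3
        have "integral {y..x} f = F x - F y"
          using ac_primitive_int[OF F yI(1) yI(2)] 3 by (simp add: integral_unique)
        moreover have "integral {-x..-y} (\<lambda>x. f (-x)) = integral {y..x} f"
          by (rule Henstock_Kurzweil_Integration.integral_reflect_real)
        ultimately have "norm (F x - F y - (x - y) *\<^sub>R f x) \<le> e * (x - y)"
          using \<delta>'(2)[of "x - y"] 3 y' by simp
        moreover have "F y - F x - (y - x) *\<^sub>R f x = - (F x - F y - (x - y) *\<^sub>R f x)"
          by (simp add: scaleR_diff_left)
        ultimately show ?thesis using 3 by (simp only: norm_minus_cancel) (simp)
      qed auto
    qed
  qed
  then show ?thesis using neg unfolding AE_negligible by blast
qed

lemma primitive_has_derivative_ae:
  fixes f :: "real \<Rightarrow> 'a::euclidean_space"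
  assumes I: "open I" "is_interval I" and F: "ac_primitive I F f"
  shows "AE x in lebesgue. x \<in> I \<longrightarrow> (F has_vector_derivative f x) (at x)"
proof -
  \<comment> \<open>Countably many subintervals, those with rational endpoints, cover \<open>I\<close>.\<close>
  have "AE x in lebesgue. \<forall>c \<in> I \<inter> \<rat>. \<forall>d \<in> I \<inter> \<rat>. c < x \<and> x < d \<longrightarrow> (F has_vector_derivative f x) (at x)"
  proof (intro AE_ball_countable')
    fix c d assume "c \<in> I \<inter> \<rat>" "d \<in> I \<inter> \<rat>"
    then show "AE x in lebesgue. c < x \<and> x < d \<longrightarrow> (F has_vector_derivative f x) (at x)"
      using primitive_differentiable_ae_Icc[OF I(2) F] by auto
  qed (auto intro: countable_rat countable_Int2)
  then show ?thesis
  proof (rule AE_mp, intro AE_I2 impI)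
    fix x assume *: "\<forall>c \<in> I \<inter> \<rat>. \<forall>d \<in> I \<inter> \<rat>. c < x \<and> x < d \<longrightarrow> (F has_vector_derivative f x) (at x)" and x: "x \<in> I"
    obtain e where e: "e > 0" "ball x e \<subseteq> I" using I x by (meson open_contains_ball)
    obtain c where c: "c \<in> \<rat>" "x - e < c" "c < x" using Rats_dense_in_real[of "x - e" x] e by auto
    obtain d where d: "d \<in> \<rat>" "x < d" "d < x + e" using Rats_dense_in_real[of x "x+e"] e by auto
    have "c \<in> I" "d \<in> I" using c d e by (auto intro!: subsetD[OF e(2)] simp: dist_real_def)
    then show "(F has_vector_derivative f x) (at x)" using * c d by blast
  qed
qed

lemma primitive_vector_derivative_ae:
  assumes "open I" "is_interval I" "ac_primitive I F f"
  shows "AE x in lebesgue. x \<in> I \<longrightarrow> vector_derivative F (at x) = f x"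
  using primitive_has_derivative_ae[OF assms] by (auto simp: vector_derivative_at)

lemma primitive_continuous:
  fixes f :: "real \<Rightarrow> 'a::euclidean_space"
  assumes I: "open I" "is_interval I" and F: "ac_primitive I F f"
  shows "continuous_on I F"
proof -
  have "isCont F x" if x: "x \<in> I" for x
  proof -
    obtain e where e: "e > 0" "cball x e \<subseteq> I" using I x by (meson open_contains_cball)
    have cd: "x - e \<in> I" "x + e \<in> I" using e by (auto intro!: subsetD[OF e(2)] simp: dist_real_def)
    have sub: "{x-e..x+e} \<subseteq> I" using Icc_subset I cd by blast
    have "continuous_on {x-e..x+e} (\<lambda>y. F (x-e) + integral {x-e..y} f)"
      by (intro continuous_intros indefinite_integral_continuous_1 loc_int_integrable[OF ac_primitive_loc_int[OF F]] cd)
    moreover have "F (x-e) + integral {x-e..y} f = F y" if "y \<in> {x-e..x+e}" for y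
      using ac_primitive_int[OF F cd(1), of y] that sub by (auto simp: integral_unique)
    ultimately have "continuous_on {x-e..x+e} F" using continuous_on_eq[of "{x-e..x+e}" _ F] by simp
    then show ?thesis using e by (intro continuous_on_interior[of "{x-e..x+e}"]) (auto simp: )
  qed
  then show ?thesis by (simp add: continuous_at_imp_continuous_on)
qed

lemma loc_int_cong_ae:
  assumes ae: "AE x in lebesgue. x \<in> I \<longrightarrow> f x = g x" and I: "is_interval I" and f: "loc_int I f"
  shows "loc_int I g"
  unfolding loc_int_def
proof (intro ballI)
  fix c d assume cd: "c \<in> I" "d \<in> I"
  obtain N where N: "negligible N" "\<And>x. x \<notin> N \<Longrightarrow> x \<in> I \<Longrightarrow> f x = g x" using ae unfolding AE_negligible by blast
  show "g absolutely_integrable_on {c..d}"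
    by (rule absolutely_integrable_spike[OF loc_int_D[OF f cd] N(1)])
       (use N(2) Icc_subset[OF I cd] in auto)
qed

lemma ac_primitive_cong_ae:
  assumes ae: "AE x in lebesgue. x \<in> I \<longrightarrow> f x = g x" and FG: "\<And>x. x \<in> I \<Longrightarrow> F x = G x"
    and I: "is_interval I" and F: "ac_primitive I F f"
  shows "ac_primitive I G g"
  unfolding ac_primitive_def
proof (intro ballI impI conjI)
  fix c d assume cd: "c \<in> I" "d \<in> I" "c \<le> d"
  show "g absolutely_integrable_on {c..d}"
    using loc_int_cong_ae[OF ae I ac_primitive_loc_int[OF F]] cd by (rule_tac loc_int_D)
  obtain N where N: "negligible N" "\<And>x. x \<notin> N \<Longrightarrow> x \<in> I \<Longrightarrow> f x = g x" using ae unfolding AE_negligible by blast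
  show "(g has_integral (G d - G c)) {c..d}"
  proof (rule has_integral_spike[OF N(1)])
    show "(f has_integral (G d - G c)) {c..d}"
      using ac_primitive_int[OF F cd] FG[OF cd(1)] FG[OF cd(2)] by simp
  qed (use N(2) Icc_subset[OF I cd(1,2)] in auto)
qed

lemma ac_primitive_linear:
  assumes "bounded_linear T" and F: "ac_primitive I F f"
  shows "ac_primitive I (\<lambda>x. T (F x)) (\<lambda>x. T (f x))"
  unfolding ac_primitive_def
proof (intro ballI impI conjI)
  fix c d assume cd: "c \<in> I" "d \<in> I" "c \<le> d"
  show "(\<lambda>x. T (f x)) absolutely_integrable_on {c..d}"
    using absolutely_integrable_linear[OF loc_int_D[OF ac_primitive_loc_int[OF F] cd(1,2)] assms(1)] by (simp add: o_def)
  show "((\<lambda>x. T (f x)) has_integral (T (F d) - T (F c))) {c..d}"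
    using has_integral_linear[OF ac_primitive_int[OF F cd] assms(1)]
    by (simp add: o_def linear_diff[OF bounded_linear.linear[OF assms(1)]])
qed

lemma loc_int_linear:
  assumes T: "bounded_linear T" and f: "loc_int I f"
  shows "loc_int I (\<lambda>x. T (f x))"
  unfolding loc_int_def
proof (intro ballI)
  fix c d assume cd: "c \<in> I" "d \<in> I"
  show "(\<lambda>x. T (f x)) absolutely_integrable_on {c..d}"
    using absolutely_integrable_linear[OF loc_int_D[OF f cd] T] unfolding o_def .
qed

lemma loc_int_add:
  assumes f: "loc_int I f" and g: "loc_int I g"
  shows "loc_int I (\<lambda>x. f x + g x)"
  unfolding loc_int_def by (intro ballI set_integral_add(1) loc_int_D[OF f] loc_int_D[OF g])

lemma loc_int_norm:
  assumes f: "loc_int I f"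
  shows "loc_int I (\<lambda>x. norm (f x))"
  unfolding loc_int_def
proof (intro ballI)
  fix c d assume cd: "c \<in> I" "d \<in> I"
  show "(\<lambda>x. norm (f x)) absolutely_integrable_on {c..d}"
    using absolutely_integrable_norm[OF loc_int_D[OF f cd]] unfolding o_def .
qed

lemma ac_primitive_add:
  assumes F: "ac_primitive I F f" and G: "ac_primitive I G g"
  shows "ac_primitive I (\<lambda>x. F x + G x) (\<lambda>x. f x + g x)"
  unfolding ac_primitive_def
proof (intro ballI impI conjI)
  fix c d assume cd: "c \<in> I" "d \<in> I" "c \<le> d"
  show "(\<lambda>x. f x + g x) absolutely_integrable_on {c..d}"
    using loc_int_add[OF ac_primitive_loc_int[OF F] ac_primitive_loc_int[OF G]] cd by (rule_tac loc_int_D)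
  show "((\<lambda>x. f x + g x) has_integral (F d + G d - (F c + G c))) {c..d}"
    using has_integral_add[OF ac_primitive_int[OF F cd] ac_primitive_int[OF G cd]] by (simp add: algebra_simps)
qed

lemma ac_primitive_cmult:
  fixes f :: "real \<Rightarrow> 'a::{euclidean_space, real_normed_field}"
  shows "ac_primitive I F f \<Longrightarrow> ac_primitive I (\<lambda>x. k * F x) (\<lambda>x. k * f x)"
  by (rule ac_primitive_linear[OF bounded_linear_mult_right])

lemma ac_primitive_minus: "ac_primitive I F f \<Longrightarrow> ac_primitive I (\<lambda>x. - F x) (\<lambda>x. - f x)"
  by (rule ac_primitive_linear[OF bounded_linear_minus[OF bounded_linear_ident]])

lemma ac_primitive_diff:
  assumes F: "ac_primitive I F f" and G: "ac_primitive I G g"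
  shows "ac_primitive I (\<lambda>x. F x - G x) (\<lambda>x. f x - g x)"
  using ac_primitive_add[OF F ac_primitive_minus[OF G]] by simp

lemma continuous_mult_absolutely_integrable:
  fixes f :: "real \<Rightarrow> 'a::{euclidean_space, real_normed_field}"
  assumes g: "continuous_on {c..d} g" and f: "f absolutely_integrable_on {c..d}"
  shows "(\<lambda>x. g x * f x) absolutely_integrable_on {c..d}"
proof (rule absolutely_integrable_bounded_measurable_product[where h="(*)"])
  show "bilinear ((*) :: 'a \<Rightarrow> 'a \<Rightarrow> 'a)"
    by (simp add: bilinear_conv_bounded_bilinear bounded_bilinear_mult)
  show "g \<in> borel_measurable (lebesgue_on {c..d})"
    by (intro continuous_imp_measurable_on_sets_lebesgue g) auto
  show "bounded (g ` {c..d})" by (intro compact_imp_bounded compact_continuous_image g compact_Icc)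
  show "{c..d} \<in> sets lebesgue" by simp
  show "f absolutely_integrable_on {c..d}" by (rule f)
qed

lemma loc_int_mult:
  fixes f :: "real \<Rightarrow> 'a::{euclidean_space, real_normed_field}"
  assumes I: "is_interval I" and g: "continuous_on I g" and f: "loc_int I f"
  shows "loc_int I (\<lambda>x. g x * f x)" "loc_int I (\<lambda>x. f x * g x)"
proof -
  show "loc_int I (\<lambda>x. g x * f x)"
    unfolding loc_int_def
  proof (intro ballI)
    fix c d assume cd: "c \<in> I" "d \<in> I"
    show "(\<lambda>x. g x * f x) absolutely_integrable_on {c..d}"
      by (intro continuous_mult_absolutely_integrable loc_int_D[OF f cd] continuous_on_subset[OF g] Icc_subset I cd)
  qed
  then show "loc_int I (\<lambda>x. f x * g x)" by (simp add: mult.commute)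
qed

text \<open>
  Subdivide \<open>[c, d]\<close> into equal pieces shorter than \<open>\<delta>\<close>: the bounds on the pieces telescope.
\<close>

lemma increment_bound_from_small:
  fixes e :: "real \<Rightarrow> 'a::real_normed_vector" and M :: "real \<Rightarrow> real"
  assumes cd: "c \<le> d" and \<delta>: "\<delta> > 0"
    and small: "\<And>s t. c \<le> s \<Longrightarrow> s \<le> t \<Longrightarrow> t \<le> d \<Longrightarrow> t - s < \<delta> \<Longrightarrow> norm (e t - e s) \<le> M t - M s"
  shows "norm (e d - e c) \<le> M d - M c"
proof -
  obtain N :: nat where N: "(d - c) / \<delta> < real N" using reals_Archimedean2 by blast
  have Npos: "0 < real N" using N cd \<delta> by (smt (verit) divide_nonneg_pos)
  define h where "h = (d - c) / real N"
  have h: "0 \<le> h" "h < \<delta>" using N Npos cd \<delta> by (auto simp: h_def field_simps)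
  have Nh: "real N * h = d - c" using Npos by (simp add: h_def)
  have "norm (e (c + real i * h) - e c) \<le> M (c + real i * h) - M c" if "i \<le> N" for i
    using that
  proof (induction i)
    case (Suc i)
    have le: "real (Suc i) * h \<le> d - c" using Suc.prems h Nh by (metis mult_right_mono of_nat_mono)
    have "norm (e (c + real (Suc i) * h) - e (c + real i * h)) \<le> M (c + real (Suc i) * h) - M (c + real i * h)"
      by (rule small) (use h le in \<open>auto simp: algebra_simps\<close>)
    moreover have "norm (e (c + real i * h) - e c) \<le> M (c + real i * h) - M c"
      using Suc by auto
    moreover have "norm (e (c + real (Suc i) * h) - e c) \<le> norm (e (c + real (Suc i) * h) - e (c + real i * h)) + norm (e (c + real i * h) - e c)"
      using norm_triangle_ineq[of "e (c + real (Suc i) * h) - e (c + real i * h)" "e (c + real i * h) - e c"] by simp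
    ultimately show ?case by linarith
  qed auto
  from this[of N] show ?thesis by (simp add: Nh)
qed

text \<open>
  On a piece \<open>[s, t]\<close> the increment of \<open>F G\<close> differs from the integral of \<open>f G + F g\<close> by the integral of
  \<open>f (G(s) - G) + (F(t) - F) g\<close>. By uniform continuity this is at most \<open>\<epsilon>\<close> times the integral of
  \<open>|f| + |g|\<close> as soon as the piece is short, and such bounds add up.
\<close>

lemma ac_primitive_mult:
  fixes f :: "real \<Rightarrow> 'a::{euclidean_space, real_normed_field}"
  assumes I: "open I" "is_interval I" and F: "ac_primitive I F f" and G: "ac_primitive I G g"
  shows "ac_primitive I (\<lambda>x. F x * G x) (\<lambda>x. f x * G x + F x * g x)"
proof (rule ac_primitiveI)
  note cF = primitive_continuous[OF I F] and cG = primitive_continuous[OF I G]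
  note lf = ac_primitive_loc_int[OF F] and lg = ac_primitive_loc_int[OF G]
  let ?k = "\<lambda>x. f x * G x + F x * g x"
  show lk: "loc_int I ?k"
    by (intro loc_int_add loc_int_mult I lf lg cF cG)
  fix c d assume cd: "c \<in> I" "d \<in> I" "c \<le> d"
  have sub: "{c..d} \<subseteq> I" using Icc_subset I cd by blast
  define m where "m = (\<lambda>x. norm (f x) + norm (g x))"
  have lm: "loc_int I m" unfolding m_def by (intro loc_int_add loc_int_norm lf lg)
  define e where "e = (\<lambda>x. F x * G x - integral {c..x} ?k)"
  have bound: "norm (e d - e c) \<le> \<epsilon> * integral {c..d} m" if \<epsilon>: "\<epsilon> > 0" for \<epsilon>
  proof -
    have "uniformly_continuous_on {c..d} F" "uniformly_continuous_on {c..d} G"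
      by (intro compact_uniformly_continuous continuous_on_subset[OF cF sub] continuous_on_subset[OF cG sub] compact_Icc)+
    then obtain \<delta>1 \<delta>2 where \<delta>: "\<delta>1 > 0" "\<delta>2 > 0"
      "\<And>x y. x \<in> {c..d} \<Longrightarrow> y \<in> {c..d} \<Longrightarrow> dist y x < \<delta>1 \<Longrightarrow> dist (F y) (F x) < \<epsilon>"
      "\<And>x y. x \<in> {c..d} \<Longrightarrow> y \<in> {c..d} \<Longrightarrow> dist y x < \<delta>2 \<Longrightarrow> dist (G y) (G x) < \<epsilon>"
      unfolding uniformly_continuous_on_def using \<epsilon> by metis
    have "norm (e d - e c) \<le> \<epsilon> * integral {c..d} m - \<epsilon> * integral {c..c} m"
    proof (rule increment_bound_from_small[OF cd(3), where \<delta>="min \<delta>1 \<delta>2"])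
      show "min \<delta>1 \<delta>2 > 0" using \<delta> by simp
      fix s t assume st: "c \<le> s" "s \<le> t" "t \<le> d" "t - s < min \<delta>1 \<delta>2"
      have stI: "s \<in> I" "t \<in> I" using st sub by auto
      have ik: "integral {c..t} ?k - integral {c..s} ?k = integral {s..t} ?k"
        by (simp only: Henstock_Kurzweil_Integration.integral_combine[OF st(1,2) loc_int_integrable[OF lk cd(1) stI(2)], symmetric]
            add_diff_cancel_left')
      have im: "integral {c..t} m - integral {c..s} m = integral {s..t} m"
        by (simp only: Henstock_Kurzweil_Integration.integral_combine[OF st(1,2) loc_int_integrable[OF lm cd(1) stI(2)], symmetric]
            add_diff_cancel_left')
      note hf = ac_primitive_int[OF F stI st(2)] and hg = ac_primitive_int[OF G stI st(2)]
      have "((\<lambda>x. f x * G s + F t * g x - ?k x) has_integral ((F t - F s) * G s + F t * (G t - G s) - integral {s..t} ?k)) {s..t}"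
        by (intro has_integral_diff has_integral_add has_integral_mult_left has_integral_mult_right hf hg
             integrable_integral loc_int_integrable[OF lk stI])
      moreover have "(F t - F s) * G s + F t * (G t - G s) - integral {s..t} ?k = e t - e s"
        using ik by (simp add: e_def algebra_simps)
      moreover have "(\<lambda>x. f x * G s + F t * g x - ?k x) = (\<lambda>x. f x * (G s - G x) + (F t - F x) * g x)"
        by (rule ext) (simp add: algebra_simps)
      ultimately have h1: "((\<lambda>x. f x * (G s - G x) + (F t - F x) * g x) has_integral (e t - e s)) {s..t}"
        by (simp only:)
      have h2: "((\<lambda>x. \<epsilon> * m x) has_integral (\<epsilon> * integral {s..t} m)) {s..t}"
        by (intro has_integral_mult_right integrable_integral loc_int_integrable[OF lm stI])
      have "norm (integral {s..t} (\<lambda>x. f x * (G s - G x) + (F t - F x) * g x)) \<le> integral {s..t} (\<lambda>x. \<epsilon> * m x)"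
      proof (rule integral_norm_bound_integral[OF has_integral_integrable[OF h1] has_integral_integrable[OF h2]])
        fix x assume x: "x \<in> {s..t}"
        have "norm (G s - G x) \<le> \<epsilon>" "norm (F t - F x) \<le> \<epsilon>"
          using \<delta>(3)[of x t] \<delta>(4)[of x s] x st by (simp_all add: dist_norm less_imp_le)
        then have "norm (f x * (G s - G x)) + norm ((F t - F x) * g x) \<le> norm (f x) * \<epsilon> + \<epsilon> * norm (g x)"
          unfolding norm_mult by (intro add_mono mult_left_mono mult_right_mono) auto
        then show "norm (f x * (G s - G x) + (F t - F x) * g x) \<le> \<epsilon> * m x"
          using norm_triangle_ineq[of "f x * (G s - G x)" "(F t - F x) * g x"]
          by (simp add: m_def algebra_simps)
      qed
      then show "norm (e t - e s) \<le> \<epsilon> * integral {c..t} m - \<epsilon> * integral {c..s} m"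
        using h1 h2 im by (simp add: integral_unique algebra_simps)
    qed
    then show ?thesis by simp
  qed
  have "norm (e d - e c) \<le> 0"
  proof (rule field_le_epsilon)
    fix \<eta> :: real assume \<eta>: "0 < \<eta>"
    have m0: "0 \<le> integral {c..d} m"
      by (rule integral_nonneg[OF loc_int_integrable[OF lm cd(1,2)]]) (simp add: m_def)
    have "norm (e d - e c) \<le> \<eta> / (integral {c..d} m + 1) * integral {c..d} m"
      by (rule bound) (use m0 \<eta> in auto)
    also have "\<dots> \<le> \<eta>" using m0 \<eta> by (auto simp: field_simps)
    finally show "norm (e d - e c) \<le> 0 + \<eta>" by simp
  qed
  then show "integral {c..d} ?k = F d * G d - F c * G c" by (simp add: e_def algebra_simps)
qed

lemma ac_primitive_power:
  fixes f :: "real \<Rightarrow> 'a::{euclidean_space, real_normed_field}"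
  assumes I: "open I" "is_interval I" and F: "ac_primitive I F f"
  shows "ac_primitive I (\<lambda>x. F x ^ Suc n) (\<lambda>x. of_nat (Suc n) * F x ^ n * f x)"
proof (induction n)
  case 0
  then show ?case using F by simp
next
  case (Suc n)
  show ?case using ac_primitive_mult[OF I F Suc] by (simp add: algebra_simps)
qed

lemma ac_primitive_bound:
  fixes f :: "real \<Rightarrow> 'a::euclidean_space"
  assumes F: "ac_primitive I F f" and K: "ac_primitive I K k" and xy: "x \<in> I" "y \<in> I" "x \<le> y"
    and le: "\<And>t. x \<le> t \<Longrightarrow> t \<le> y \<Longrightarrow> norm (f t) \<le> k t"
  shows "norm (F y - F x) \<le> K y - K x"
proof -
  note f = ac_primitive_int[OF F xy] and k = ac_primitive_int[OF K xy]
  have "norm (integral {x..y} f) \<le> integral {x..y} k"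
    by (rule integral_norm_bound_integral[OF has_integral_integrable[OF f] has_integral_integrable[OF k]]) (use le in auto)
  then show ?thesis using f k by (simp add: integral_unique)
qed

text \<open>
  For \<open>x\<close> on either side of \<open>c\<close> one of the two intervals is empty or a point, so this is the oriented
  integral from \<open>c\<close> to \<open>x\<close>.
\<close>

definition integral_from :: "real \<Rightarrow> (real \<Rightarrow> 'a::euclidean_space) \<Rightarrow> real \<Rightarrow> 'a" where
  "integral_from c f x = integral {c..x} f - integral {x..c} f"

lemma integral_from_self [simp]: "integral_from c f c = 0"
  by (simp add: integral_from_def)

lemma ac_primitive_integral_from:
  assumes I: "is_interval I" and f: "loc_int I f" and c: "c \<in> I"
  shows "ac_primitive I (integral_from c f) f"
proof (rule ac_primitiveI[OF f])
  fix x y assume xy: "x \<in> I" "y \<in> I" "x \<le> y"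
  have comb: "integral {a..b} f + integral {b..e} f = integral {a..e} f" if "a \<le> b" "b \<le> e" "a \<in> I" "e \<in> I" for a b e
    using Henstock_Kurzweil_Integration.integral_combine[of a b e f] that loc_int_integrable[OF f] by blast
  have deg: "integral {a..b} f = 0" if "b \<le> a" for a b
    using that by (cases "a = b") auto
  consider "c \<le> x" | "x \<le> c" "c \<le> y" | "y \<le> c" by linarith
  then show "integral {x..y} f = integral_from c f y - integral_from c f x"
  proof cases
    case 1
    then have z: "integral {x..c} f = 0" "integral {y..c} f = 0" using deg xy by auto
    have "integral {c..x} f + integral {x..y} f = integral {c..y} f" using comb 1 xy c by blast
    then show ?thesis unfolding integral_from_def z by (simp add: algebra_simps)
  next
    case 2
    then have z: "integral {c..x} f = 0" "integral {y..c} f = 0" using deg by auto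
    have "integral {x..c} f + integral {c..y} f = integral {x..y} f" using comb 2 xy c by blast
    then show ?thesis unfolding integral_from_def z by (simp add: add.commute)
  next
    case 3
    have xc: "x \<le> c" using xy(3) 3 by (rule order_trans)
    have z: "integral {c..x} f = 0" "integral {c..y} f = 0" using deg[OF xc] deg[OF 3] .
    have "integral {x..y} f + integral {y..c} f = integral {x..c} f" using comb[OF xy(3) 3 xy(1) c] .
    then show ?thesis unfolding integral_from_def z by (simp add: eq_diff_eq)
  qed
qed

section \<open>Linear systems with locally integrable coefficients\<close>

context
  fixes I :: "real set" and a b :: "real \<Rightarrow> complex" and c :: real and u0 v0 :: complex
begin

fun picard_term :: "nat \<Rightarrow> (real \<Rightarrow> complex) \<times> (real \<Rightarrow> complex)" where
  "picard_term 0 = (\<lambda>x. u0, \<lambda>x. v0)"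
| "picard_term (Suc n) =
     (integral_from c (\<lambda>x. a x * snd (picard_term n) x), integral_from c (\<lambda>x. b x * fst (picard_term n) x))"

end

text \<open>
  Since \<open>C K\<^sup>n\<^sup>+\<^sup>1 / (n + 1)!\<close> is a primitive of \<open>C k K\<^sup>n / n!\<close>, every Picard iteration gains one more
  factor of the exponential series. To the left of \<open>c\<close> the same is done with \<open>- K\<close>.
\<close>

lemma picard_step_bound:
  fixes g :: "real \<Rightarrow> complex" and k :: "real \<Rightarrow> real"
  assumes I: "open I" "is_interval I" and c: "c \<in> I" and x: "x \<in> I"
    and K: "ac_primitive I K k" "K c = 0"
    and k0: "\<And>t. k t \<ge> 0" and g: "loc_int I g"
    and le: "\<And>t. t \<in> I \<Longrightarrow> norm (g t) \<le> k t * (C * \<bar>K t\<bar> ^ n / fact n)"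
  shows "norm (integral_from c g x) \<le> C * \<bar>K x\<bar> ^ Suc n / fact (Suc n)"
proof -
  note G = ac_primitive_integral_from[OF I(2) g c]
  have mono: "K s \<le> K t" if "s \<in> I" "t \<in> I" "s \<le> t" for s t
  proof -
    have "0 \<le> integral {s..t} k"
      by (rule integral_nonneg[OF has_integral_integrable[OF ac_primitive_int[OF K(1) that]]]) (rule k0)
    then show ?thesis using integral_unique[OF ac_primitive_int[OF K(1) that]] by simp
  qed
  have primK: "ac_primitive I (\<lambda>t. (C / fact (Suc n)) * L t ^ Suc n) (\<lambda>t. C / fact n * L t ^ n * l t)"
    if "ac_primitive I L l" for L l
  proof -
    have "ac_primitive I (\<lambda>t. (C / fact (Suc n)) * L t ^ Suc n) (\<lambda>t. (C / fact (Suc n)) * (of_nat (Suc n) * L t ^ n * l t))"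
      by (intro ac_primitive_cmult ac_primitive_power I that)
    moreover have "(C / fact (Suc n)) * (of_nat (Suc n) * L t ^ n * l t) = C / fact n * L t ^ n * l t" for t
      by (simp add: field_simps del: of_nat_Suc)
    ultimately show ?thesis by (simp only:)
  qed
  show ?thesis
  proof (cases "c \<le> x")
    case True
    have K0: "0 \<le> K t" if "c \<le> t" "t \<in> I" for t using mono[OF c that(2,1)] K(2) by simp
    have "norm (integral_from c g x - integral_from c g c) \<le> (C / fact (Suc n)) * K x ^ Suc n - (C / fact (Suc n)) * K c ^ Suc n"
    proof (rule ac_primitive_bound[OF G primK[OF K(1)] c x True])
      fix t assume t: "c \<le> t" "t \<le> x"
      then have tI: "t \<in> I" using Icc_subset[OF I(2) c x] by auto
      show "norm (g t) \<le> C / fact n * K t ^ n * k t"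
        using le[OF tI] K0[OF t(1) tI] by (simp add: mult_ac)
    qed
    then show ?thesis using K(2) K0[OF True x] by (simp add: abs_of_nonneg)
  next
    case False
    then have xc: "x \<le> c" by simp
    have K0: "K t \<le> 0" if "t \<le> c" "t \<in> I" for t using mono[OF that(2) c that(1)] K(2) by simp
    have P: "ac_primitive I (\<lambda>t. - ((C / fact (Suc n)) * (- K t) ^ Suc n)) (\<lambda>t. - (C / fact n * (- K t) ^ n * (- k t)))"
      by (intro ac_primitive_minus primK K(1))
    have "norm (integral_from c g c - integral_from c g x) \<le> - ((C / fact (Suc n)) * (- K c) ^ Suc n) - (- ((C / fact (Suc n)) * (- K x) ^ Suc n))"
    proof (rule ac_primitive_bound[OF G P x c xc])
      fix t assume t: "x \<le> t" "t \<le> c"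
      then have tI: "t \<in> I" using Icc_subset[OF I(2) x c] by auto
      show "norm (g t) \<le> - (C / fact n * (- K t) ^ n * (- k t))"
        using le[OF tI] K0[OF t(2) tI] by (simp add: mult_ac abs_of_nonpos)
    qed
    then show ?thesis using K(2) K0[OF xc x] by (simp add: abs_of_nonpos)
  qed
qed

lemma abs_power_le: "\<bar>x\<bar> \<le> B \<Longrightarrow> C \<ge> 0 \<Longrightarrow> C * \<bar>x\<bar> ^ n / fact n \<le> C * (B ^ n / fact n)" for x :: real
  by (simp add: divide_right_mono mult_left_mono power_mono)

text \<open>
  The Picard series converges uniformly on compact subintervals, being dominated by the exponential
  series of \<open>K\<close>, the integral of \<open>|a| + |b|\<close>. It can therefore be integrated term by term, by
  dominated convergence.
\<close>

lemma linear_system_existence: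
  fixes a b :: "real \<Rightarrow> complex"
  assumes I: "open I" "is_interval I" and a: "loc_int I a" and b: "loc_int I b" and c: "c \<in> I"
  obtains u v where "ac_primitive I u (\<lambda>x. a x * v x)" "ac_primitive I v (\<lambda>x. b x * u x)"
    "u c = u0" "v c = v0"
proof -
  define U where "U = (\<lambda>n. fst (picard_term a b c u0 v0 n))"
  define V where "V = (\<lambda>n. snd (picard_term a b c u0 v0 n))"
  have U0: "U 0 = (\<lambda>x. u0)" and V0: "V 0 = (\<lambda>x. v0)" by (auto simp: U_def V_def)
  have US: "U (Suc n) = integral_from c (\<lambda>x. a x * V n x)" and VS: "V (Suc n) = integral_from c (\<lambda>x. b x * U n x)" for n
    by (auto simp: U_def V_def)
  have cont: "continuous_on I (U n) \<and> continuous_on I (V n)" for n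
  proof (induction n)
    case (Suc n)
    then show ?case unfolding US VS
      using primitive_continuous[OF I ac_primitive_integral_from[OF I(2) loc_int_mult(2)[OF I(2) _ a] c]]
        primitive_continuous[OF I ac_primitive_integral_from[OF I(2) loc_int_mult(2)[OF I(2) _ b] c]] by blast
  qed (simp add: U0 V0)
  have pU: "ac_primitive I (U (Suc n)) (\<lambda>x. a x * V n x)" and pV: "ac_primitive I (V (Suc n)) (\<lambda>x. b x * U n x)" for n
    using cont[of n] unfolding US VS by (intro ac_primitive_integral_from I c loc_int_mult a b; simp)+
  define k where "k = (\<lambda>x. norm (a x) + norm (b x))"
  define K where "K = integral_from c k"
  have K: "ac_primitive I K k" "K c = 0"
    unfolding K_def k_def by (auto intro!: ac_primitive_integral_from I c loc_int_add loc_int_norm a b)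
  define C where "C = norm u0 + norm v0"
  have C0: "C \<ge> 0" by (simp add: C_def)
  have k0: "k t \<ge> 0" for t by (simp add: k_def)
  have bnd: "\<forall>x\<in>I. norm (U n x) \<le> C * \<bar>K x\<bar> ^ n / fact n \<and> norm (V n x) \<le> C * \<bar>K x\<bar> ^ n / fact n" for n
  proof (induction n)
    case 0
    then show ?case by (simp add: U0 V0 C_def)
  next
    case (Suc n)
    have le: "norm (\<alpha> * w) \<le> k t * (C * \<bar>K t\<bar> ^ n / fact n)"
      if "norm \<alpha> \<le> k t" "norm w \<le> C * \<bar>K t\<bar> ^ n / fact n" for t and \<alpha> w :: complex
      unfolding norm_mult by (rule mult_mono) (use that k0 in auto)
    show ?case
      unfolding US VS
      by (intro ballI conjI picard_step_bound[OF I c _ K k0] loc_int_mult a b I le)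
         (use Suc cont in \<open>auto simp: k_def\<close>)
  qed
  define u where "u = (\<lambda>x. \<Sum>n. U n x)"
  define v where "v = (\<lambda>x. \<Sum>n. V n x)"
  have cK: "continuous_on I K" by (rule primitive_continuous[OF I K(1)])
  have expsum: "summable (\<lambda>n. C * (B ^ n / fact n))" for B :: real
    by (intro summable_mult summable_exp[of B, unfolded inverse_eq_divide, simplified] |
        use summable_exp[of B] in \<open>simp add: field_simps\<close>)+
  have Kbd: "\<exists>B\<ge>0. \<forall>x\<in>{s..t}. \<bar>K x\<bar> \<le> B" if "s \<in> I" "t \<in> I" for s t
  proof -
    have "bounded (K ` {s..t})"
      by (intro compact_imp_bounded compact_continuous_image continuous_on_subset[OF cK] Icc_subset I that compact_Icc)
    then obtain B where "\<forall>x\<in>{s..t}. \<bar>K x\<bar> \<le> B" unfolding bounded_iff by auto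
    then show ?thesis by (intro exI[of _ "max B 0"]) auto
  qed
  \<comment> \<open>Both equations of the system have this form, with \<open>W\<close> and \<open>W'\<close> the series of the two unknowns.\<close>
  have main: "ac_primitive I w (\<lambda>x. \<gamma> x * w' x)"
    if \<gamma>: "loc_int I \<gamma>" and W: "\<And>n. ac_primitive I (W (Suc n)) (\<lambda>x. \<gamma> x * W' n x)"
      and W0: "\<exists>y. W 0 = (\<lambda>x. y)"
      and w: "w = (\<lambda>x. \<Sum>n. W n x)" and w': "w' = (\<lambda>x. \<Sum>n. W' n x)"
      and bW: "\<And>n x. x \<in> I \<Longrightarrow> norm (W n x) \<le> C * \<bar>K x\<bar> ^ n / fact n"
      and bW': "\<And>n x. x \<in> I \<Longrightarrow> norm (W' n x) \<le> C * \<bar>K x\<bar> ^ n / fact n"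
      and cW': "\<And>n. continuous_on I (W' n)"
    for \<gamma> :: "real \<Rightarrow> complex" and W W' w w'
    unfolding ac_primitive_def
  proof (intro ballI impI)
    fix s t assume st: "s \<in> I" "t \<in> I" "s \<le> t"
    have sub: "{s..t} \<subseteq> I" using Icc_subset I st by blast
    obtain B where B: "B \<ge> 0" "\<And>x. x \<in> {s..t} \<Longrightarrow> \<bar>K x\<bar> \<le> B" using Kbd[OF st(1,2)] by blast
    have M: "norm (W n x) \<le> C * (B ^ n / fact n)" "norm (W' n x) \<le> C * (B ^ n / fact n)" if "x \<in> {s..t}" for x n
      using bW[of x n] bW'[of x n] abs_power_le[OF B(2)[OF that] C0, of n] sub that by force+
    have ul: "uniform_limit {s..t} (\<lambda>n x. \<Sum>i<n. W' i x) w' sequentially"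
      unfolding w' by (rule Weierstrass_m_test[OF M(2) expsum])
    have cw': "continuous_on {s..t} w'"
      by (rule uniform_limit_theorem[OF _ ul])
         (auto intro!: always_eventually continuous_on_sum continuous_on_subset[OF cW' sub])
    have ai: "(\<lambda>x. \<gamma> x * w' x) absolutely_integrable_on {s..t}"
      using continuous_mult_absolutely_integrable[OF cw' loc_int_D[OF \<gamma> st(1,2)]] by (simp add: mult.commute)
    have sW: "summable (\<lambda>n. W n x)" "summable (\<lambda>n. W' n x)" if "x \<in> {s..t}" for x
      by (rule summable_comparison_test'[OF expsum[of B], of 0], use M that in blast)+
    define P where "P = (\<lambda>N x. \<gamma> x * (\<Sum>i<N. W' i x))"
    have P: "(P N has_integral (\<Sum>i<N. W (Suc i) t - W (Suc i) s)) {s..t}" for N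
      unfolding P_def sum_distrib_left
      by (intro has_integral_sum ac_primitive_int[OF W] st finite_lessThan)
    define E where "E = (\<Sum>n. C * (B ^ n / fact n))"
    have E: "norm (\<Sum>i<N. W' i x) \<le> E" if "x \<in> {s..t}" for x N
    proof -
      have "norm (\<Sum>i<N. W' i x) \<le> (\<Sum>i<N. C * (B ^ i / fact i))"
        by (rule sum_norm_le) (use M that in auto)
      also have "\<dots> \<le> E" unfolding E_def
        by (rule sum_le_suminf[OF expsum]) (use B C0 in auto)
      finally show ?thesis .
    qed
    have gint: "(\<lambda>x. E * norm (\<gamma> x)) integrable_on {s..t}"
      by (intro integrable_on_cmult_left loc_int_integrable[OF loc_int_norm[OF \<gamma>]] st |
          rule integrable_on_mult_right)+
    have Pb: "norm (P N x) \<le> E * norm (\<gamma> x)" if "x \<in> {s..t}" for x N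
      using E[OF that, of N] unfolding P_def norm_mult
      by (subst mult.commute) (rule mult_right_mono, auto)
    have Pl: "(\<lambda>N. P N x) \<longlonglongrightarrow> \<gamma> x * w' x" if "x \<in> {s..t}" for x
      unfolding P_def w' by (intro tendsto_intros summable_LIMSEQ sW that)
    have lim: "(\<lambda>N. integral {s..t} (P N)) \<longlonglongrightarrow> integral {s..t} (\<lambda>x. \<gamma> x * w' x)"
      by (rule dominated_convergence(2)[OF _ gint Pb Pl]) (use P in \<open>auto simp: has_integral_integrable_integral\<close>)
    have "(\<lambda>N. \<Sum>i<N. W (Suc i) t - W (Suc i) s) \<longlonglongrightarrow> (\<Sum>i. W (Suc i) t - W (Suc i) s)"
      by (intro summable_LIMSEQ summable_diff; subst summable_Suc_iff; intro sW; use st in auto)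
    moreover have "integral {s..t} (P N) = (\<Sum>i<N. W (Suc i) t - W (Suc i) s)" for N
      using P by (rule integral_unique)
    ultimately have eq: "integral {s..t} (\<lambda>x. \<gamma> x * w' x) = (\<Sum>i. W (Suc i) t - W (Suc i) s)"
      using lim LIMSEQ_unique by auto
    have "(\<Sum>i. W (Suc i) t - W (Suc i) s) = (\<Sum>i. W (Suc i) t) - (\<Sum>i. W (Suc i) s)"
      by (rule suminf_diff[symmetric]; subst summable_Suc_iff; intro sW; use st in auto)
    also have "\<dots> = (w t - W 0 t) - (w s - W 0 s)"
      unfolding w using suminf_split_head[OF sW(1), of t] suminf_split_head[OF sW(1), of s] st by simp
    also have "\<dots> = w t - w s" using W0 by auto
    finally have "integral {s..t} (\<lambda>x. \<gamma> x * w' x) = w t - w s" using eq by simp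
    then show "(\<lambda>x. \<gamma> x * w' x) absolutely_integrable_on {s..t} \<and> ((\<lambda>x. \<gamma> x * w' x) has_integral w t - w s) {s..t}"
      using ai set_lebesgue_integral_eq_integral(1)[OF ai] by (metis integrable_integral)
  qed
  have at_c: "u c = u0" "v c = v0"
  proof -
    have "(\<lambda>n. U n c) = (\<lambda>n. if n = 0 then u0 else 0)" "(\<lambda>n. V n c) = (\<lambda>n. if n = 0 then v0 else 0)"
      by (rule ext, case_tac n; simp add: U0 V0 US VS)+
    then show "u c = u0" "v c = v0" unfolding u_def v_def
      using suminf_finite[of "{0}" "\<lambda>n. if n = 0 then u0 else 0"] suminf_finite[of "{0}" "\<lambda>n. if n = 0 then v0 else 0"] by auto
  qed
  show ?thesis
  proof (rule that)
    show "ac_primitive I u (\<lambda>x. a x * v x)"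
      by (rule main[OF a pU _ u_def v_def]) (use bnd cont U0 in auto)
    show "ac_primitive I v (\<lambda>x. b x * u x)"
      by (rule main[OF b pV _ v_def u_def]) (use bnd cont V0 in auto)
  qed (fact at_c)+
qed

section \<open>The Sturm--Liouville equation as a first-order system\<close>

lemma continuous_ae_eq_imp_eq:
  fixes f g :: "real \<Rightarrow> 'a::euclidean_space"
  assumes I: "open I" and f: "continuous_on I f" and g: "continuous_on I g"
    and ae: "AE x in lebesgue. x \<in> I \<longrightarrow> f x = g x" and x: "x \<in> I"
  shows "f x = g x"
proof (rule ccontr)
  assume ne: "f x \<noteq> g x"
  let ?U = "{y \<in> I. f y - g y \<in> - {0}}"
  have "open ?U"
  proof -
    have "open (I \<inter> (\<lambda>y. f y - g y) -` (- {0}))"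
      by (rule continuous_open_preimage[OF continuous_on_diff[OF f g] I]) auto
    moreover have "I \<inter> (\<lambda>y. f y - g y) -` (- {0}) = ?U" by auto
    ultimately show ?thesis by (simp only:)
  qed
  moreover have "negligible ?U"
  proof -
    obtain N where N: "negligible N" "\<And>x. x \<notin> N \<Longrightarrow> x \<in> I \<Longrightarrow> f x = g x" using ae unfolding AE_negligible by blast
    show ?thesis by (rule negligible_subset[OF N(1)]) (use N(2) in auto)
  qed
  ultimately have "?U = {}" using open_not_negligible by blast
  then show False using x ne by auto
qed

locale sturm_liouville =
  fixes S :: sl_data
  assumes problem: "sl_problem S"
begin

abbreviation "I \<equiv> dom_int S"
abbreviation "p \<equiv> coeff_p S"
abbreviation "q \<equiv> coeff_q S"
abbreviation "r \<equiv> coeff_r S"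

lemma open_I [simp]: "open I"
  by (simp add: dom_int_def)

lemma interval_I [simp]: "is_interval I"
  unfolding is_interval_1 dom_int_def
proof (intro allI ballI impI)
  fix a b x :: real
  assume a: "a \<in> einterval (left_end S) (right_end S)" and b: "b \<in> einterval (left_end S) (right_end S)" and x: "a \<le> x \<and> x \<le> b"
  have "left_end S < ereal x" using a x by (auto simp: einterval_iff intro: less_le_trans[of _ "ereal a"])
  moreover have "ereal x < right_end S" using b x by (auto simp: einterval_iff intro: le_less_trans[of _ "ereal b"])
  ultimately show "x \<in> einterval (left_end S) (right_end S)" by (simp add: einterval_iff)
qed

lemma I_nonempty: "\<exists>c. c \<in> I"
  using problem einterval_nonempty unfolding sl_problem_def dom_int_def by blast

lemma I_lebesgue [simp]: "I \<in> sets lebesgue"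
  using open_I by (simp add: borel_open)

lemma AE_on_I_iff: "(AE x in lebesgue_on I. P x) \<longleftrightarrow> (AE x in lebesgue. x \<in> I \<longrightarrow> P x)"
  by (rule AE_lebesgue_on_iff) simp

lemma r_pos: "AE x in lebesgue. x \<in> I \<longrightarrow> r x > 0" and p_pos: "AE x in lebesgue. x \<in> I \<longrightarrow> p x > 0"
  using problem unfolding sl_problem_def AE_on_I_iff by auto

lemma r_measurable: "r \<in> borel_measurable (lebesgue_on I)"
  using problem unfolding sl_problem_def by auto

lemma loc_int_of_real: "loc_int J f \<Longrightarrow> loc_int J (\<lambda>x. complex_of_real (f x))"
  by (rule loc_int_linear[OF bounded_linear_of_real])

lemma L1_loc_iff: "L1_loc S f \<longleftrightarrow> loc_int I f"
  unfolding L1_loc_def loc_int_def by blast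

lemma loc_int_r_real: "loc_int I r"
  using problem unfolding sl_problem_def L1_loc_iff by blast

lemma loc_int_r: "loc_int I (\<lambda>x. complex_of_real (r x))"
  by (rule loc_int_of_real[OF loc_int_r_real])

lemma loc_int_q: "loc_int I (\<lambda>x. complex_of_real (q x))"
  using problem unfolding sl_problem_def L1_loc_iff by (intro loc_int_of_real) blast

lemma loc_int_inv_p: "loc_int I (\<lambda>x. complex_of_real (1 / p x))"
  using problem unfolding sl_problem_def L1_loc_iff by (intro loc_int_of_real) blast

text \<open>
  This says \<open>\<tau> f = F\<close> with quasi-derivative \<open>h\<close>, as integral equations. It is equivalent to the
  definition through derivatives (\<open>regular_sl_system\<close>, \<open>sl_system_regular\<close>), and all later arguments use
  only this form.
\<close>

definition sl_system :: "(real \<Rightarrow> complex) \<Rightarrow> (real \<Rightarrow> complex) \<Rightarrow> (real \<Rightarrow> complex) \<Rightarrow> bool" where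
  "sl_system f h F \<longleftrightarrow> ac_primitive I f (\<lambda>x. h x / of_real (p x)) \<and>
     ac_primitive I h (\<lambda>x. of_real (q x) * f x - of_real (r x) * F x)"

lemma sl_system_continuous: "sl_system f h F \<Longrightarrow> continuous_on I f" "sl_system f h F \<Longrightarrow> continuous_on I h"
  unfolding sl_system_def by (rule primitive_continuous[OF open_I interval_I], erule conjunct1,
      rule primitive_continuous[OF open_I interval_I], erule conjunct2)

lemma sl_system_cong:
  assumes "sl_system f h F" "\<And>x. x \<in> I \<Longrightarrow> f x = f' x" "\<And>x. x \<in> I \<Longrightarrow> h x = h' x"
    "AE x in lebesgue. x \<in> I \<longrightarrow> F x = F' x"
  shows "sl_system f' h' F'"
  unfolding sl_system_def
proof
  note s = assms(1)[unfolded sl_system_def]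
  show "ac_primitive I f' (\<lambda>x. h' x / of_real (p x))"
  proof (rule ac_primitive_cong_ae[OF _ assms(2) interval_I s[THEN conjunct1]])
    show "AE x in lebesgue. x \<in> I \<longrightarrow> h x / of_real (p x) = h' x / of_real (p x)"
      by (rule AE_I2) (simp add: assms(3))
  qed
  show "ac_primitive I h' (\<lambda>x. of_real (q x) * f' x - of_real (r x) * F' x)"
  proof (rule ac_primitive_cong_ae[OF _ assms(3) interval_I s[THEN conjunct2]])
    show "AE x in lebesgue. x \<in> I \<longrightarrow> of_real (q x) * f x - of_real (r x) * F x = of_real (q x) * f' x - of_real (r x) * F' x"
      using assms(4) by eventually_elim (simp add: assms(2))
  qed
qed

lemma regular_sl_system:
  assumes "tau_regular S f" shows "sl_system f (quasi_deriv S f) (tau S f)"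
proof -
  let ?h = "quasi_deriv S f"
  have qd: "is_quasi_deriv S f ?h"
    using assms unfolding tau_regular_def quasi_deriv_def by (metis someI_ex)
  obtain f' where f': "ac_primitive I f f'" using assms unfolding tau_regular_def AC_loc_iff by blast
  obtain h' where h': "ac_primitive I ?h h'" using qd unfolding is_quasi_deriv_def AC_loc_iff by blast
  have "AE x in lebesgue. x \<in> I \<longrightarrow> f' x = ?h x / of_real (p x)"
    using primitive_vector_derivative_ae[OF open_I interval_I f'] p_pos
      qd[unfolded is_quasi_deriv_def AE_on_I_iff, THEN conjunct2] by eventually_elim auto
  then have 1: "ac_primitive I f (\<lambda>x. ?h x / of_real (p x))"
    by (rule ac_primitive_cong_ae[OF _ refl interval_I f'])
  have "AE x in lebesgue. x \<in> I \<longrightarrow> h' x = of_real (q x) * f x - of_real (r x) * tau S f x"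
    using primitive_vector_derivative_ae[OF open_I interval_I h'] r_pos
    by eventually_elim (auto simp: tau_def)
  then have "ac_primitive I ?h (\<lambda>x. of_real (q x) * f x - of_real (r x) * tau S f x)"
    by (rule ac_primitive_cong_ae[OF _ refl interval_I h'])
  with 1 show ?thesis unfolding sl_system_def by blast
qed

text \<open>
  The quasi-derivative is a choice that is determined only almost everywhere; it is continuous, however,
  and therefore agrees with \<open>h\<close> at every point.
\<close>

lemma sl_system_regular:
  assumes sys: "sl_system f h F"
  shows "tau_regular S f" "\<And>x. x \<in> I \<Longrightarrow> quasi_deriv S f x = h x"
    "AE x in lebesgue. x \<in> I \<longrightarrow> tau S f x = F x"
proof -
  have f: "ac_primitive I f (\<lambda>x. h x / of_real (p x))"
    and h: "ac_primitive I h (\<lambda>x. of_real (q x) * f x - of_real (r x) * F x)"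
    using sys unfolding sl_system_def by auto
  have vd: "AE x in lebesgue. x \<in> I \<longrightarrow> h x = of_real (p x) * vector_derivative f (at x)"
    using primitive_vector_derivative_ae[OF open_I interval_I f] p_pos by eventually_elim auto
  have iq: "is_quasi_deriv S f h" unfolding is_quasi_deriv_def AE_on_I_iff AC_loc_iff using vd h by blast
  then show reg: "tau_regular S f" using f unfolding tau_regular_def AC_loc_iff by blast
  have qd: "is_quasi_deriv S f (quasi_deriv S f)" unfolding quasi_deriv_def using iq by (metis someI_ex)
  note sys' = regular_sl_system[OF reg]
  have ae: "AE x in lebesgue. x \<in> I \<longrightarrow> quasi_deriv S f x = h x"
    using qd[unfolded is_quasi_deriv_def AE_on_I_iff, THEN conjunct2] vd by eventually_elim auto
  show eq: "quasi_deriv S f x = h x" if "x \<in> I" for x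
    by (rule continuous_ae_eq_imp_eq[OF open_I sl_system_continuous(2)[OF sys'] sl_system_continuous(2)[OF sys] ae that])
  have "ac_primitive I (quasi_deriv S f) (\<lambda>x. of_real (q x) * f x - of_real (r x) * F x)"
    by (rule ac_primitive_cong_ae[OF _ _ interval_I h]) (simp_all add: eq)
  from primitive_vector_derivative_ae[OF open_I interval_I this] r_pos
  show "AE x in lebesgue. x \<in> I \<longrightarrow> tau S f x = F x"
    by eventually_elim (auto simp: tau_def)
qed

lemma solution_sl_system:
  assumes "is_solution S z u" shows "sl_system u (quasi_deriv S u) (\<lambda>x. z * u x)"
  using assms unfolding is_solution_def AE_on_I_iff
  by (intro sl_system_cong[OF regular_sl_system[of u]]) simp_all

lemma sl_system_solution: "sl_system u v (\<lambda>x. z * u x) \<Longrightarrow> is_solution S z u"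
  unfolding is_solution_def AE_on_I_iff using sl_system_regular by blast

lemma sl_system_combination:
  assumes f: "sl_system f h F" and g: "sl_system g k G"
  shows "sl_system (\<lambda>x. \<alpha> * f x + \<beta> * g x) (\<lambda>x. \<alpha> * h x + \<beta> * k x) (\<lambda>x. \<alpha> * F x + \<beta> * G x)"
proof -
  note f1 = f[unfolded sl_system_def, THEN conjunct1] and f2 = f[unfolded sl_system_def, THEN conjunct2]
  note g1 = g[unfolded sl_system_def, THEN conjunct1] and g2 = g[unfolded sl_system_def, THEN conjunct2]
  have e1: "\<alpha> * (h x / of_real (p x)) + \<beta> * (k x / of_real (p x)) = (\<alpha> * h x + \<beta> * k x) / of_real (p x)" for x
    by (simp add: add_divide_distrib)
  have e2: "\<alpha> * (of_real (q x) * f x - of_real (r x) * F x) + \<beta> * (of_real (q x) * g x - of_real (r x) * G x)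
      = of_real (q x) * (\<alpha> * f x + \<beta> * g x) - of_real (r x) * (\<alpha> * F x + \<beta> * G x)" for x
    by (simp add: algebra_simps)
  show ?thesis unfolding sl_system_def
    using ac_primitive_add[OF ac_primitive_cmult[OF f1, of \<alpha>] ac_primitive_cmult[OF g1, of \<beta>]]
      ac_primitive_add[OF ac_primitive_cmult[OF f2, of \<alpha>] ac_primitive_cmult[OF g2, of \<beta>]]
    unfolding e1 e2 by blast
qed

lemma sl_system_cnj:
  assumes f: "sl_system f h F"
  shows "sl_system (\<lambda>x. cnj (f x)) (\<lambda>x. cnj (h x)) (\<lambda>x. cnj (F x))"
  using ac_primitive_linear[OF bounded_linear_cnj f[unfolded sl_system_def, THEN conjunct1]]
    ac_primitive_linear[OF bounded_linear_cnj f[unfolded sl_system_def, THEN conjunct2]]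
  unfolding sl_system_def by simp

text \<open>
  The terms with \<open>p\<close> and \<open>q\<close> cancel.
\<close>

lemma wronskian_primitive:
  assumes f: "sl_system f h F" and g: "sl_system g k G"
  shows "ac_primitive I (\<lambda>x. f x * k x - h x * g x) (\<lambda>x. of_real (r x) * (F x * g x - f x * G x))"
proof -
  note f1 = f[unfolded sl_system_def, THEN conjunct1] and f2 = f[unfolded sl_system_def, THEN conjunct2]
  note g1 = g[unfolded sl_system_def, THEN conjunct1] and g2 = g[unfolded sl_system_def, THEN conjunct2]
  have e: "(h x / of_real (p x) * k x + f x * (of_real (q x) * g x - of_real (r x) * G x))
        - ((of_real (q x) * f x - of_real (r x) * F x) * g x + h x * (k x / of_real (p x)))
     = of_real (r x) * (F x * g x - f x * G x)" for x
    by (simp add: right_diff_distrib left_diff_distrib mult_ac)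
  show ?thesis
    using ac_primitive_diff[OF ac_primitive_mult[OF open_I interval_I f1 g2] ac_primitive_mult[OF open_I interval_I f2 g1]]
    unfolding e .
qed

lemma sl_system_existence:
  assumes c: "c \<in> I"
  obtains u v where "sl_system u v (\<lambda>x. z * u x)" "u c = u0" "v c = v0"
proof -
  have "loc_int I (\<lambda>x. of_real (q x) + (- z) * of_real (r x))"
    by (intro loc_int_add loc_int_q loc_int_linear[OF bounded_linear_mult_right] loc_int_r)
  from linear_system_existence[OF open_I interval_I loc_int_inv_p this c]
  obtain u v where uv: "ac_primitive I u (\<lambda>x. of_real (1 / p x) * v x)"
     "ac_primitive I v (\<lambda>x. (of_real (q x) + (- z) * of_real (r x)) * u x)" "u c = u0" "v c = v0"
    .
  have "sl_system u v (\<lambda>x. z * u x)"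
    using uv(1,2) unfolding sl_system_def by (simp add: algebra_simps)
  then show ?thesis using that uv by blast
qed

section \<open>The weighted Hilbert space\<close>

lemma space_weighted [simp]: "space (weighted S) = I"
  and sets_weighted [simp]: "sets (weighted S) = sets (lebesgue_on I)"
  by (simp_all add: weighted_def space_restrict_space)

lemma measurable_weighted [simp]: "borel_measurable (weighted S) = borel_measurable (lebesgue_on I)"
  by (rule measurable_cong_sets) auto

lemma AE_weighted: "(AE x in weighted S. P x) \<longleftrightarrow> (AE x in lebesgue. x \<in> I \<longrightarrow> P x)"
proof -
  have "(AE x in weighted S. P x) \<longleftrightarrow> (AE x in lebesgue_on I. 0 < ennreal (r x) \<longrightarrow> P x)"
    unfolding weighted_def by (rule AE_density) (use r_measurable in measurable)
  also have "\<dots> \<longleftrightarrow> (AE x in lebesgue. x \<in> I \<longrightarrow> P x)"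
    unfolding AE_on_I_iff
  proof
    assume "AE x in lebesgue. x \<in> I \<longrightarrow> 0 < ennreal (r x) \<longrightarrow> P x"
    then show "AE x in lebesgue. x \<in> I \<longrightarrow> P x" using r_pos by eventually_elim auto
  qed auto
  finally show ?thesis .
qed

lemma borel_measurable_ae_on_I:
  fixes f g :: "real \<Rightarrow> complex"
  assumes f: "f \<in> borel_measurable (lebesgue_on I)" and ae: "AE x in lebesgue. x \<in> I \<longrightarrow> f x = g x"
  shows "g \<in> borel_measurable (lebesgue_on I)"
proof -
  have "(\<lambda>x. if x \<in> I then f x else 0) \<in> borel_measurable lebesgue"
    using f by (simp add: borel_measurable_if)
  then have "(\<lambda>x. if x \<in> I then g x else 0) \<in> borel_measurable lebesgue"
    by (rule borel_measurable_AE) (use ae in auto)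
  then show ?thesis by (simp add: borel_measurable_if)
qed

lemma integrable_weighted:
  fixes \<phi> :: "real \<Rightarrow> 'a::euclidean_space"
  assumes "\<phi> \<in> borel_measurable (lebesgue_on I)"
  shows "integrable (weighted S) \<phi> \<longleftrightarrow> (\<lambda>x. r x *\<^sub>R \<phi> x) absolutely_integrable_on I"
    "(LINT x|weighted S. \<phi> x) = (LINT x:I|lebesgue. r x *\<^sub>R \<phi> x)"
proof -
  have r0: "AE x in lebesgue_on I. 0 \<le> r x" unfolding AE_on_I_iff using r_pos by eventually_elim auto
  show "integrable (weighted S) \<phi> \<longleftrightarrow> (\<lambda>x. r x *\<^sub>R \<phi> x) absolutely_integrable_on I"
    unfolding weighted_def integrable_density[OF assms r_measurable r0] set_integrable_def
    by (rule integrable_restrict_space) simp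
  show "(LINT x|weighted S. \<phi> x) = (LINT x:I|lebesgue. r x *\<^sub>R \<phi> x)"
    unfolding weighted_def integral_density[OF assms r_measurable r0] set_lebesgue_integral_def
    by (rule integral_restrict_space) simp
qed

lemma continuous_measurable: "continuous_on I f \<Longrightarrow> (f :: real \<Rightarrow> complex) \<in> borel_measurable (lebesgue_on I)"
  by (rule continuous_imp_measurable_on_sets_lebesgue) auto

lemma L2_r_iff: "f \<in> L2_r S \<longleftrightarrow> f \<in> borel_measurable (lebesgue_on I) \<and> integrable (weighted S) (\<lambda>x. (cmod (f x))\<^sup>2)"
  unfolding L2_r_def by simp

lemma L2_r_measurable: "f \<in> L2_r S \<Longrightarrow> f \<in> borel_measurable (lebesgue_on I)"
  unfolding L2_r_iff by blast

lemma L2_r_norm_bound: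
  assumes g: "g \<in> borel_measurable (lebesgue_on I)" and f: "f1 \<in> L2_r S" "f2 \<in> L2_r S"
    and le: "AE x in lebesgue. x \<in> I \<longrightarrow> cmod (g x) \<le> C * (cmod (f1 x) + cmod (f2 x))"
  shows "g \<in> L2_r S"
  unfolding L2_r_iff
proof
  show "integrable (weighted S) (\<lambda>x. (cmod (g x))\<^sup>2)"
  proof (rule Bochner_Integration.integrable_bound)
    show "integrable (weighted S) (\<lambda>x. 2 * C\<^sup>2 * ((cmod (f1 x))\<^sup>2 + (cmod (f2 x))\<^sup>2))"
      by (rule integrable_mult_right, rule Bochner_Integration.integrable_add) (use f in \<open>auto simp: L2_r_iff\<close>)
    show "(\<lambda>x. (cmod (g x))\<^sup>2) \<in> borel_measurable (weighted S)"
      using g by simp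
    show "AE x in weighted S. norm ((cmod (g x))\<^sup>2) \<le> norm (2 * C\<^sup>2 * ((cmod (f1 x))\<^sup>2 + (cmod (f2 x))\<^sup>2))"
      unfolding AE_weighted using le
    proof eventually_elim
      case (elim x)
      show ?case
      proof
        assume "x \<in> I"
        then have "(cmod (g x))\<^sup>2 \<le> (C * (cmod (f1 x) + cmod (f2 x)))\<^sup>2"
          using elim by (intro power_mono) auto
        also have "\<dots> = C\<^sup>2 * (cmod (f1 x) + cmod (f2 x))\<^sup>2" by (simp add: power_mult_distrib)
        also have "\<dots> \<le> C\<^sup>2 * (2 * ((cmod (f1 x))\<^sup>2 + (cmod (f2 x))\<^sup>2))"
          using sum_squares_bound[of "cmod (f1 x)" "cmod (f2 x)"]
          by (intro mult_left_mono) (auto simp: power2_sum)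
        finally show "norm ((cmod (g x))\<^sup>2) \<le> norm (2 * C\<^sup>2 * ((cmod (f1 x))\<^sup>2 + (cmod (f2 x))\<^sup>2))"
          by (simp add: algebra_simps)
      qed
    qed
  qed
qed (fact g)

lemma L2_r_cong_ae:
  assumes f: "f \<in> L2_r S" and ae: "AE x in lebesgue. x \<in> I \<longrightarrow> f x = g x"
  shows "g \<in> L2_r S"
proof (rule L2_r_norm_bound[OF borel_measurable_ae_on_I[OF L2_r_measurable[OF f] ae] f f])
  show "AE x in lebesgue. x \<in> I \<longrightarrow> cmod (g x) \<le> 1 * (cmod (f x) + cmod (f x))"
    using ae by eventually_elim auto
qed

lemma L2_r_combination:
  assumes f: "f \<in> L2_r S" and g: "g \<in> L2_r S" shows "(\<lambda>x. \<alpha> * f x + \<beta> * g x) \<in> L2_r S"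
proof (rule L2_r_norm_bound[OF _ f g])
  show "(\<lambda>x. \<alpha> * f x + \<beta> * g x) \<in> borel_measurable (lebesgue_on I)"
    using f g by (auto dest!: L2_r_measurable)
  show "AE x in lebesgue. x \<in> I \<longrightarrow> cmod (\<alpha> * f x + \<beta> * g x) \<le> (cmod \<alpha> + cmod \<beta>) * (cmod (f x) + cmod (g x))"
  proof (intro AE_I2 impI)
    fix x
    have "cmod (\<alpha> * f x + \<beta> * g x) \<le> cmod \<alpha> * cmod (f x) + cmod \<beta> * cmod (g x)"
      by (metis norm_mult norm_triangle_ineq)
    also have "\<dots> \<le> (cmod \<alpha> + cmod \<beta>) * (cmod (f x) + cmod (g x))"
      by (simp add: algebra_simps)
    finally show "cmod (\<alpha> * f x + \<beta> * g x) \<le> (cmod \<alpha> + cmod \<beta>) * (cmod (f x) + cmod (g x))" .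
  qed
qed

lemma L2_r_cmult: "f \<in> L2_r S \<Longrightarrow> (\<lambda>x. \<alpha> * f x) \<in> L2_r S"
  using L2_r_combination[of f f \<alpha> 0] by simp

lemma L2_r_cnj:
  assumes f: "f \<in> L2_r S" shows "(\<lambda>x. cnj (f x)) \<in> L2_r S"
proof (rule L2_r_norm_bound[OF _ f f])
  have "cnj \<in> borel_measurable borel"
    by (intro borel_measurable_continuous_onI continuous_intros)
  then show "(\<lambda>x. cnj (f x)) \<in> borel_measurable (lebesgue_on I)"
    by (rule measurable_compose[OF L2_r_measurable[OF f]])
  show "AE x in lebesgue. x \<in> I \<longrightarrow> cmod (cnj (f x)) \<le> 1 * (cmod (f x) + cmod (f x))"
    by (rule AE_I2) simp
qed

lemma L2_r_product_integrable:
  assumes f: "f \<in> L2_r S" and g: "g \<in> L2_r S"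
  shows "integrable (weighted S) (\<lambda>x. f x * g x)"
proof (rule Bochner_Integration.integrable_bound)
  show "integrable (weighted S) (\<lambda>x. (cmod (f x))\<^sup>2 + (cmod (g x))\<^sup>2)"
    using f g unfolding L2_r_iff by auto
  show "(\<lambda>x. f x * g x) \<in> borel_measurable (weighted S)"
    using f g by (auto dest!: L2_r_measurable)
  have "cmod (f x * g x) \<le> (cmod (f x))\<^sup>2 + (cmod (g x))\<^sup>2" for x
  proof -
    have "0 \<le> cmod (f x) * cmod (g x)" by simp
    then show ?thesis using sum_squares_bound[of "cmod (f x)" "cmod (g x)"] unfolding norm_mult by linarith
  qed
  then show "AE x in weighted S. norm (f x * g x) \<le> norm ((cmod (f x))\<^sup>2 + (cmod (g x))\<^sup>2)" by auto
qed

lemma L2_r_product_weight: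
  assumes "f \<in> L2_r S" "g \<in> L2_r S"
  shows "(\<lambda>x. of_real (r x) * (f x * g x)) absolutely_integrable_on I"
    "(LINT x|weighted S. f x * g x) = (LINT x:I|lebesgue. of_real (r x) * (f x * g x))"
proof -
  have m: "(\<lambda>x. f x * g x) \<in> borel_measurable (lebesgue_on I)" using assms by (auto dest!: L2_r_measurable)
  show "(\<lambda>x. of_real (r x) * (f x * g x)) absolutely_integrable_on I"
    using integrable_weighted(1)[OF m] L2_r_product_integrable[OF assms] by (simp add: scaleR_conv_of_real)
  show "(LINT x|weighted S. f x * g x) = (LINT x:I|lebesgue. of_real (r x) * (f x * g x))"
    using integrable_weighted(2)[OF m] by (simp add: scaleR_conv_of_real)
qed

end

section \<open>Limits at the endpoints\<close>

lemma filter_limit_exists: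
  fixes W :: "'a \<Rightarrow> complex"
  assumes F: "F \<noteq> bot"
    and C: "\<And>e. e > 0 \<Longrightarrow> \<exists>P. eventually P F \<and> (\<forall>x y. P x \<and> P y \<longrightarrow> dist (W x) (W y) < e)"
  shows "\<exists>L. (W \<longlongrightarrow> L) F"
proof -
  have "cauchy_filter (filtermap W F)"
    unfolding cauchy_filter_metric_filtermap using C by blast
  moreover have "complete (UNIV :: complex set)" by (rule complete_UNIV)
  moreover have "filtermap W F \<noteq> bot" using F by (simp add: filtermap_bot_iff)
  ultimately have "\<exists>x\<in>UNIV. filtermap W F \<le> nhds x"
    unfolding complete_uniform by simp
  then show ?thesis unfolding filterlim_def by blast
qed

context sturm_liouville
begin

text \<open>
  Filters on the reals, so that the extended reals occur no more after \<open>interval_exhaustion\<close>.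
\<close>

definition "endL = filtermap real_of_ereal (at_right (left_end S))"
definition "endR = filtermap real_of_ereal (at_left (right_end S))"

lemma ends_less: "left_end S < right_end S"
  using problem unfolding sl_problem_def by blast

lemma mem_I_iff: "x \<in> I \<longleftrightarrow> left_end S < ereal x \<and> ereal x < right_end S"
  by (simp add: dom_int_def einterval_iff)

lemma eventually_endL: "eventually P endL \<longleftrightarrow> (\<exists>c\<in>I. \<forall>x\<in>I. x \<le> c \<longrightarrow> P x)"
  unfolding endL_def eventually_filtermap eventually_at_right[OF ends_less]
proof
  assume "\<exists>b>left_end S. \<forall>y>left_end S. y < b \<longrightarrow> P (real_of_ereal y)"
  then obtain b where b: "b > left_end S" "\<And>y. y > left_end S \<Longrightarrow> y < b \<Longrightarrow> P (real_of_ereal y)" by blast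
  obtain c where c: "c \<in> einterval (left_end S) (min b (right_end S))"
    using einterval_nonempty[of "left_end S" "min b (right_end S)"] b ends_less by auto
  show "\<exists>c\<in>I. \<forall>x\<in>I. x \<le> c \<longrightarrow> P x"
  proof (intro bexI ballI impI)
    show "c \<in> I" using c by (simp add: mem_I_iff einterval_iff)
    fix x assume x: "x \<in> I" "x \<le> c"
    have "ereal x \<le> ereal c" using x by simp
    also have "ereal c < b" using c by (simp add: einterval_iff)
    finally show "P x" using b(2)[of "ereal x"] x by (simp add: mem_I_iff)
  qed
next
  assume "\<exists>c\<in>I. \<forall>x\<in>I. x \<le> c \<longrightarrow> P x"
  then obtain c where c: "c \<in> I" "\<And>x. x \<in> I \<Longrightarrow> x \<le> c \<Longrightarrow> P x" by blast
  show "\<exists>b>left_end S. \<forall>y>left_end S. y < b \<longrightarrow> P (real_of_ereal y)"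
  proof (intro exI[of _ "ereal c"] conjI allI impI)
    show "left_end S < ereal c" using c by (simp add: mem_I_iff)
    fix y assume y: "left_end S < y" "y < ereal c"
    then obtain x where x: "y = ereal x" by (cases y) auto
    have "y < right_end S" using y(2) c(1) unfolding mem_I_iff by (meson less_trans)
    then show "P (real_of_ereal y)" using c(2)[of x] y x by (simp add: mem_I_iff)
  qed
qed

lemma eventually_endR: "eventually P endR \<longleftrightarrow> (\<exists>c\<in>I. \<forall>x\<in>I. c \<le> x \<longrightarrow> P x)"
  unfolding endR_def eventually_filtermap eventually_at_left[OF ends_less]
proof
  assume "\<exists>b<right_end S. \<forall>y>b. y < right_end S \<longrightarrow> P (real_of_ereal y)"
  then obtain b where b: "b < right_end S" "\<And>y. y < right_end S \<Longrightarrow> y > b \<Longrightarrow> P (real_of_ereal y)" by blast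
  obtain c where c: "c \<in> einterval (max b (left_end S)) (right_end S)"
    using einterval_nonempty[of "max b (left_end S)" "right_end S"] b ends_less by auto
  show "\<exists>c\<in>I. \<forall>x\<in>I. c \<le> x \<longrightarrow> P x"
  proof (intro bexI ballI impI)
    show "c \<in> I" using c by (simp add: mem_I_iff einterval_iff)
    fix x assume x: "x \<in> I" "c \<le> x"
    have "b < ereal c" using c by (simp add: einterval_iff)
    also have "ereal c \<le> ereal x" using x by simp
    finally show "P x" using b(2)[of "ereal x"] x by (simp add: mem_I_iff)
  qed
next
  assume "\<exists>c\<in>I. \<forall>x\<in>I. c \<le> x \<longrightarrow> P x"
  then obtain c where c: "c \<in> I" "\<And>x. x \<in> I \<Longrightarrow> c \<le> x \<Longrightarrow> P x" by blast
  show "\<exists>b<right_end S. \<forall>y>b. y < right_end S \<longrightarrow> P (real_of_ereal y)"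
  proof (intro exI[of _ "ereal c"] conjI allI impI)
    show "ereal c < right_end S" using c by (simp add: mem_I_iff)
    fix y assume y: "y < right_end S" "ereal c < y"
    then obtain x where x: "y = ereal x" by (cases y) auto
    have "left_end S < y" using y(2) c(1) unfolding mem_I_iff by (meson less_trans)
    then show "P (real_of_ereal y)" using c(2)[of x] y x by (simp add: mem_I_iff)
  qed
qed

lemma endL_nontrivial: "endL \<noteq> bot"
  using eventually_endL[of "\<lambda>_. False"] by (auto simp: trivial_limit_def)

lemma endR_nontrivial: "endR \<noteq> bot"
  using eventually_endR[of "\<lambda>_. False"] by (auto simp: trivial_limit_def)

lemma eventually_endL_in: "eventually (\<lambda>x. x \<in> I) endL" and eventually_endR_in: "eventually (\<lambda>x. x \<in> I) endR"
  using I_nonempty by (auto simp: eventually_endL eventually_endR)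

lemma wronskian_left_eqI:
  assumes "(wronskian S f g \<longlongrightarrow> L) endL" shows "wronskian_left S f g = L"
proof -
  have "((\<lambda>e. wronskian S f g (real_of_ereal e)) \<longlongrightarrow> L) (at_right (left_end S))"
    using assms unfolding endL_def filterlim_filtermap .
  moreover have "at_right (left_end S) \<noteq> bot"
    using endL_nontrivial by (simp add: endL_def filtermap_bot_iff)
  ultimately show ?thesis unfolding wronskian_left_def by (intro tendsto_Lim)
qed

lemma interval_exhaustion:
  obtains l u :: "nat \<Rightarrow> real" where "\<And>n. l n \<in> I" "\<And>n. u n \<in> I" "\<And>n. l n < u n"
    "filterlim l endL sequentially" "filterlim u endR sequentially"
    "\<And>w :: real \<Rightarrow> 'a::euclidean_space. w absolutely_integrable_on I \<Longrightarrow>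
       (\<lambda>n. integral {l n..u n} w) \<longlonglongrightarrow> integral I w"
proof -
  obtain u l :: "nat \<Rightarrow> real" where ul: "einterval (left_end S) (right_end S) = (\<Union>i. {l i .. u i})"
    "incseq u" "decseq l" "\<And>i. l i < u i" "\<And>i. left_end S < l i" "\<And>i. u i < right_end S"
    "(\<lambda>x. ereal (l x)) \<longlonglongrightarrow> left_end S" "(\<lambda>x. ereal (u x)) \<longlonglongrightarrow> right_end S"
    by (rule einterval_Icc_approximation[OF ends_less]) (rule that)
  have IU: "I = (\<Union>i. {l i .. u i})" using ul(1) by (simp add: dom_int_def)
  have l: "l n \<in> I" and u: "u n \<in> I" for n
    unfolding IU using ul(4)[of n] by (auto intro!: exI[of _ n])
  have fl: "filterlim l endL sequentially"
    unfolding filterlim_iff eventually_endL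
  proof (intro allI impI, elim bexE)
    fix P c assume c: "c \<in> I" "\<forall>x\<in>I. x \<le> c \<longrightarrow> P x"
    then have "eventually (\<lambda>n. ereal (l n) < ereal c) sequentially"
      using ul(7) by (intro order_tendstoD(2)) (auto simp: mem_I_iff)
    then show "eventually (\<lambda>n. P (l n)) sequentially"
      by eventually_elim (use c l in auto)
  qed
  have fu: "filterlim u endR sequentially"
    unfolding filterlim_iff eventually_endR
  proof (intro allI impI, elim bexE)
    fix P c assume c: "c \<in> I" "\<forall>x\<in>I. c \<le> x \<longrightarrow> P x"
    then have "eventually (\<lambda>n. ereal c < ereal (u n)) sequentially"
      using ul(8) by (intro order_tendstoD(1)) (auto simp: mem_I_iff)
    then show "eventually (\<lambda>n. P (u n)) sequentially"
      by eventually_elim (use c u in auto)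
  qed
  have conv: "(\<lambda>n. integral {l n..u n} w) \<longlonglongrightarrow> integral I w"
    if w: "w absolutely_integrable_on I" for w :: "real \<Rightarrow> 'a"
  proof -
    have inc: "incseq (\<lambda>i. {l i .. u i})"
    proof (rule incseq_SucI)
      fix n show "{l n..u n} \<subseteq> {l (Suc n)..u (Suc n)}"
        using incseq_SucD[OF ul(2), of n] decseq_SucD[OF ul(3), of n] by auto
    qed
    have "(\<lambda>i. LINT x:{l i .. u i}|lebesgue. w x) \<longlonglongrightarrow> (LINT x:(\<Union>i. {l i .. u i})|lebesgue. w x)"
      by (rule set_integral_cont_up[OF _ inc]) (use w IU in auto)
    moreover have "(LINT x:(\<Union>i. {l i .. u i})|lebesgue. w x) = integral I w"
      unfolding IU[symmetric] by (rule set_lebesgue_integral_eq_integral(2)[OF w])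
    moreover have "(LINT x:{l i .. u i}|lebesgue. w x) = integral {l i .. u i} w" for i
    proof (rule set_lebesgue_integral_eq_integral(2))
      show "w absolutely_integrable_on {l i..u i}"
        by (rule set_integrable_subset[OF w]) (auto simp: IU)
    qed
    ultimately show ?thesis by simp
  qed
  show ?thesis by (rule that[OF l u ul(4) fl fu conv])
qed

lemma absolutely_integrable_loc_int: "w absolutely_integrable_on I \<Longrightarrow> loc_int I w"
  unfolding loc_int_def
proof (intro ballI)
  fix c d assume w: "w absolutely_integrable_on I" and cd: "c \<in> I" "d \<in> I"
  show "w absolutely_integrable_on {c..d}"
    by (rule set_integrable_subset[OF w]) (use Icc_subset[OF interval_I cd] in auto)
qed

text \<open>
  Some compact subinterval carries all but less than \<open>e\<close> of the integral of \<open>|w|\<close>, so an interval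
  outside of it carries less than \<open>e\<close>.
\<close>

lemma absolutely_integrable_tails:
  fixes w :: "real \<Rightarrow> complex"
  assumes w: "w absolutely_integrable_on I" and e: "e > 0"
  obtains c d where "c \<in> I" "d \<in> I"
    "\<And>x y. x \<in> I \<Longrightarrow> y \<in> I \<Longrightarrow> x \<le> y \<Longrightarrow> y \<le> c \<or> d \<le> x \<Longrightarrow> integral {x..y} (\<lambda>t. norm (w t)) < e"
proof -
  let ?n = "\<lambda>t. norm (w t)"
  have n: "?n absolutely_integrable_on I"
    using absolutely_integrable_norm[OF w] unfolding o_def .
  obtain l u :: "nat \<Rightarrow> real" where lu: "\<And>n. l n \<in> I" "\<And>n. u n \<in> I" "\<And>n. l n < u n"
    "(\<lambda>n. integral {l n..u n} ?n) \<longlonglongrightarrow> integral I ?n"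
  proof (rule interval_exhaustion[where ?'a=real])
    fix l u :: "nat \<Rightarrow> real"
    assume a: "\<And>n. l n \<in> I" "\<And>n. u n \<in> I" "\<And>n. l n < u n"
      "\<And>w. w absolutely_integrable_on I \<Longrightarrow> (\<lambda>n. integral {l n..u n} w) \<longlonglongrightarrow> integral I (w :: real \<Rightarrow> real)"
    show thesis by (rule that[OF a(1,2,3) a(4)[OF n]])
  qed
  note ln = absolutely_integrable_loc_int[OF n]
  from order_tendstoD(1)[OF lu(4), of "integral I ?n - e"] e
  obtain N where N: "integral I ?n - e < integral {l N..u N} ?n"
    by (auto simp: eventually_sequentially)
  have le: "integral {x..y} ?n \<le> integral I ?n" if "x \<in> I" "y \<in> I" for x y
    by (rule integral_subset_le[OF Icc_subset[OF interval_I that] loc_int_integrable[OF ln that]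
          set_lebesgue_integral_eq_integral(1)[OF n]]) simp
  have comb: "integral {x..y} ?n + integral {y..z} ?n = integral {x..z} ?n" if "x \<le> y" "y \<le> z" "x \<in> I" "z \<in> I" for x y z
    by (rule Henstock_Kurzweil_Integration.integral_combine[OF that(1,2) loc_int_integrable[OF ln that(3,4)]])
  have nn: "0 \<le> integral {x..y} ?n" if "x \<in> I" "y \<in> I" for x y
    by (rule integral_nonneg[OF loc_int_integrable[OF ln that]]) simp
  show ?thesis
  proof (rule that[OF lu(1)[of N] lu(2)[of N]])
    fix x y assume xy: "x \<in> I" "y \<in> I" "x \<le> y" "y \<le> l N \<or> u N \<le> x"
    note luN = lu(1)[of N] lu(2)[of N] less_imp_le[OF lu(3)[of N]]
    from xy(4) show "integral {x..y} ?n < e"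
    proof
      assume yl: "y \<le> l N"
      have "integral {x..y} ?n + integral {y..l N} ?n + integral {l N..u N} ?n = integral {x..u N} ?n"
        using comb[OF xy(3) yl xy(1) luN(1)] comb[OF order_trans[OF xy(3) yl] luN(3) xy(1) luN(2)] by simp
      then show ?thesis using le[OF xy(1) luN(2)] nn[OF xy(2) luN(1)] N by linarith
    next
      assume ux: "u N \<le> x"
      have "integral {l N..u N} ?n + integral {u N..x} ?n + integral {x..y} ?n = integral {l N..y} ?n"
        using comb[OF luN(3) ux luN(1) xy(1)] comb[OF order_trans[OF luN(3) ux] xy(3) luN(1) xy(2)] by simp
      then show ?thesis using le[OF luN(1) xy(2)] nn[OF luN(2) xy(1)] N by linarith
    qed
  qed
qed

lemma primitive_increment_le:
  fixes w :: "real \<Rightarrow> complex"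
  assumes W: "ac_primitive I W w" and xy: "x \<in> I" "y \<in> I" "x \<le> y"
  shows "norm (W y - W x) \<le> integral {x..y} (\<lambda>t. norm (w t))"
proof -
  note i = ac_primitive_int[OF W xy]
  have "norm (integral {x..y} w) \<le> integral {x..y} (\<lambda>t. norm (w t))"
    by (rule integral_norm_bound_integral[OF has_integral_integrable[OF i]
         loc_int_integrable[OF loc_int_norm[OF ac_primitive_loc_int[OF W]] xy(1,2)]]) simp
  then show ?thesis using i by (simp add: integral_unique)
qed

text \<open>
  Small tails of the density are the Cauchy criterion for its primitive at both ends.
\<close>

lemma primitive_limits:
  fixes w :: "real \<Rightarrow> complex"
  assumes W: "ac_primitive I W w" and w: "w absolutely_integrable_on I"
  obtains L R where "(W \<longlongrightarrow> L) endL" "(W \<longlongrightarrow> R) endR" "R - L = integral I w"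
proof -
  have d: "dist (W x) (W y) < e"
    if h: "\<And>x y. x \<in> I \<Longrightarrow> y \<in> I \<Longrightarrow> x \<le> y \<Longrightarrow> Q x y \<Longrightarrow> integral {x..y} (\<lambda>t. norm (w t)) < e"
      and xy: "x \<in> I" "y \<in> I" "Q x y" "Q y x" for x y e and Q :: "real \<Rightarrow> real \<Rightarrow> bool"
  proof (cases "x \<le> y")
    case True
    then show ?thesis using primitive_increment_le[OF W xy(1,2) True] h[OF xy(1,2) True xy(3)]
      by (simp add: dist_norm norm_minus_commute)
  next
    case False
    then have yx: "y \<le> x" by simp
    show ?thesis using primitive_increment_le[OF W xy(2,1) yx] h[OF xy(2,1) yx xy(4)]
      by (simp add: dist_norm)
  qed
  have "\<exists>L. (W \<longlongrightarrow> L) endL"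
  proof (rule filter_limit_exists[OF endL_nontrivial])
    fix e :: real assume e: "e > 0"
    obtain c d where cd: "c \<in> I" "d \<in> I"
      "\<And>x y. x \<in> I \<Longrightarrow> y \<in> I \<Longrightarrow> x \<le> y \<Longrightarrow> y \<le> c \<or> d \<le> x \<Longrightarrow> integral {x..y} (\<lambda>t. norm (w t)) < e"
      by (rule absolutely_integrable_tails[OF w e]) (rule that)
    show "\<exists>P. eventually P endL \<and> (\<forall>x y. P x \<and> P y \<longrightarrow> dist (W x) (W y) < e)"
      by (intro exI[of _ "\<lambda>x. x \<in> I \<and> x \<le> c"] conjI allI impI d[where Q="\<lambda>x y. y \<le> c"])
         (use cd in \<open>auto simp: eventually_endL\<close>)
  qed
  then obtain L where L: "(W \<longlongrightarrow> L) endL" by blast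
  have "\<exists>R. (W \<longlongrightarrow> R) endR"
  proof (rule filter_limit_exists[OF endR_nontrivial])
    fix e :: real assume e: "e > 0"
    obtain c d where cd: "c \<in> I" "d \<in> I"
      "\<And>x y. x \<in> I \<Longrightarrow> y \<in> I \<Longrightarrow> x \<le> y \<Longrightarrow> y \<le> c \<or> d \<le> x \<Longrightarrow> integral {x..y} (\<lambda>t. norm (w t)) < e"
      by (rule absolutely_integrable_tails[OF w e]) (rule that)
    show "\<exists>P. eventually P endR \<and> (\<forall>x y. P x \<and> P y \<longrightarrow> dist (W x) (W y) < e)"
      by (intro exI[of _ "\<lambda>x. x \<in> I \<and> d \<le> x"] conjI allI impI d[where Q="\<lambda>x y. d \<le> x"])
         (use cd in \<open>auto simp: eventually_endR\<close>)
  qed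
  then obtain R where R: "(W \<longlongrightarrow> R) endR" by blast
  have "R - L = integral I w"
  proof (rule interval_exhaustion[where ?'a=complex])
    fix l u :: "nat \<Rightarrow> real"
    assume a: "\<And>n. l n \<in> I" "\<And>n. u n \<in> I" "\<And>n. l n < u n"
      "filterlim l endL sequentially" "filterlim u endR sequentially"
      "\<And>w. w absolutely_integrable_on I \<Longrightarrow> (\<lambda>n. integral {l n..u n} w) \<longlonglongrightarrow> integral I (w :: real \<Rightarrow> complex)"
    have "(\<lambda>n. W (u n) - W (l n)) \<longlonglongrightarrow> R - L"
      by (intro tendsto_diff filterlim_compose[OF R a(5)] filterlim_compose[OF L a(4)])
    moreover have "W (u n) - W (l n) = integral {l n..u n} w" for n
      by (rule integral_unique[OF ac_primitive_int[OF W a(1,2) less_imp_le[OF a(3)]], symmetric])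
    ultimately show "R - L = integral I w"
      using a(6)[OF w] LIMSEQ_unique by auto
  qed
  then show ?thesis by (rule that[OF L R])
qed

section \<open>Green's formula and the limit point endpoint\<close>

lemma dom_T_maxD:
  assumes "f \<in> dom_T_max S"
  shows "sl_system f (quasi_deriv S f) (tau S f)" "f \<in> L2_r S" "tau S f \<in> L2_r S"
  using assms regular_sl_system unfolding dom_T_max_def by blast+

lemma dom_T_maxI:
  assumes "sl_system f h F" "f \<in> L2_r S" "F \<in> L2_r S"
  shows "f \<in> dom_T_max S"
proof -
  have "AE x in lebesgue. x \<in> I \<longrightarrow> F x = tau S f x"
    using sl_system_regular(3)[OF assms(1)] by eventually_elim auto
  then have "tau S f \<in> L2_r S" by (rule L2_r_cong_ae[OF assms(3)])
  then show ?thesis using sl_system_regular(1)[OF assms(1)] assms(2) unfolding dom_T_max_def by blast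
qed

lemma wronskian_eq:
  assumes "sl_system f h F" "sl_system g k G" "x \<in> I"
  shows "wronskian S f g x = f x * k x - h x * g x"
  using sl_system_regular(2)[OF assms(1,3)] sl_system_regular(2)[OF assms(2,3)] by (simp add: wronskian_def)

lemma wronskian_ac_primitive:
  assumes "sl_system f h F" "sl_system g k G"
  shows "ac_primitive I (wronskian S f g) (\<lambda>x. of_real (r x) * (F x * g x - f x * G x))"
  by (rule ac_primitive_cong_ae[OF _ _ interval_I wronskian_primitive[OF assms]])
     (simp_all add: wronskian_eq[OF assms])

lemma wronskian_derivative_integrable:
  assumes "f \<in> L2_r S" "F \<in> L2_r S" "g \<in> L2_r S" "G \<in> L2_r S"
  shows "(\<lambda>x. of_real (r x) * (F x * g x - f x * G x)) absolutely_integrable_on I"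
    "(LINT x|weighted S. F x * g x - f x * G x) = integral I (\<lambda>x. of_real (r x) * (F x * g x - f x * G x))"
proof -
  note Fg = L2_r_product_weight[OF assms(2,3)] and fG = L2_r_product_weight[OF assms(1,4)]
  have e: "of_real (r x) * (F x * g x) - of_real (r x) * (f x * G x) = of_real (r x) * (F x * g x - f x * G x)" for x
    by (simp add: algebra_simps)
  show ai: "(\<lambda>x. of_real (r x) * (F x * g x - f x * G x)) absolutely_integrable_on I"
    using set_integral_diff(1)[OF Fg(1) fG(1)] unfolding e .
  have "(LINT x|weighted S. F x * g x - f x * G x) = (LINT x|weighted S. F x * g x) - (LINT x|weighted S. f x * G x)"
    by (rule Bochner_Integration.integral_diff[OF L2_r_product_integrable L2_r_product_integrable]) (fact assms)+
  also have "\<dots> = (LINT x:I|lebesgue. of_real (r x) * (F x * g x - f x * G x))"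
    unfolding Fg(2) fG(2) set_integral_diff(2)[OF Fg(1) fG(1), symmetric] e ..
  also have "\<dots> = integral I (\<lambda>x. of_real (r x) * (F x * g x - f x * G x))"
    by (rule set_lebesgue_integral_eq_integral(2)[OF ai])
  finally show "(LINT x|weighted S. F x * g x - f x * G x) = integral I (\<lambda>x. of_real (r x) * (F x * g x - f x * G x))" .
qed

lemma green_limits:
  assumes f: "f \<in> dom_T_max S" and g: "g \<in> dom_T_max S"
  obtains R where "(wronskian S f g \<longlongrightarrow> wronskian_left S f g) endL" "(wronskian S f g \<longlongrightarrow> R) endR"
    "R - wronskian_left S f g = (LINT x|weighted S. tau S f x * g x - f x * tau S g x)"
proof -
  note f = dom_T_maxD[OF f] and g = dom_T_maxD[OF g]
  note w = wronskian_derivative_integrable[OF f(2,3) g(2,3)]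
  show ?thesis
  proof (rule primitive_limits[OF wronskian_ac_primitive[OF f(1) g(1)] w(1)])
    fix L R assume *: "(wronskian S f g \<longlongrightarrow> L) endL" "(wronskian S f g \<longlongrightarrow> R) endR"
      "R - L = integral I (\<lambda>x. of_real (r x) * (tau S f x * g x - f x * tau S g x))"
    then have "wronskian_left S f g = L" by (intro wronskian_left_eqI)
    then show thesis using that[of R] * w(2) by simp
  qed
qed

lemma wronskian_left_tendsto:
  assumes "f \<in> dom_T_max S" "g \<in> dom_T_max S"
  shows "(wronskian S f g \<longlongrightarrow> wronskian_left S f g) endL"
  by (rule green_limits[OF assms])

lemma wronskian_left_sl_systemI:
  assumes "sl_system f h F" "sl_system g k G" "((\<lambda>x. f x * k x - h x * g x) \<longlongrightarrow> L) endL"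
  shows "wronskian_left S f g = L"
proof (rule wronskian_left_eqI, rule Lim_transform_eventually[OF assms(3)])
  show "eventually (\<lambda>x. f x * k x - h x * g x = wronskian S f g x) endL"
    using eventually_endL_in by eventually_elim (simp add: wronskian_eq[OF assms(1,2)])
qed

lemma indicator_measurable_I:
  assumes "A \<in> sets borel" shows "(indicator A :: real \<Rightarrow> complex) \<in> borel_measurable (lebesgue_on I)"
  by (rule measurable_restrict_space1, rule borel_measurable_indicator) (use assms in simp)

lemma L2_r_indicator_iff:
  assumes u: "u \<in> borel_measurable (lebesgue_on I)" and A: "A \<in> sets borel"
  shows "set_integrable (weighted S) A (\<lambda>x. (cmod (u x))\<^sup>2) \<longleftrightarrow> (\<lambda>x. indicator A x * u x) \<in> L2_r S"
proof -
  have m: "(\<lambda>x. indicator A x * u x) \<in> borel_measurable (lebesgue_on I)"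
    using u indicator_measurable_I[OF A] by simp
  have "(cmod (indicator A x * u x))\<^sup>2 = indicator A x *\<^sub>R (cmod (u x))\<^sup>2" for x
    by (simp add: indicator_def)
  then show ?thesis using m unfolding set_integrable_def L2_r_iff by simp
qed

text \<open>
  A solution \<open>u\<close> satisfies \<open>u W(f, g) = f W(u, g) - g W(u, f)\<close>. The coordinates \<open>A = W(u, g)\<close> and
  \<open>B = W(u, f)\<close> have the derivatives \<open>r u (z g - \<tau> g)\<close> and \<open>r u (z f - \<tau> f)\<close>; inserting \<open>u\<close> shows that
  these are bounded by an integrable function times \<open>N = |A| + |B|\<close>. Close to \<open>b\<close> the integral of
  that function is small, so the maximum of \<open>N\<close> over \<open>[d0, y]\<close> exceeds \<open>N(d0)\<close> by at most half of
  itself, and \<open>N\<close> is bounded. Hence \<open>|u|\<close> is bounded by a multiple of \<open>|f| + |g|\<close>.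
\<close>

lemma nonzero_end_wronskian_imp_L2:
  assumes f: "f \<in> dom_T_max S" and g: "g \<in> dom_T_max S"
    and R: "(wronskian S f g \<longlongrightarrow> R) endR" "R \<noteq> 0" and u: "is_solution S z u"
  shows "\<exists>c\<in>I. set_integrable (weighted S) {c..} (\<lambda>x. (cmod (u x))\<^sup>2)"
proof -
  note f = dom_T_maxD[OF f] and g = dom_T_maxD[OF g] and us = solution_sl_system[OF u]
  let ?h = "quasi_deriv S f" and ?k = "quasi_deriv S g" and ?v = "quasi_deriv S u"
  let ?F = "tau S f" and ?G = "tau S g"
  define \<delta> where "\<delta> = cmod R / 2"
  have \<delta>: "\<delta> > 0" using R(2) by (simp add: \<delta>_def)
  have "eventually (\<lambda>x. \<delta> < cmod (wronskian S f g x)) endR"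
    by (rule order_tendstoD(1)[OF tendsto_norm[OF R(1)]]) (use R(2) in \<open>simp add: \<delta>_def\<close>)
  then obtain c1 where c1: "c1 \<in> I" "\<And>x. x \<in> I \<Longrightarrow> c1 \<le> x \<Longrightarrow> \<delta> < cmod (wronskian S f g x)"
    unfolding eventually_endR by blast
  \<comment> \<open>The integrable function of the estimate is \<open>|r| a b / \<delta>\<close>, a product of two square integrable functions.\<close>
  define a where "a = (\<lambda>x. complex_of_real (cmod (f x) + cmod (g x)))"
  define b where "b = (\<lambda>x. complex_of_real (cmod (z * f x - ?F x) + cmod (z * g x - ?G x)))"
  have zf: "(\<lambda>x. z * f x - ?F x) \<in> L2_r S" and zg: "(\<lambda>x. z * g x - ?G x) \<in> L2_r S"
    using L2_r_combination[OF f(2,3), of z "-1"] L2_r_combination[OF g(2,3), of z "-1"] by simp_all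
  have cmodL2: "(\<lambda>x. complex_of_real (cmod (\<phi> x) + cmod (\<eta> x))) \<in> L2_r S" if "\<phi> \<in> L2_r S" "\<eta> \<in> L2_r S" for \<phi> \<eta>
  proof (rule L2_r_norm_bound[OF _ that, where C=1])
    show "(\<lambda>x. complex_of_real (cmod (\<phi> x) + cmod (\<eta> x))) \<in> borel_measurable (lebesgue_on I)"
      using that[THEN L2_r_measurable] by simp
    show "AE x in lebesgue. x \<in> I \<longrightarrow> cmod (complex_of_real (cmod (\<phi> x) + cmod (\<eta> x))) \<le> 1 * (cmod (\<phi> x) + cmod (\<eta> x))"
      by (rule AE_I2) (simp del: of_real_add)
  qed
  have aL: "a \<in> L2_r S" and bL: "b \<in> L2_r S"
    unfolding a_def b_def by (rule cmodL2[OF f(2) g(2)], rule cmodL2[OF zf zg])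
  define w where "w = (\<lambda>x. of_real (r x) * (a x * b x))"
  have wI: "w absolutely_integrable_on I" unfolding w_def by (rule L2_r_product_weight(1)[OF aL bL])
  have nw: "norm (w x) = \<bar>r x\<bar> * ((cmod (f x) + cmod (g x)) * (cmod (z * f x - ?F x) + cmod (z * g x - ?G x)))" for x
    unfolding w_def a_def b_def norm_mult norm_of_real by simp
  have ln: "loc_int I (\<lambda>x. norm (w x))" by (rule loc_int_norm[OF absolutely_integrable_loc_int[OF wI]])
  \<comment> \<open>With the tail \<open>\<delta> / 4\<close> each of \<open>A\<close> and \<open>B\<close> changes by at most a quarter of the maximum of \<open>N\<close>.\<close>
  obtain c2 d2 where d2: "c2 \<in> I" "d2 \<in> I"
    "\<And>x y. x \<in> I \<Longrightarrow> y \<in> I \<Longrightarrow> x \<le> y \<Longrightarrow> y \<le> c2 \<or> d2 \<le> x \<Longrightarrow> integral {x..y} (\<lambda>t. norm (w t)) < \<delta> / 4"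
    by (rule absolutely_integrable_tails[OF wI, of "\<delta> / 4"]) (use \<delta> in simp, rule that)
  define d0 where "d0 = max c1 d2"
  have d0: "d0 \<in> I" "c1 \<le> d0" "d2 \<le> d0" using c1(1) d2(2) by (auto simp: d0_def max_def)
  let ?A = "\<lambda>x. u x * ?k x - ?v x * g x" and ?B = "\<lambda>x. u x * ?h x - ?v x * f x"
  note A = wronskian_primitive[OF us g(1)] and B = wronskian_primitive[OF us f(1)]
  define N where "N = (\<lambda>x. cmod (?A x) + cmod (?B x))"
  have cN: "continuous_on I N"
    unfolding N_def
    by (intro continuous_on_add continuous_on_norm primitive_continuous[OF open_I interval_I A] primitive_continuous[OF open_I interval_I B])
  have u_le: "cmod (u x) \<le> (cmod (f x) + cmod (g x)) * N x / \<delta>" if x: "x \<in> I" "d0 \<le> x" for x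
  proof -
    have W: "wronskian S f g x = f x * ?k x - ?h x * g x" by (simp add: wronskian_def)
    have "u x * wronskian S f g x = f x * ?A x - g x * ?B x" unfolding W by (simp add: algebra_simps)
    then have "cmod (u x) * cmod (wronskian S f g x) \<le> cmod (f x * ?A x) + cmod (g x * ?B x)"
      by (metis norm_mult norm_triangle_ineq4)
    also have "\<dots> \<le> (cmod (f x) + cmod (g x)) * N x"
      unfolding norm_mult N_def by (simp add: algebra_simps)
    finally have 1: "cmod (u x) * cmod (wronskian S f g x) \<le> (cmod (f x) + cmod (g x)) * N x" .
    have "cmod (u x) * \<delta> \<le> cmod (u x) * cmod (wronskian S f g x)"
      using c1(2)[of x] x d0(2) by (intro mult_left_mono) auto
    then show ?thesis using 1 \<delta> by (simp add: pos_le_divide_eq)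
  qed
  have N_bound: "N y \<le> 2 * N d0" if y: "y \<in> I" "d0 \<le> y" for y
  proof -
    have sub: "{d0..y} \<subseteq> I" by (rule Icc_subset[OF interval_I d0(1) y(1)])
    obtain x where x: "x \<in> {d0..y}" "\<And>t. t \<in> {d0..y} \<Longrightarrow> N t \<le> N x"
      using continuous_attains_sup[OF compact_Icc _ continuous_on_subset[OF cN sub]] y(2) by auto
    have xI: "x \<in> I" "d0 \<le> x" using x(1) sub by auto
    define m where "m = N x"
    have m0: "m \<ge> 0" by (simp add: m_def N_def)
    note P = ac_primitive_linear[OF bounded_linear_mult_right[of "m / \<delta>"] ac_primitive_integral_from[OF interval_I ln d0(1)]]
    have inc: "m / \<delta> * integral_from d0 (\<lambda>x. norm (w x)) x - m / \<delta> * integral_from d0 (\<lambda>x. norm (w x)) d0 \<le> m / 4"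
    proof -
      have "integral_from d0 (\<lambda>x. norm (w x)) x - integral_from d0 (\<lambda>x. norm (w x)) d0 = integral {d0..x} (\<lambda>x. norm (w x))"
        by (rule integral_unique[OF ac_primitive_int[OF ac_primitive_integral_from[OF interval_I ln d0(1)] d0(1) xI], symmetric])
      also have "\<dots> \<le> \<delta> / 4" using d2(3)[OF d0(1) xI] d0(3) by simp
      finally have "m / \<delta> * (integral_from d0 (\<lambda>x. norm (w x)) x - integral_from d0 (\<lambda>x. norm (w x)) d0) \<le> m / \<delta> * (\<delta> / 4)"
        using m0 \<delta> by (intro mult_left_mono) auto
      then show ?thesis using \<delta> by (simp add: right_diff_distrib)
    qed
    have pw: "cmod (of_real (r t) * (z * u t * \<phi> t - u t * \<Phi> t)) \<le> m / \<delta> * norm (w t)"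
      if t: "d0 \<le> t" "t \<le> x"
        and le: "cmod (z * \<phi> t - \<Phi> t) \<le> cmod (z * f t - ?F t) + cmod (z * g t - ?G t)" for t \<phi> \<Phi>
    proof -
      have tI: "t \<in> I" using t x(1) sub by auto
      have Nt: "N t \<le> m" unfolding m_def by (rule x(2)) (use t x(1) in auto)
      have "cmod (u t) \<le> (cmod (f t) + cmod (g t)) * m / \<delta>"
        by (rule order_trans[OF u_le[OF tI t(1)]], rule divide_right_mono, rule mult_left_mono[OF Nt]) (use \<delta> in auto)
      then have 1: "cmod (u t) * cmod (z * \<phi> t - \<Phi> t)
          \<le> ((cmod (f t) + cmod (g t)) * m / \<delta>) * (cmod (z * f t - ?F t) + cmod (z * g t - ?G t))"
        using le m0 \<delta> by (intro mult_mono) auto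
      have "cmod (of_real (r t) * (z * u t * \<phi> t - u t * \<Phi> t)) = \<bar>r t\<bar> * (cmod (u t) * cmod (z * \<phi> t - \<Phi> t))"
      proof -
        have e: "of_real (r t) * (z * u t * \<phi> t - u t * \<Phi> t) = of_real (r t) * (u t * (z * \<phi> t - \<Phi> t))"
          by (simp add: algebra_simps)
        show ?thesis unfolding e by (simp only: norm_mult norm_of_real real_norm_def)
      qed
      also have "\<dots> \<le> \<bar>r t\<bar> * (((cmod (f t) + cmod (g t)) * m / \<delta>) * (cmod (z * f t - ?F t) + cmod (z * g t - ?G t)))"
        using 1 by (intro mult_left_mono) auto
      also have "\<dots> = m / \<delta> * norm (w t)" unfolding nw by simp
      finally show ?thesis .
    qed
    have "norm (?A x - ?A d0) \<le> m / 4"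
      by (rule order_trans[OF ac_primitive_bound[OF A P d0(1) xI pw[where \<phi>=g and \<Phi>="?G"]] inc]) auto
    moreover have "norm (?B x - ?B d0) \<le> m / 4"
      by (rule order_trans[OF ac_primitive_bound[OF B P d0(1) xI pw[where \<phi>=f and \<Phi>="?F"]] inc]) auto
    moreover have "cmod (?A x) \<le> cmod (?A d0) + norm (?A x - ?A d0)" "cmod (?B x) \<le> cmod (?B d0) + norm (?B x - ?B d0)"
      by (rule norm_triangle_sub)+
    ultimately have "m \<le> N d0 + m / 2" unfolding m_def N_def by linarith
    then have "m \<le> 2 * N d0" by simp
    moreover have "N y \<le> m" unfolding m_def by (rule x(2)) (use y in auto)
    ultimately show ?thesis by simp
  qed
  have um: "u \<in> borel_measurable (lebesgue_on I)"
    by (rule continuous_measurable[OF sl_system_continuous(1)[OF us]])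
  have "(\<lambda>x. indicator {d0..} x * u x) \<in> L2_r S"
  proof (rule L2_r_norm_bound[OF _ f(2) g(2), where C="2 * N d0 / \<delta>"])
    show "(\<lambda>x. indicator {d0..} x * u x) \<in> borel_measurable (lebesgue_on I)"
      using um indicator_measurable_I[of "{d0..}"] by simp
    show "AE x in lebesgue. x \<in> I \<longrightarrow> cmod (indicator {d0..} x * u x) \<le> 2 * N d0 / \<delta> * (cmod (f x) + cmod (g x))"
    proof (intro AE_I2 impI)
      fix x assume x: "x \<in> I"
      have N0: "0 \<le> N d0" by (simp add: N_def)
      show "cmod (indicator {d0..} x * u x) \<le> 2 * N d0 / \<delta> * (cmod (f x) + cmod (g x))"
      proof (cases "d0 \<le> x")
        case True
        have "cmod (u x) \<le> (cmod (f x) + cmod (g x)) * N x / \<delta>" by (rule u_le[OF x True])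
        also have "\<dots> \<le> (cmod (f x) + cmod (g x)) * (2 * N d0) / \<delta>"
          using N_bound[OF x True] \<delta> by (intro divide_right_mono mult_left_mono) auto
        finally show ?thesis using True by (simp add: mult_ac)
      next
        case False
        then show ?thesis using N0 \<delta> by simp
      qed
    qed
  qed
  then show ?thesis using d0(1) L2_r_indicator_iff[OF um, of "{d0..}"] by auto
qed

lemma limit_point_wronskian_vanishes:
  assumes lp: "limit_point_right S" and f: "f \<in> dom_T_max S" and g: "g \<in> dom_T_max S"
  shows "(wronskian S f g \<longlongrightarrow> 0) endR"
proof (rule green_limits[OF f g])
  fix R assume R: "(wronskian S f g \<longlongrightarrow> R) endR"
  have "R = 0"
  proof (rule ccontr)
    assume "R \<noteq> 0"
    then have "limit_circle_right S"
      unfolding limit_circle_right_def using nonzero_end_wronskian_imp_L2[OF f g R] by blast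
    then show False using lp unfolding limit_point_right_def by blast
  qed
  then show ?thesis using R by simp
qed

section \<open>Algebra of the boundary values\<close>

lemma dom_T_max_combination:
  assumes "f \<in> dom_T_max S" "g \<in> dom_T_max S"
  shows "(\<lambda>x. \<alpha> * f x + \<beta> * g x) \<in> dom_T_max S"
  by (rule dom_T_maxI[OF sl_system_combination[OF dom_T_maxD(1)[OF assms(1)] dom_T_maxD(1)[OF assms(2)]]
       L2_r_combination[OF dom_T_maxD(2)[OF assms(1)] dom_T_maxD(2)[OF assms(2)]]
       L2_r_combination[OF dom_T_maxD(3)[OF assms(1)] dom_T_maxD(3)[OF assms(2)]]])

lemma dom_T_max_cnj:
  assumes "f \<in> dom_T_max S" shows "(\<lambda>x. cnj (f x)) \<in> dom_T_max S"
  by (rule dom_T_maxI[OF sl_system_cnj[OF dom_T_maxD(1)[OF assms]] L2_r_cnj[OF dom_T_maxD(2)[OF assms]]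
       L2_r_cnj[OF dom_T_maxD(3)[OF assms]]])

lemma wronskian_left_combination:
  assumes v: "v \<in> dom_T_max S" and f: "f \<in> dom_T_max S" and g: "g \<in> dom_T_max S"
  shows "wronskian_left S v (\<lambda>x. \<alpha> * f x + \<beta> * g x) = \<alpha> * wronskian_left S v f + \<beta> * wronskian_left S v g"
proof (rule wronskian_left_sl_systemI[OF dom_T_maxD(1)[OF v] sl_system_combination[OF dom_T_maxD(1)[OF f] dom_T_maxD(1)[OF g]]])
  have "((\<lambda>x. \<alpha> * wronskian S v f x + \<beta> * wronskian S v g x) \<longlongrightarrow> \<alpha> * wronskian_left S v f + \<beta> * wronskian_left S v g) endL"
    by (intro tendsto_intros wronskian_left_tendsto v f g)
  then show "((\<lambda>x. v x * (\<alpha> * quasi_deriv S f x + \<beta> * quasi_deriv S g x) - quasi_deriv S v x * (\<alpha> * f x + \<beta> * g x))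
      \<longlongrightarrow> \<alpha> * wronskian_left S v f + \<beta> * wronskian_left S v g) endL"
    by (simp add: wronskian_def algebra_simps)
qed

text \<open>
  The conjugate of the quasi-derivative of a real function is again its quasi-derivative.
\<close>

lemma wronskian_left_real_cnj:
  assumes v: "v \<in> dom_T_max S" "\<And>x. x \<in> I \<Longrightarrow> v x \<in> \<real>" and g: "g \<in> dom_T_max S"
  shows "wronskian_left S v (\<lambda>x. cnj (g x)) = cnj (wronskian_left S v g)"
proof -
  note vs = dom_T_maxD(1)[OF v(1)] and gs = dom_T_maxD(1)[OF g]
  have vc: "sl_system v (\<lambda>x. cnj (quasi_deriv S v x)) (\<lambda>x. cnj (tau S v x))"
    by (rule sl_system_cong[OF sl_system_cnj[OF vs]]) (use v(2) in \<open>auto simp: Reals_cnj_iff\<close>)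
  show ?thesis
  proof (rule wronskian_left_sl_systemI[OF vc sl_system_cnj[OF gs]])
    have ev: "eventually (\<lambda>x. cnj (wronskian S v g x) = v x * cnj (quasi_deriv S g x) - cnj (quasi_deriv S v x) * cnj (g x)) endL"
      using eventually_endL_in
    proof eventually_elim
      case (elim x)
      then have "cnj (v x) = v x" using v(2) by (simp add: Reals_cnj_iff)
      then show ?case by (simp add: wronskian_def)
    qed
    have "((\<lambda>x. cnj (wronskian S v g x)) \<longlongrightarrow> cnj (wronskian_left S v g)) endL"
      by (intro tendsto_cnj wronskian_left_tendsto v g)
    then show "((\<lambda>x. v x * cnj (quasi_deriv S g x) - cnj (quasi_deriv S v x) * cnj (g x)) \<longlongrightarrow> cnj (wronskian_left S v g)) endL"
      by (rule Lim_transform_eventually[OF _ ev])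
  qed
qed

section \<open>Square integrable solutions near the limit point endpoint\<close>

text \<open>
  The weighted square norm over \<open>[c, d]\<close>. With \<open>|r|\<close> instead of \<open>r\<close> the integrand is nonnegative at
  every point and not only almost everywhere.
\<close>

definition energy :: "(real \<Rightarrow> complex) \<Rightarrow> real \<Rightarrow> real \<Rightarrow> real" where
  "energy u c d = integral {c..d} (\<lambda>x. \<bar>r x\<bar> * (cmod (u x))\<^sup>2)"

lemma energy_loc_int:
  assumes "continuous_on I u" shows "loc_int I (\<lambda>x. \<bar>r x\<bar> * (cmod (u x))\<^sup>2)"
proof (rule loc_int_mult(2)[OF interval_I])
  show "continuous_on I (\<lambda>x. (cmod (u x))\<^sup>2)" by (intro continuous_intros assms)
  show "loc_int I (\<lambda>x. \<bar>r x\<bar>)" using loc_int_norm[OF loc_int_r_real] by simp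
qed

lemma energy_nonneg: "continuous_on I u \<Longrightarrow> c \<in> I \<Longrightarrow> d \<in> I \<Longrightarrow> 0 \<le> energy u c d"
  unfolding energy_def by (rule integral_nonneg[OF loc_int_integrable[OF energy_loc_int]]) auto

lemma energy_mono:
  assumes u: "continuous_on I u" and c: "c \<in> I" "d \<in> I" "e \<in> I" "d \<le> e"
  shows "energy u c d \<le> energy u c e"
  unfolding energy_def
  by (rule integral_subset_le[OF _ loc_int_integrable[OF energy_loc_int[OF u]] loc_int_integrable[OF energy_loc_int[OF u]]])
     (use c in auto)

text \<open>
  This is Green's formula for \<open>cnj u\<close> and \<open>u\<close> on \<open>[c, d]\<close>: the Wronskian of the two is \<open>2 \<i>\<close> times the
  imaginary part of \<open>cnj u v\<close>.
\<close>

lemma energy_identity: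
  assumes sys: "sl_system u v (\<lambda>x. z * u x)" and cd: "c \<in> I" "d \<in> I" "c \<le> d"
  shows "Im z * energy u c d = Im (cnj (u c) * v c) - Im (cnj (u d) * v d)"
proof -
  note W = wronskian_primitive[OF sl_system_cnj[OF sys] sys]
  have "((\<lambda>x. (cnj z - z) * of_real (\<bar>r x\<bar> * (cmod (u x))\<^sup>2)) has_integral (cnj z - z) * of_real (energy u c d)) {c..d}"
    unfolding energy_def
    by (rule has_integral_mult_right, rule has_integral_of_real, rule integrable_integral,
        rule loc_int_integrable[OF energy_loc_int[OF sl_system_continuous(1)[OF sys]] cd(1,2)])
  moreover have "AE x in lebesgue. x \<in> I \<longrightarrow>
     of_real (r x) * (cnj (z * u x) * u x - cnj (u x) * (z * u x)) = (cnj z - z) * of_real (\<bar>r x\<bar> * (cmod (u x))\<^sup>2)"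
    using r_pos
  proof eventually_elim
    case (elim x)
    show ?case
    proof
      assume "x \<in> I"
      then have "\<bar>r x\<bar> = r x" using elim by simp
      moreover have "cnj (u x) * u x = of_real ((cmod (u x))\<^sup>2)"
        using complex_norm_square[of "u x"] by (simp add: mult.commute)
      ultimately show "of_real (r x) * (cnj (z * u x) * u x - cnj (u x) * (z * u x)) = (cnj z - z) * of_real (\<bar>r x\<bar> * (cmod (u x))\<^sup>2)"
        by (simp add: algebra_simps)
    qed
  qed
  then have "ac_primitive I (\<lambda>x. cnj (u x) * v x - cnj (v x) * u x) (\<lambda>x. (cnj z - z) * of_real (\<bar>r x\<bar> * (cmod (u x))\<^sup>2))"
    by (rule ac_primitive_cong_ae[OF _ refl interval_I W])
  note ac_primitive_int[OF this cd]
  ultimately have "(cnj z - z) * of_real (energy u c d) = (cnj (u d) * v d - cnj (v d) * u d) - (cnj (u c) * v c - cnj (v c) * u c)"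
    by (rule has_integral_unique)
  then have "Im ((cnj z - z) * of_real (energy u c d)) = Im ((cnj (u d) * v d - cnj (v d) * u d) - (cnj (u c) * v c - cnj (v c) * u c))"
    by simp
  then show ?thesis by (simp add: algebra_simps)
qed

lemma energy_zero_imp:
  assumes u: "continuous_on I u" and cd: "c \<in> I" "d \<in> I" and E: "energy u c d = 0" and x: "c < x" "x < d"
  shows "u x = 0"
proof -
  have sub: "{c<..<d} \<subseteq> I" using Icc_subset[OF interval_I cd] by auto
  let ?g = "\<lambda>x. \<bar>r x\<bar> * (cmod (u x))\<^sup>2"
  have ai: "?g absolutely_integrable_on {c..d}" by (rule loc_int_D[OF energy_loc_int[OF u] cd])
  have "(LINT x|lebesgue. indicator {c..d} x *\<^sub>R ?g x) = 0"
    using set_lebesgue_integral_eq_integral(2)[OF ai] E unfolding energy_def set_lebesgue_integral_def by simp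
  then have "AE x in lebesgue. indicator {c..d} x *\<^sub>R ?g x = 0"
    using integral_nonneg_eq_0_iff_AE[OF ai[unfolded set_integrable_def]] by simp
  with r_pos have "AE x in lebesgue. x \<in> {c<..<d} \<longrightarrow> u x = 0"
  proof eventually_elim
    case (elim y)
    show ?case
    proof
      assume y: "y \<in> {c<..<d}"
      then have "r y > 0" using elim(1) sub by auto
      moreover have "\<bar>r y\<bar> * (cmod (u y))\<^sup>2 = 0" using elim(2) y by (simp add: indicator_def)
      ultimately show "u y = 0" by simp
    qed
  qed
  from continuous_ae_eq_imp_eq[OF _ continuous_on_subset[OF u sub] continuous_on_const this]
  show ?thesis using x by auto
qed

text \<open>
  If \<open>u\<close> vanished on \<open>(c, d)\<close>, then so would the right-hand side of the equation for \<open>v\<close>, and \<open>v\<close> would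
  stay 1; but \<open>v / p\<close> is the derivative of \<open>u\<close>.
\<close>

lemma energy_positive:
  assumes sys: "sl_system u v (\<lambda>x. z * u x)" and cd: "c \<in> I" "d \<in> I" "c < d" and ini: "u c = 0" "v c = 1"
  shows "energy u c d > 0"
proof (rule ccontr)
  assume "\<not> energy u c d > 0"
  then have E: "energy u c d = 0" using energy_nonneg[OF sl_system_continuous(1)[OF sys] cd(1,2)] by simp
  have sub: "{c<..<d} \<subseteq> I" using Icc_subset[OF interval_I cd(1,2)] by auto
  have u0: "u x = 0" if "c \<le> x" "x < d" for x
    using energy_zero_imp[OF sl_system_continuous(1)[OF sys] cd(1,2) E, of x] that ini by (cases "x = c") auto
  have p: "ac_primitive I u (\<lambda>x. v x / of_real (p x))"
    and q: "ac_primitive I v (\<lambda>x. of_real (q x) * u x - of_real (r x) * (z * u x))"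
    using sys unfolding sl_system_def by auto
  have v1: "v x = 1" if x: "c < x" "x < d" for x
  proof -
    have xI: "x \<in> I" using x sub by auto
    have "((\<lambda>x. of_real (q x) * u x - of_real (r x) * (z * u x)) has_integral 0) {c..x}"
      by (rule has_integral_is_0) (use u0 x in auto)
    then have "v x - v c = 0"
      using ac_primitive_int[OF q cd(1) xI less_imp_le[OF x(1)]] has_integral_unique by blast
    then show ?thesis using ini by simp
  qed
  have "AE x in lebesgue. x \<in> {c<..<d} \<longrightarrow> v x = 0"
    using primitive_has_derivative_ae[OF open_I interval_I p] p_pos
  proof eventually_elim
    case (elim x)
    show ?case
    proof
      assume x: "x \<in> {c<..<d}"
      then have xI: "x \<in> I" using sub by auto
      have "((\<lambda>_. 0) has_vector_derivative (0::complex)) (at x)" by simp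
      then have "(u has_vector_derivative 0) (at x)"
        by (rule has_vector_derivative_transform_within_open[where S="{c<..<d}"]) (use x u0 in auto)
      moreover have "(u has_vector_derivative v x / of_real (p x)) (at x)" using elim xI by blast
      ultimately have "v x / of_real (p x) = 0" using vector_derivative_unique_at by blast
      then show "v x = 0" using elim(2) xI by simp
    qed
  qed
  from continuous_ae_eq_imp_eq[OF _ continuous_on_subset[OF sl_system_continuous(2)[OF sys] sub] continuous_on_const this, of "(c + d) / 2"]
  have "v ((c + d) / 2) = 0" using cd by auto
  then show False using v1[of "(c + d) / 2"] cd by auto
qed

text \<open>
  Pointwise \<open>|u + k v|\<^sup>2 \<le> 2 |u|\<^sup>2 + 2 |k v|\<^sup>2\<close>.
\<close>

lemma energy_combination_le:
  assumes u: "continuous_on I u" and v: "continuous_on I v" and cd: "c \<in> I" "d \<in> I"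
  shows "energy (\<lambda>x. u x + k * v x) c d \<le> 2 * energy u c d + 2 * (cmod k)\<^sup>2 * energy v c d"
proof -
  note iu = loc_int_integrable[OF energy_loc_int[OF u] cd] and iv = loc_int_integrable[OF energy_loc_int[OF v] cd]
  have cuv: "continuous_on I (\<lambda>x. u x + k * v x)" by (intro continuous_intros u v)
  have i2: "((\<lambda>x. 2 * (\<bar>r x\<bar> * (cmod (u x))\<^sup>2) + 2 * (cmod k)\<^sup>2 * (\<bar>r x\<bar> * (cmod (v x))\<^sup>2)) has_integral
      2 * energy u c d + 2 * (cmod k)\<^sup>2 * energy v c d) {c..d}"
    unfolding energy_def
    by (rule has_integral_add; rule has_integral_mult_right; rule integrable_integral) (fact iu iv)+
  have "energy (\<lambda>x. u x + k * v x) c d \<le> integral {c..d} (\<lambda>x. 2 * (\<bar>r x\<bar> * (cmod (u x))\<^sup>2) + 2 * (cmod k)\<^sup>2 * (\<bar>r x\<bar> * (cmod (v x))\<^sup>2))"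
    unfolding energy_def
  proof (rule integral_le[OF loc_int_integrable[OF energy_loc_int[OF cuv] cd] has_integral_integrable[OF i2]])
    fix x assume "x \<in> {c..d}"
    have "(cmod (u x + k * v x))\<^sup>2 \<le> (cmod (u x) + cmod k * cmod (v x))\<^sup>2"
      by (rule power_mono) (metis norm_mult norm_triangle_ineq, simp)
    also have "\<dots> \<le> 2 * (cmod (u x))\<^sup>2 + 2 * (cmod k * cmod (v x))\<^sup>2"
      using sum_squares_bound[of "cmod (u x)" "cmod k * cmod (v x)"] by (simp add: power2_sum)
    finally have "\<bar>r x\<bar> * (cmod (u x + k * v x))\<^sup>2 \<le> \<bar>r x\<bar> * (2 * (cmod (u x))\<^sup>2 + 2 * (cmod k * cmod (v x))\<^sup>2)"
      by (rule mult_left_mono) simp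
    then show "\<bar>r x\<bar> * (cmod (u x + k * v x))\<^sup>2 \<le> 2 * (\<bar>r x\<bar> * (cmod (u x))\<^sup>2) + 2 * (cmod k)\<^sup>2 * (\<bar>r x\<bar> * (cmod (v x))\<^sup>2)"
      by (simp add: power_mult_distrib algebra_simps)
  qed
  then show ?thesis using i2 by (simp add: integral_unique)
qed

lemma bounded_energy_imp_L2_right:
  assumes u: "continuous_on I u" and c: "c \<in> I" and B: "\<And>d. d \<in> I \<Longrightarrow> c \<le> d \<Longrightarrow> energy u c d \<le> B"
  shows "(\<lambda>x. indicator {c..} x * u x) \<in> L2_r S"
proof -
  let ?g = "\<lambda>x. \<bar>r x\<bar> * (cmod (u x))\<^sup>2"
  obtain l d :: "nat \<Rightarrow> real" where d: "\<And>n. d n \<in> I" "filterlim d endR sequentially"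
    by (rule interval_exhaustion[where ?'a=real]) (rule that)
  \<comment> \<open>Partial maxima turn the exhausting sequence into an increasing one, for monotone convergence.\<close>
  define e where "e = (\<lambda>n. Max (insert c (d ` {..n})))"
  have eI: "e n \<in> I" for n
    using Max_in[of "insert c (d ` {..n})"] d(1) c unfolding e_def by auto
  have ce: "c \<le> e n" for n unfolding e_def by (rule Max_ge) auto
  have emono: "e m \<le> e n" if "m \<le> n" for m n
    unfolding e_def by (rule Max_mono) (use that in auto)
  have de: "d n \<le> e n" for n unfolding e_def by (rule Max_ge) auto
  have ai: "?g absolutely_integrable_on {c..e n}" for n
    by (rule loc_int_D[OF energy_loc_int[OF u] c eI])
  let ?f = "\<lambda>n x. indicator {c..e n} x *\<^sub>R ?g x"
  let ?h = "\<lambda>x. indicator (I \<inter> {c..}) x *\<^sub>R ?g x"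
  have intf: "integral\<^sup>L lebesgue (?f n) = energy u c (e n)" for n
    using set_lebesgue_integral_eq_integral(2)[OF ai] unfolding energy_def set_lebesgue_integral_def .
  have lim: "(\<lambda>n. ?f n x) \<longlonglongrightarrow> ?h x" for x
  proof (rule tendsto_eventually)
    show "eventually (\<lambda>n. ?f n x = ?h x) sequentially"
    proof (cases "x \<in> I \<and> c \<le> x")
      case True
      have "eventually (\<lambda>y. x \<le> y) endR" unfolding eventually_endR using True by blast
      then have "eventually (\<lambda>n. x \<le> d n) sequentially" using d(2) unfolding filterlim_iff by blast
      then show ?thesis
      proof eventually_elim
        case (elim n)
        then have "x \<le> e n" using de[of n] by simp
        then show ?case using True by simp
      qed
    next
      case False
      have a: "x \<notin> {c..e n}" for n using False Icc_subset[OF interval_I c eI[of n]] by auto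
      have b: "x \<notin> I \<inter> {c..}" using False by auto
      show ?thesis unfolding indicator_simps(2)[OF a] indicator_simps(2)[OF b] by simp
    qed
  qed
  have inc: "incseq (\<lambda>n. energy u c (e n))"
    by (rule incseq_SucI, rule energy_mono[OF u c eI eI emono]) simp
  obtain E where E: "(\<lambda>n. energy u c (e n)) \<longlonglongrightarrow> E"
    using incseq_convergent[OF inc, of B] B[OF eI ce] by blast
  have "integrable lebesgue ?h"
  proof (rule integrable_monotone_convergence)
    show "integrable lebesgue (?f n)" for n using ai[of n] unfolding set_integrable_def .
    show "AE x in lebesgue. mono (\<lambda>n. ?f n x)"
    proof (intro AE_I2 monoI)
      fix x m n :: nat and y :: real assume "m \<le> n"
      then have "indicator {c..e m} y \<le> (indicator {c..e n} y :: real)"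
        using emono[of m n] by (auto simp: indicator_def)
      then show "?f m y \<le> ?f n y" by (simp add: mult_right_mono)
    qed
    show "AE x in lebesgue. (\<lambda>n. ?f n x) \<longlonglongrightarrow> ?h x" using lim by (intro AE_I2)
    show "(\<lambda>n. integral\<^sup>L lebesgue (?f n)) \<longlonglongrightarrow> E" unfolding intf by (rule E)
    show "?h \<in> borel_measurable lebesgue"
      by (rule borel_measurable_LIMSEQ_real[OF lim])
         (use ai in \<open>auto simp: set_integrable_def dest: borel_measurable_integrable\<close>)
  qed
  then have h: "set_integrable lebesgue I (\<lambda>x. indicator {c..} x *\<^sub>R ?g x)"
    unfolding set_integrable_def by (simp add: indicator_inter_arith mult.assoc)
  have um: "u \<in> borel_measurable (lebesgue_on I)" by (rule continuous_measurable[OF u])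
  have m: "(\<lambda>x. indicator {c..} x * u x) \<in> borel_measurable (lebesgue_on I)"
    using um indicator_measurable_I[of "{c..}"] by simp
  have m2: "(\<lambda>x. (cmod (indicator {c..} x * u x))\<^sup>2) \<in> borel_measurable (lebesgue_on I)"
    using m by simp
  obtain N where N: "negligible N" "\<And>x. x \<notin> N \<Longrightarrow> x \<in> I \<Longrightarrow> r x > 0"
    using r_pos unfolding AE_negligible by blast
  have "(\<lambda>x. r x *\<^sub>R (cmod (indicator {c..} x * u x))\<^sup>2) absolutely_integrable_on I"
  proof (rule absolutely_integrable_spike[OF h N(1)])
    fix x assume "x \<in> I - N"
    then have "\<bar>r x\<bar> = r x" using N(2)[of x] by simp
    then show "r x *\<^sub>R (cmod (indicator {c..} x * u x))\<^sup>2 = indicator {c..} x *\<^sub>R ?g x"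
      by (simp add: indicator_def)
  qed
  then show ?thesis unfolding L2_r_iff integrable_weighted(1)[OF m2] using m by blast
qed

text \<open>
  For \<open>d > c\<close> choose \<open>m\<close> such that \<open>\<theta> + m \<phi>\<close> vanishes at \<open>d\<close>; this is possible because a nonzero
  \<open>Im z\<close> forbids \<open>\<phi>(d) = 0\<close>. The energy identity then reads \<open>Im z E(c, d) = Im m\<close>. Compared with the
  energy on a fixed interval \<open>[c, c']\<close>, which is quadratic in \<open>m\<close>, it bounds \<open>|m|\<close> independently of
  \<open>d\<close>. A limit point \<open>\<mu>\<close> of these \<open>m\<close> as \<open>d\<close> tends to \<open>b\<close> gives a solution \<open>\<theta> + \<mu> \<phi>\<close> of bounded
  energy.
\<close>

lemma weyl_solution:
  assumes z: "z \<notin> \<real>" and c: "c \<in> I"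
  obtains u v where "sl_system u v (\<lambda>x. z * u x)" "u c = 1" "(\<lambda>x. indicator {c..} x * u x) \<in> L2_r S"
proof -
  have Imz: "\<bar>Im z\<bar> > 0" using z by (simp add: complex_is_Real_iff)
  obtain \<theta> \<theta>' where th: "sl_system \<theta> \<theta>' (\<lambda>x. z * \<theta> x)" "\<theta> c = 1" "\<theta>' c = 0"
    by (rule sl_system_existence[OF c]) (rule that)
  obtain \<phi> \<phi>' where ph: "sl_system \<phi> \<phi>' (\<lambda>x. z * \<phi> x)" "\<phi> c = 0" "\<phi>' c = 1"
    by (rule sl_system_existence[OF c]) (rule that)
  note c\<theta> = sl_system_continuous(1)[OF th(1)] and c\<phi> = sl_system_continuous(1)[OF ph(1)]
  have sys: "sl_system (\<lambda>x. \<theta> x + m * \<phi> x) (\<lambda>x. \<theta>' x + m * \<phi>' x) (\<lambda>x. z * (\<theta> x + m * \<phi> x))" for m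
    using sl_system_combination[OF th(1) ph(1), of 1 m] by (simp add: algebra_simps)
  have cont: "continuous_on I (\<lambda>x. \<theta> x + m * \<phi> x)" for m by (rule sl_system_continuous(1)[OF sys])
  have energy_dirichlet: "\<bar>Im z\<bar> * energy (\<lambda>x. \<theta> x + m * \<phi> x) c d \<le> cmod m"
    if d: "d \<in> I" "c \<le> d" and m: "\<theta> d + m * \<phi> d = 0" for m d
  proof -
    have "Im z * energy (\<lambda>x. \<theta> x + m * \<phi> x) c d = Im m"
      using energy_identity[OF sys[of m] c d] m th ph by simp
    then have "\<bar>Im z\<bar> * energy (\<lambda>x. \<theta> x + m * \<phi> x) c d = \<bar>Im m\<bar>"
      using energy_nonneg[OF cont[of m] c d(1)] by (metis abs_mult abs_of_nonneg)
    then show ?thesis using abs_Im_le_cmod[of m] by simp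
  qed
  define m where "m = (\<lambda>d. - \<theta> d / \<phi> d)"
  have m: "\<theta> d + m d * \<phi> d = 0" if d: "d \<in> I" "c < d" for d
  proof -
    have "Im z * energy \<phi> c d \<noteq> 0" using energy_positive[OF ph(1) c d ph(2,3)] Imz by auto
    then have "\<phi> d \<noteq> 0" using energy_identity[OF ph(1) c d(1) less_imp_le[OF d(2)]] ph(2) by auto
    then show ?thesis by (simp add: m_def)
  qed
  obtain c' where c': "c' \<in> I" "c < c'"
  proof -
    obtain \<epsilon> where "\<epsilon> > 0" "ball c \<epsilon> \<subseteq> I" using open_I c by (meson open_contains_ball)
    then show thesis by (intro that[of "c + \<epsilon> / 2"]) (auto simp: dist_real_def)
  qed
  define P where "P = energy \<phi> c c'"
  define Q where "Q = energy \<theta> c c'"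
  have P: "P > 0" unfolding P_def by (rule energy_positive[OF ph(1) c c' ph(2,3)])
  have Q: "Q \<ge> 0" unfolding Q_def by (rule energy_nonneg[OF c\<theta> c c'(1)])
  \<comment> \<open>For \<open>|m| > 1\<close> the estimate \<open>|m|\<^sup>2 P \<le> 2 |m| / |Im z| + 2 Q\<close> can be divided by \<open>|m|\<close>.\<close>
  define B where "B = max 1 ((2 / \<bar>Im z\<bar> + 2 * Q) / P)"
  have bound: "cmod (m d) \<le> B" if d: "d \<in> I" "c' \<le> d" for d
  proof (cases "cmod (m d) \<le> 1")
    case False
    let ?\<mu> = "cmod (m d)"
    have \<mu>: "?\<mu> > 1" using False by simp
    have md: "\<theta> d + m d * \<phi> d = 0" using m d c' by simp
    have "energy (\<lambda>x. \<theta> x + m d * \<phi> x) c c' \<le> energy (\<lambda>x. \<theta> x + m d * \<phi> x) c d"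
      by (rule energy_mono[OF cont c c'(1) d])
    also have "\<dots> \<le> ?\<mu> / \<bar>Im z\<bar>"
      using energy_dirichlet[OF d(1) _ md] Imz c' d by (simp add: pos_le_divide_eq mult.commute)
    finally have e1: "energy (\<lambda>x. \<theta> x + m d * \<phi> x) c c' \<le> ?\<mu> / \<bar>Im z\<bar>" .
    have "energy (\<lambda>x. m d * \<phi> x) c c' = energy (\<lambda>x. (\<theta> x + m d * \<phi> x) + (-1) * \<theta> x) c c'" by simp
    also have "\<dots> \<le> 2 * energy (\<lambda>x. \<theta> x + m d * \<phi> x) c c' + 2 * (cmod (-1))\<^sup>2 * Q"
      unfolding Q_def by (rule energy_combination_le[OF cont c\<theta> c c'(1)])
    finally have "energy (\<lambda>x. m d * \<phi> x) c c' \<le> 2 * (?\<mu> / \<bar>Im z\<bar>) + 2 * Q" using e1 by simp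
    moreover have "energy (\<lambda>x. m d * \<phi> x) c c' = ?\<mu>\<^sup>2 * P"
    proof -
      have "energy (\<lambda>x. m d * \<phi> x) c c' = integral {c..c'} (\<lambda>x. ?\<mu>\<^sup>2 * (\<bar>r x\<bar> * (cmod (\<phi> x))\<^sup>2))"
        unfolding energy_def by (simp add: norm_mult power_mult_distrib mult_ac)
      then show ?thesis unfolding P_def energy_def by simp
    qed
    ultimately have "?\<mu> * (?\<mu> * P) \<le> 2 * (?\<mu> / \<bar>Im z\<bar>) + 2 * Q" by (simp add: power2_eq_square mult.assoc)
    also have "\<dots> \<le> 2 * (?\<mu> / \<bar>Im z\<bar>) + ?\<mu> * (2 * Q)"
      using mult_right_mono[of 1 ?\<mu> "2 * Q"] \<mu> Q by simp
    also have "\<dots> = ?\<mu> * (2 / \<bar>Im z\<bar> + 2 * Q)" by (simp add: distrib_left mult.commute)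
    finally have "?\<mu> * P \<le> 2 / \<bar>Im z\<bar> + 2 * Q"
      by (rule mult_left_le_imp_le[OF _ order_less_trans[OF zero_less_one \<mu>]])
    then show ?thesis unfolding B_def using P by (simp add: pos_le_divide_eq le_max_iff_disj)
  qed (simp add: B_def)
  obtain l d :: "nat \<Rightarrow> real" where d: "\<And>n. d n \<in> I" "filterlim d endR sequentially"
    by (rule interval_exhaustion[where ?'a=real]) (rule that)
  define e where "e = (\<lambda>n. max c' (d n))"
  have eI: "e n \<in> I" and ec: "c' \<le> e n" for n using d(1) c'(1) by (auto simp: e_def max_def)
  have "bounded (range (\<lambda>n. m (e n)))"
    unfolding bounded_iff by (intro exI[of _ B]) (auto intro: bound[OF eI ec])
  from bounded_imp_convergent_subsequence[OF this]
  obtain \<mu> \<rho> where \<mu>: "strict_mono (\<rho> :: nat \<Rightarrow> nat)" "(\<lambda>n. m (e (\<rho> n))) \<longlonglongrightarrow> \<mu>"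
    unfolding o_def by blast
  have energy_lim: "energy (\<lambda>x. \<theta> x + \<mu> * \<phi> x) c t \<le> 2 * (B / \<bar>Im z\<bar>) + 1" if t: "t \<in> I" "c \<le> t" for t
  proof -
    have "(\<lambda>n. 2 * (cmod (\<mu> - m (e (\<rho> n))))\<^sup>2 * energy \<phi> c t) \<longlonglongrightarrow> 2 * (cmod (\<mu> - \<mu>))\<^sup>2 * energy \<phi> c t"
      by (intro tendsto_intros \<mu>(2))
    then have "eventually (\<lambda>n. 2 * (cmod (\<mu> - m (e (\<rho> n))))\<^sup>2 * energy \<phi> c t < 1) sequentially"
      by (rule order_tendstoD(2)) simp
    moreover have "eventually (\<lambda>n. t \<le> d (\<rho> n)) sequentially"
    proof -
      have "eventually (\<lambda>y. t \<le> y) endR" unfolding eventually_endR using t by blast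
      then show ?thesis
        by (rule eventually_compose_filterlim[OF _ filterlim_compose[OF d(2) filterlim_subseq[OF \<mu>(1)]]])
    qed
    ultimately have "eventually (\<lambda>n. 2 * (cmod (\<mu> - m (e (\<rho> n))))\<^sup>2 * energy \<phi> c t < 1 \<and> t \<le> d (\<rho> n)) sequentially"
      by (rule eventually_conj)
    then obtain n where n: "2 * (cmod (\<mu> - m (e (\<rho> n))))\<^sup>2 * energy \<phi> c t < 1" "t \<le> d (\<rho> n)"
      unfolding eventually_sequentially by blast
    let ?e = "e (\<rho> n)"
    have te: "t \<le> ?e" using n(2) by (simp add: e_def)
    have ce: "c < ?e" using ec[of "\<rho> n"] c'(2) by simp
    have "energy (\<lambda>x. \<theta> x + \<mu> * \<phi> x) c t = energy (\<lambda>x. (\<theta> x + m ?e * \<phi> x) + (\<mu> - m ?e) * \<phi> x) c t"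
      by (simp add: algebra_simps)
    also have "\<dots> \<le> 2 * energy (\<lambda>x. \<theta> x + m ?e * \<phi> x) c t + 2 * (cmod (\<mu> - m ?e))\<^sup>2 * energy \<phi> c t"
      by (rule energy_combination_le[OF cont c\<phi> c t(1)])
    also have "\<dots> \<le> 2 * (B / \<bar>Im z\<bar>) + 1"
    proof -
      have "energy (\<lambda>x. \<theta> x + m ?e * \<phi> x) c t \<le> energy (\<lambda>x. \<theta> x + m ?e * \<phi> x) c ?e"
        by (rule energy_mono[OF cont c t(1) eI te])
      also have "\<dots> \<le> cmod (m ?e) / \<bar>Im z\<bar>"
        using energy_dirichlet[OF eI less_imp_le[OF ce] m[OF eI ce]] Imz by (simp add: pos_le_divide_eq mult.commute)
      also have "\<dots> \<le> B / \<bar>Im z\<bar>"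
        by (rule divide_right_mono[OF bound[OF eI ec]]) simp
      finally show ?thesis using n(1) by simp
    qed
    finally show ?thesis .
  qed
  show ?thesis
    by (rule that[OF sys[of \<mu>] _ bounded_energy_imp_L2_right[OF cont c energy_lim]]) (simp_all add: th ph)
qed

lemma L2_r_from_halves:
  assumes u: "continuous_on I u" and c: "c \<in> I" "c' \<in> I"
    and L: "(\<lambda>x. indicator {..c'} x * u x) \<in> L2_r S" and R: "(\<lambda>x. indicator {c..} x * u x) \<in> L2_r S"
  shows "u \<in> L2_r S"
proof -
  have um: "u \<in> borel_measurable (lebesgue_on I)" by (rule continuous_measurable[OF u])
  \<comment> \<open>The two halves may leave a compact gap \<open>[c', c]\<close>.\<close>
  have M: "(\<lambda>x. indicator {c'..c} x * u x) \<in> L2_r S"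
  proof -
    have m: "(\<lambda>x. indicator {c'..c} x * u x) \<in> borel_measurable (lebesgue_on I)"
      using um indicator_measurable_I[of "{c'..c}"] by simp
    have m2: "(\<lambda>x. (cmod (indicator {c'..c} x * u x))\<^sup>2) \<in> borel_measurable (lebesgue_on I)"
      using m by simp
    have ai: "(\<lambda>x. (cmod (u x))\<^sup>2 * r x) absolutely_integrable_on {c'..c}"
      by (rule continuous_mult_absolutely_integrable[OF _ loc_int_D[OF loc_int_r_real c(2,1)]])
         (intro continuous_intros continuous_on_subset[OF u Icc_subset[OF interval_I c(2,1)]])
    have e: "indicator I x *\<^sub>R (r x *\<^sub>R (cmod (indicator {c'..c} x * u x))\<^sup>2) = indicator {c'..c} x *\<^sub>R ((cmod (u x))\<^sup>2 * r x)" for x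
      using Icc_subset[OF interval_I c(2,1)] by (auto simp: indicator_def)
    have "(\<lambda>x. r x *\<^sub>R (cmod (indicator {c'..c} x * u x))\<^sup>2) absolutely_integrable_on I"
      using ai unfolding set_integrable_def e .
    then show ?thesis unfolding L2_r_iff integrable_weighted(1)[OF m2] using m by blast
  qed
  show ?thesis
  proof (rule L2_r_norm_bound[OF um L L2_r_combination[OF M R, of 1 1], where C=1])
    show "AE x in lebesgue. x \<in> I \<longrightarrow> cmod (u x) \<le> 1 * (cmod (indicator {..c'} x * u x)
        + cmod (1 * (indicator {c'..c} x * u x) + 1 * (indicator {c..} x * u x)))"
    proof (intro AE_I2 impI)
      fix x
      have "cmod (u x) \<le> cmod (u x + u x)" by (simp add: mult_2[symmetric] norm_mult)
      then show "cmod (u x) \<le> 1 * (cmod (indicator {..c'} x * u x)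
        + cmod (1 * (indicator {c'..c} x * u x) + 1 * (indicator {c..} x * u x)))"
        by (auto simp: indicator_def)
    qed
  qed
qed

end

section \<open>The solutions \<open>\<psi>(z)\<close>\<close>

locale limit_circle_point = sturm_liouville +
  fixes v1 v2 :: "real \<Rightarrow> complex"
  assumes lc: "limit_circle_left S" and lp: "limit_point_right S" and frame: "boundary_frame S v1 v2"
begin

abbreviation "b0 \<equiv> bv0 S v2"
abbreviation "b1 \<equiv> bv1 S v1"
abbreviation "\<psi> \<equiv> psi S v2"

lemma frame_dom: "v1 \<in> dom_T_max S" "v2 \<in> dom_T_max S"
  and frame_real: "\<And>x. x \<in> I \<Longrightarrow> v1 x \<in> \<real>" "\<And>x. x \<in> I \<Longrightarrow> v2 x \<in> \<real>"
  and frame_wronskian: "wronskian_left S v1 v2 = 1"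
  using frame unfolding boundary_frame_def by blast+

lemma b0_combination:
  "f \<in> dom_T_max S \<Longrightarrow> g \<in> dom_T_max S \<Longrightarrow> b0 (\<lambda>x. \<alpha> * f x + \<beta> * g x) = \<alpha> * b0 f + \<beta> * b0 g"
  unfolding bv0_def by (simp add: wronskian_left_combination[OF frame_dom(2)])

lemma b1_combination:
  "f \<in> dom_T_max S \<Longrightarrow> g \<in> dom_T_max S \<Longrightarrow> b1 (\<lambda>x. \<alpha> * f x + \<beta> * g x) = \<alpha> * b1 f + \<beta> * b1 g"
  unfolding bv1_def by (simp add: wronskian_left_combination[OF frame_dom(1)])

lemma boundary_values_cnj: "g \<in> dom_T_max S \<Longrightarrow> b0 (\<lambda>x. cnj (g x)) = cnj (b0 g)"
  "g \<in> dom_T_max S \<Longrightarrow> b1 (\<lambda>x. cnj (g x)) = cnj (b1 g)"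
  unfolding bv0_def bv1_def
  by (simp_all add: wronskian_left_real_cnj[OF frame_dom(1) frame_real(1)] wronskian_left_real_cnj[OF frame_dom(2) frame_real(2)])

lemma wronskian_left_cong:
  assumes v: "v \<in> dom_T_max S" and g: "g \<in> dom_T_max S" and eq: "\<And>x. x \<in> I \<Longrightarrow> g x = g' x"
  shows "wronskian_left S v g' = wronskian_left S v g"
proof -
  have "sl_system g' (quasi_deriv S g) (tau S g)"
    by (rule sl_system_cong[OF dom_T_maxD(1)[OF g] eq]) auto
  then show ?thesis
  proof (rule wronskian_left_sl_systemI[OF dom_T_maxD(1)[OF v]])
    have "eventually (\<lambda>x. wronskian S v g x = v x * quasi_deriv S g x - quasi_deriv S v x * g' x) endL"
      using eventually_endL_in by eventually_elim (simp add: wronskian_def eq)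
    then show "((\<lambda>x. v x * quasi_deriv S g x - quasi_deriv S v x * g' x) \<longlongrightarrow> wronskian_left S v g) endL"
      by (rule Lim_transform_eventually[OF wronskian_left_tendsto[OF v g]])
  qed
qed

lemma boundary_values_cong:
  assumes "g \<in> dom_T_max S" "\<And>x. x \<in> I \<Longrightarrow> g x = g' x"
  shows "b0 g' = b0 g" "b1 g' = b1 g"
  unfolding bv0_def bv1_def
  by (simp_all add: wronskian_left_cong[OF frame_dom(1) assms] wronskian_left_cong[OF frame_dom(2) assms])

text \<open>
  The Pluecker identity \<open>W(f, g) W(v1, v2) = W(v1, f) W(v2, g) - W(v2, f) W(v1, g)\<close> holds at every
  point; pass to the limit at \<open>a\<close>, where \<open>W(v1, v2) = 1\<close>.
\<close>

lemma wronskian_left_boundary_values: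
  assumes f: "f \<in> dom_T_max S" and g: "g \<in> dom_T_max S"
  shows "wronskian_left S f g = b0 f * b1 g - b1 f * b0 g"
proof -
  note T = wronskian_left_tendsto
  have "((\<lambda>x. wronskian S f g x * wronskian S v1 v2 x) \<longlongrightarrow> wronskian_left S f g * wronskian_left S v1 v2) endL"
    by (intro tendsto_mult T f g frame_dom)
  moreover have "((\<lambda>x. wronskian S v1 f x * wronskian S v2 g x - wronskian S v2 f x * wronskian S v1 g x)
      \<longlongrightarrow> wronskian_left S v1 f * wronskian_left S v2 g - wronskian_left S v2 f * wronskian_left S v1 g) endL"
    by (intro tendsto_mult tendsto_diff T f g frame_dom)
  moreover have "wronskian S f g x * wronskian S v1 v2 x
      = wronskian S v1 f x * wronskian S v2 g x - wronskian S v2 f x * wronskian S v1 g x" for x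
    unfolding wronskian_def by (simp add: algebra_simps)
  ultimately have "wronskian_left S f g * wronskian_left S v1 v2
      = wronskian_left S v1 f * wronskian_left S v2 g - wronskian_left S v2 f * wronskian_left S v1 g"
    using tendsto_unique[OF endL_nontrivial] by simp
  then show ?thesis by (simp add: frame_wronskian bv0_def bv1_def)
qed

lemma green_formula:
  assumes f: "f \<in> dom_T_max S" and g: "g \<in> dom_T_max S"
  shows "(LINT x|weighted S. tau S f x * g x - f x * tau S g x) = b1 f * b0 g - b0 f * b1 g"
proof (rule green_limits[OF f g])
  fix R assume R: "(wronskian S f g \<longlongrightarrow> R) endR"
    "R - wronskian_left S f g = (LINT x|weighted S. tau S f x * g x - f x * tau S g x)"
  have "R = 0" using tendsto_unique[OF endR_nontrivial R(1) limit_point_wronskian_vanishes[OF lp f g]] .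
  then show ?thesis using R(2) wronskian_left_boundary_values[OF f g] by simp
qed

definition L2_sol :: "complex \<Rightarrow> (real \<Rightarrow> complex) \<Rightarrow> bool" where
  "L2_sol z y \<longleftrightarrow> is_solution S z y \<and> y \<in> L2_r S"

lemma L2_solI: "sl_system y v (\<lambda>x. z * y x) \<Longrightarrow> y \<in> L2_r S \<Longrightarrow> L2_sol z y"
  unfolding L2_sol_def using sl_system_solution by blast

lemma L2_solD:
  assumes "L2_sol z y"
  shows "sl_system y (quasi_deriv S y) (\<lambda>x. z * y x)" "y \<in> L2_r S" "y \<in> dom_T_max S"
    "AE x in lebesgue. x \<in> I \<longrightarrow> tau S y x = z * y x" "continuous_on I y"
proof -
  show sys: "sl_system y (quasi_deriv S y) (\<lambda>x. z * y x)" and L: "y \<in> L2_r S"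
    using assms solution_sl_system unfolding L2_sol_def by blast+
  show "y \<in> dom_T_max S" by (rule dom_T_maxI[OF sys L L2_r_cmult[OF L]])
  show "AE x in lebesgue. x \<in> I \<longrightarrow> tau S y x = z * y x" by (rule sl_system_regular(3)[OF sys])
  show "continuous_on I y" by (rule sl_system_continuous(1)[OF sys])
qed

lemma L2_sol_combination:
  assumes "L2_sol z f" "L2_sol z g" shows "L2_sol z (\<lambda>x. \<alpha> * f x + \<beta> * g x)"
proof -
  have "sl_system (\<lambda>x. \<alpha> * f x + \<beta> * g x) (\<lambda>x. \<alpha> * quasi_deriv S f x + \<beta> * quasi_deriv S g x) (\<lambda>x. z * (\<alpha> * f x + \<beta> * g x))"
    using sl_system_combination[OF L2_solD(1)[OF assms(1)] L2_solD(1)[OF assms(2)], of \<alpha> \<beta>] by (simp add: algebra_simps)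
  then show ?thesis by (rule L2_solI) (intro L2_r_combination L2_solD(2)[OF assms(1)] L2_solD(2)[OF assms(2)])
qed

lemma L2_sol_cnj:
  assumes "L2_sol z f" shows "L2_sol (cnj z) (\<lambda>x. cnj (f x))"
proof -
  have "sl_system (\<lambda>x. cnj (f x)) (\<lambda>x. cnj (quasi_deriv S f x)) (\<lambda>x. cnj z * cnj (f x))"
    using sl_system_cnj[OF L2_solD(1)[OF assms]] by simp
  then show ?thesis by (rule L2_solI) (intro L2_r_cnj L2_solD(2)[OF assms])
qed

lemma integral_weighted_cong:
  assumes "f \<in> borel_measurable (lebesgue_on I)" "g \<in> borel_measurable (lebesgue_on I)"
    "AE x in lebesgue. x \<in> I \<longrightarrow> f x = (g x :: complex)"
  shows "(LINT x|weighted S. f x) = (LINT x|weighted S. g x)"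
  by (rule integral_cong_AE) (use assms in \<open>simp_all add: AE_weighted\<close>)

lemma green_solutions:
  assumes y: "L2_sol z y" and x: "L2_sol w x"
  shows "(z - w) * (LINT t|weighted S. y t * x t) = b1 y * b0 x - b0 y * b1 x"
proof -
  note y' = L2_solD[OF y] and x' = L2_solD[OF x]
  note m = L2_r_measurable
  have "(LINT t|weighted S. tau S y t * x t - y t * tau S x t) = (LINT t|weighted S. (z - w) * (y t * x t))"
  proof (rule integral_weighted_cong)
    show "(\<lambda>t. tau S y t * x t - y t * tau S x t) \<in> borel_measurable (lebesgue_on I)"
      using m[OF y'(2)] m[OF x'(2)] m[OF dom_T_maxD(3)[OF y'(3)]] m[OF dom_T_maxD(3)[OF x'(3)]] by simp
    show "(\<lambda>t. (z - w) * (y t * x t)) \<in> borel_measurable (lebesgue_on I)"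
      using m[OF y'(2)] m[OF x'(2)] by simp
    show "AE t in lebesgue. t \<in> I \<longrightarrow> tau S y t * x t - y t * tau S x t = (z - w) * (y t * x t)"
      using y'(4) x'(4) by eventually_elim (simp add: algebra_simps)
  qed
  then show ?thesis using green_formula[OF y'(3) x'(3)] by simp
qed

lemma ae_zero_imp_zero:
  assumes "continuous_on I y" "AE x in lebesgue. x \<in> I \<longrightarrow> y x = (0::complex)" "x \<in> I"
  shows "y x = 0"
  by (rule continuous_ae_eq_imp_eq[OF open_I assms(1) continuous_on_const assms(2,3)])

lemma L2_inner_self: "L2_inner S y y = of_real ((L2_norm S y)\<^sup>2)"
proof -
  have "L2_inner S y y = (LINT x|weighted S. complex_of_real ((cmod (y x))\<^sup>2))"
    unfolding L2_inner_def
    by (rule arg_cong[where f="integral\<^sup>L (weighted S)"], rule ext) (metis complex_norm_square mult.commute of_real_power)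
  also have "\<dots> = of_real (LINT x|weighted S. (cmod (y x))\<^sup>2)" by (rule integral_complex_of_real)
  also have "(LINT x|weighted S. (cmod (y x))\<^sup>2) = (L2_norm S y)\<^sup>2"
    unfolding L2_norm_def by (subst real_sqrt_pow2) (simp_all add: integral_nonneg_AE)
  finally show ?thesis .
qed

lemma L2_norm_zero_imp:
  assumes y: "y \<in> L2_r S" and n: "L2_norm S y = 0"
  shows "AE x in lebesgue. x \<in> I \<longrightarrow> y x = 0"
proof -
  have "(LINT x|weighted S. (cmod (y x))\<^sup>2) = 0" using n unfolding L2_norm_def by simp
  then have "AE x in weighted S. (cmod (y x))\<^sup>2 = 0"
    using integral_nonneg_eq_0_iff_AE[of "weighted S" "\<lambda>x. (cmod (y x))\<^sup>2"] y unfolding L2_r_iff by auto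
  then show ?thesis unfolding AE_weighted by eventually_elim auto
qed

text \<open>
  A real boundary condition makes the boundary values of \<open>y\<close> complex multiples of a real vector, so the
  boundary term in Green's formula for \<open>cnj y\<close> and \<open>y\<close> vanishes. What is left is \<open>cnj z - z\<close> times
  the squared norm of \<open>y\<close>.
\<close>

lemma L2_sol_boundary_condition_zero:
  assumes z: "z \<notin> \<real>" and y: "L2_sol z y"
    and bc: "of_real (cos \<beta>) * b0 y + of_real (sin \<beta>) * b1 y = 0" and x: "x \<in> I"
  shows "y x = 0"
proof -
  note y' = L2_solD[OF y]
  define C where "C = complex_of_real (cos \<beta>)"
  define D where "D = complex_of_real (sin \<beta>)"
  have "C * C + D * D = of_real (cos \<beta> * cos \<beta> + sin \<beta> * sin \<beta>)"
    unfolding C_def D_def by (simp only: of_real_add of_real_mult)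
  then have CC: "C * C + D * D = 1" unfolding sin_cos_squared_add3 by simp
  have "cnj C = C" "cnj D = D" by (simp_all add: C_def D_def)
  note CD = CC this
  \<comment> \<open>The boundary values are \<open>(- t D, t C)\<close>, the multiple \<open>t\<close> of the real vector \<open>(- sin \<beta>, cos \<beta>)\<close>.\<close>
  define t where "t = C * b1 y - D * b0 y"
  have bc': "C * b0 y + D * b1 y = 0" using bc by (simp add: C_def D_def)
  have B0: "b0 y = - t * D"
  proof -
    have "b0 y = (C * C + D * D) * b0 y" by (simp add: CD)
    also have "\<dots> = C * (C * b0 y + D * b1 y) - t * D" unfolding t_def by (simp add: algebra_simps)
    finally show ?thesis using bc' by simp
  qed
  have B1: "b1 y = t * C"
  proof -
    have "b1 y = (C * C + D * D) * b1 y" by (simp add: CD)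
    also have "\<dots> = D * (C * b0 y + D * b1 y) + t * C" unfolding t_def by (simp add: algebra_simps)
    finally show ?thesis using bc' by simp
  qed
  have "(cnj z - z) * (LINT t|weighted S. cnj (y t) * y t) = cnj (b1 y) * b0 y - cnj (b0 y) * b1 y"
    using green_solutions[OF L2_sol_cnj[OF y] y] by (simp add: boundary_values_cnj[OF y'(3)])
  also have "\<dots> = 0" unfolding B0 B1 by (simp add: CD)
  finally have "(cnj z - z) * L2_inner S y y = 0" unfolding L2_inner_def .
  moreover have "cnj z - z \<noteq> 0" using z by (auto simp: Reals_cnj_iff)
  ultimately have "L2_norm S y = 0" unfolding L2_inner_self by simp
  from ae_zero_imp_zero[OF y'(5) L2_norm_zero_imp[OF y'(2) this] x] show ?thesis .
qed

text \<open>
  Weyl's solution is square integrable near \<open>b\<close>, and near \<open>a\<close> by the limit circle case. It is not zero,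
  so its first boundary value is not zero and can be normalized to 1.
\<close>

lemma psi_L2_sol:
  assumes z: "z \<notin> \<real>"
  shows "L2_sol z (\<psi> z)" "b0 (\<psi> z) = 1"
proof -
  obtain c where c: "c \<in> I" using I_nonempty by blast
  obtain u v where u: "sl_system u v (\<lambda>x. z * u x)" "u c = 1" "(\<lambda>x. indicator {c..} x * u x) \<in> L2_r S"
    by (rule weyl_solution[OF z c]) (rule that)
  note cu = sl_system_continuous(1)[OF u(1)]
  obtain c' where c': "c' \<in> I" "set_integrable (weighted S) {..c'} (\<lambda>x. (cmod (u x))\<^sup>2)"
    using lc sl_system_solution[OF u(1)] unfolding limit_circle_left_def by blast
  have "(\<lambda>x. indicator {..c'} x * u x) \<in> L2_r S"
    using c'(2) L2_r_indicator_iff[OF continuous_measurable[OF cu], of "{..c'}"] by simp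
  from L2_r_from_halves[OF cu c c'(1) this u(3)] have uL: "u \<in> L2_r S" .
  have us: "L2_sol z u" by (rule L2_solI[OF u(1) uL])
  have nz: "b0 u \<noteq> 0"
  proof
    assume "b0 u = 0"
    then have "u c = 0" by (intro L2_sol_boundary_condition_zero[OF z us, where \<beta>=0] c) simp
    then show False using u(2) by simp
  qed
  let ?y = "\<lambda>x. (1 / b0 u) * u x + 0 * u x"
  have "L2_sol z ?y" by (rule L2_sol_combination[OF us us])
  moreover have "b0 ?y = 1" using b0_combination[OF L2_solD(3)[OF us] L2_solD(3)[OF us], of "1 / b0 u" 0] nz by simp
  ultimately have "is_solution S z ?y \<and> ?y \<in> L2_r S \<and> b0 ?y = 1" unfolding L2_sol_def by blast
  then have "is_solution S z (\<psi> z) \<and> \<psi> z \<in> L2_r S \<and> b0 (\<psi> z) = 1"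
    unfolding psi_def by (rule someI[where P="\<lambda>y. is_solution S z y \<and> y \<in> L2_r S \<and> b0 y = 1"])
  then show "L2_sol z (\<psi> z)" "b0 (\<psi> z) = 1" unfolding L2_sol_def by blast+
qed

lemma psi_dom: "z \<notin> \<real> \<Longrightarrow> \<psi> z \<in> dom_T_max S"
  by (rule L2_solD(3)[OF psi_L2_sol(1)])

text \<open>
  The difference of the two sides is a square integrable solution with first boundary value zero.
\<close>

lemma L2_sol_multiple_psi:
  assumes z: "z \<notin> \<real>" and y: "L2_sol z y" and x: "x \<in> I"
  shows "y x = b0 y * \<psi> z x"
proof -
  note p = psi_L2_sol[OF z]
  have "1 * y x + (- b0 y) * \<psi> z x = 0"
  proof (rule L2_sol_boundary_condition_zero[OF z L2_sol_combination[OF y p(1)] _ x, where \<beta>=0])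
    show "of_real (cos 0) * b0 (\<lambda>x. 1 * y x + (- b0 y) * \<psi> z x) + of_real (sin 0) * b1 (\<lambda>x. 1 * y x + (- b0 y) * \<psi> z x) = 0"
      unfolding b0_combination[OF L2_solD(3)[OF y] psi_dom[OF z]] p(2) by simp
  qed
  then show ?thesis by simp
qed

lemma psi_cnj:
  assumes z: "z \<notin> \<real>"
  shows "\<And>x. x \<in> I \<Longrightarrow> \<psi> (cnj z) x = cnj (\<psi> z x)" "b1 (\<psi> (cnj z)) = cnj (b1 (\<psi> z))"
proof -
  have cz: "cnj z \<notin> \<real>" using z by (simp add: complex_is_Real_iff)
  note p = psi_L2_sol[OF z]
  note d = psi_dom[OF z]
  show eq: "\<psi> (cnj z) x = cnj (\<psi> z x)" if "x \<in> I" for x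
    using L2_sol_multiple_psi[OF cz L2_sol_cnj[OF p(1)] that] by (simp add: boundary_values_cnj[OF d] p(2))
  show "b1 (\<psi> (cnj z)) = cnj (b1 (\<psi> z))"
    using boundary_values_cong(2)[OF dom_T_max_cnj[OF d], of "\<psi> (cnj z)"] eq by (simp add: boundary_values_cnj[OF d])
qed

section \<open>The deficiency space and the resolvent on it\<close>

lemma i_not_Real [simp]: "\<i> \<notin> \<real>"
  by (simp add: complex_is_Real_iff)

lemma L2_eq_iff: "L2_eq S f g \<longleftrightarrow> (AE x in lebesgue. x \<in> I \<longrightarrow> f x = g x)"
  unfolding L2_eq_def AE_weighted ..

lemma L2_eq_refl [simp]: "L2_eq S f f"
  unfolding L2_eq_def by simp

lemma L2_eq_sym:
  assumes "L2_eq S f g" shows "L2_eq S g f"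
  using assms unfolding L2_eq_def by eventually_elim simp

lemma L2_eq_trans:
  assumes "L2_eq S f g" "L2_eq S g h" shows "L2_eq S f h"
  using assms unfolding L2_eq_def by eventually_elim simp

lemma L2_eq_combination:
  assumes "L2_eq S f f'" "L2_eq S g g'"
  shows "L2_eq S (\<lambda>x. \<alpha> * f x + \<beta> * g x) (\<lambda>x. \<alpha> * f' x + \<beta> * g' x)"
  using assms unfolding L2_eq_def by eventually_elim simp

lemma L2_eq_L2_r: "L2_eq S f g \<Longrightarrow> f \<in> L2_r S \<Longrightarrow> g \<in> L2_r S"
  unfolding L2_eq_iff by (rule L2_r_cong_ae)

lemma L2_inner_cong:
  assumes "u \<in> L2_r S" "f \<in> L2_r S" "L2_eq S u u'" "L2_eq S f f'"
  shows "L2_inner S u f = L2_inner S u' f'"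
  unfolding L2_inner_def
proof (rule integral_weighted_cong)
  note m = L2_r_measurable
  have "u' \<in> L2_r S" "f' \<in> L2_r S" using L2_eq_L2_r assms by blast+
  then show "(\<lambda>x. cnj (u' x) * f' x) \<in> borel_measurable (lebesgue_on I)"
    using m[OF L2_r_cnj[of u']] m[of f'] by simp
  show "(\<lambda>x. cnj (u x) * f x) \<in> borel_measurable (lebesgue_on I)"
    using m[OF L2_r_cnj[OF assms(1)]] m[OF assms(2)] by simp
  show "AE x in lebesgue. x \<in> I \<longrightarrow> cnj (u x) * f x = cnj (u' x) * f' x"
    using assms(3,4) unfolding L2_eq_iff by eventually_elim simp
qed

lemma L2_inner_combination:
  assumes "u \<in> L2_r S" "f \<in> L2_r S" "g \<in> L2_r S"
  shows "L2_inner S u (\<lambda>x. \<alpha> * f x + \<beta> * g x) = \<alpha> * L2_inner S u f + \<beta> * L2_inner S u g"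
proof -
  have "L2_inner S u (\<lambda>x. \<alpha> * f x + \<beta> * g x) = (LINT x|weighted S. \<alpha> * (cnj (u x) * f x) + \<beta> * (cnj (u x) * g x))"
    unfolding L2_inner_def by (rule arg_cong[where f="integral\<^sup>L (weighted S)"], rule ext) (simp add: algebra_simps)
  also have "\<dots> = \<alpha> * L2_inner S u f + \<beta> * L2_inner S u g"
    unfolding L2_inner_def
    by (subst Bochner_Integration.integral_add)
       (simp_all add: L2_r_product_integrable L2_r_cnj assms)
  finally show ?thesis .
qed

lemma L2_inner_cmult: "u \<in> L2_r S \<Longrightarrow> f \<in> L2_r S \<Longrightarrow> L2_inner S u (\<lambda>x. \<alpha> * f x) = \<alpha> * L2_inner S u f"
  using L2_inner_combination[of u f f \<alpha> 0] by simp

lemma L2_inner_cmult_left: "L2_inner S (\<lambda>x. \<alpha> * u x) f = cnj \<alpha> * L2_inner S u f"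
  unfolding L2_inner_def by (simp add: mult.assoc)

abbreviation "N\<^sub>i \<equiv> deficiency_space S \<i>"

definition psi_i_norm_sq :: complex where
  "psi_i_norm_sq = of_real ((L2_norm S (\<psi> \<i>))\<^sup>2)"

lemma psi_L2_r: "z \<notin> \<real> \<Longrightarrow> \<psi> z \<in> L2_r S"
  by (rule L2_solD(2)[OF psi_L2_sol(1)])

lemma psi_i_inner_self: "L2_inner S (\<psi> \<i>) (\<psi> \<i>) = psi_i_norm_sq"
  unfolding psi_i_norm_sq_def by (rule L2_inner_self)

lemma b0_zero:
  assumes y: "y \<in> dom_T_max S" and zero: "\<And>x. x \<in> I \<Longrightarrow> y x = 0"
  shows "b0 y = 0"
proof -
  have "b0 y = b0 (\<lambda>x. 0 * y x + 0 * y x)"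
    by (rule boundary_values_cong(1)[OF dom_T_max_combination[OF y y]]) (simp add: zero)
  also have "\<dots> = 0 * b0 y + 0 * b0 y" by (rule b0_combination[OF y y])
  finally show ?thesis by simp
qed

lemma psi_i_norm_sq_nonzero: "psi_i_norm_sq \<noteq> 0"
proof
  assume "psi_i_norm_sq = 0"
  then have "L2_norm S (\<psi> \<i>) = 0" by (simp add: psi_i_norm_sq_def)
  from b0_zero[OF psi_dom ae_zero_imp_zero[OF L2_solD(5)[OF psi_L2_sol(1)] L2_norm_zero_imp[OF psi_L2_r this]]]
  have "b0 (\<psi> \<i>) = 0" by simp
  then show False using psi_L2_sol(2)[OF i_not_Real] by simp
qed

lemma deficiency_space_iff: "g \<in> N\<^sub>i \<longleftrightarrow> g \<in> L2_r S \<and> (\<exists>\<kappa>. L2_eq S g (\<lambda>x. \<kappa> * \<psi> \<i> x))"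
proof
  assume "g \<in> N\<^sub>i"
  then obtain k where g: "g \<in> L2_r S" and k: "k \<in> dom_T_max S" "L2_eq S g k" "L2_eq S (\<lambda>x. \<i> * g x) (tau S k)"
    unfolding deficiency_space_def T_max_def tau_on_def by auto
  have "AE x in lebesgue. x \<in> I \<longrightarrow> tau S k x = \<i> * k x"
    using k(2,3) unfolding L2_eq_iff by eventually_elim auto
  then have "sl_system k (quasi_deriv S k) (\<lambda>x. \<i> * k x)"
    by (rule sl_system_cong[OF dom_T_maxD(1)[OF k(1)] refl refl])
  then have ks: "L2_sol \<i> k" by (rule L2_solI[OF _ dom_T_maxD(2)[OF k(1)]])
  have "L2_eq S k (\<lambda>x. b0 k * \<psi> \<i> x)"
    unfolding L2_eq_iff by (rule AE_I2) (simp add: L2_sol_multiple_psi[OF i_not_Real ks])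
  then show "g \<in> L2_r S \<and> (\<exists>\<kappa>. L2_eq S g (\<lambda>x. \<kappa> * \<psi> \<i> x))"
    using g L2_eq_trans[OF k(2)] by blast
next
  assume "g \<in> L2_r S \<and> (\<exists>\<kappa>. L2_eq S g (\<lambda>x. \<kappa> * \<psi> \<i> x))"
  then obtain \<kappa> where g: "g \<in> L2_r S" and k: "L2_eq S g (\<lambda>x. \<kappa> * \<psi> \<i> x)" by blast
  note p = psi_L2_sol(1)[OF i_not_Real]
  have s: "L2_sol \<i> (\<lambda>x. \<kappa> * \<psi> \<i> x)" using L2_sol_combination[OF p p, of \<kappa> 0] by simp
  have "L2_eq S (\<lambda>x. \<i> * g x) (tau S (\<lambda>x. \<kappa> * \<psi> \<i> x))"
    using k L2_solD(4)[OF s] unfolding L2_eq_iff by eventually_elim simp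
  then show "g \<in> N\<^sub>i"
    unfolding deficiency_space_def T_max_def tau_on_def
    using g k L2_r_cmult[OF g] L2_solD(3)[OF s] by blast
qed

lemma deficiency_space_eq: "f \<in> N\<^sub>i \<Longrightarrow> L2_eq S f g \<Longrightarrow> g \<in> N\<^sub>i"
  unfolding deficiency_space_iff using L2_eq_L2_r L2_eq_trans L2_eq_sym by blast

lemma deficiency_space_combination:
  assumes "f \<in> N\<^sub>i" "g \<in> N\<^sub>i" shows "(\<lambda>x. c * f x + d * g x) \<in> N\<^sub>i"
proof -
  obtain \<kappa> \<nu> where k: "f \<in> L2_r S" "g \<in> L2_r S" "L2_eq S f (\<lambda>x. \<kappa> * \<psi> \<i> x)" "L2_eq S g (\<lambda>x. \<nu> * \<psi> \<i> x)"
    using assms unfolding deficiency_space_iff by blast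
  have "L2_eq S (\<lambda>x. c * f x + d * g x) (\<lambda>x. (c * \<kappa> + d * \<nu>) * \<psi> \<i> x)"
    using L2_eq_combination[OF k(3,4), of c d] by (simp add: algebra_simps)
  then show ?thesis unfolding deficiency_space_iff using L2_r_combination[OF k(1,2)] by blast
qed

lemma psi_in_deficiency_space: "\<psi> \<i> \<in> N\<^sub>i"
  unfolding deficiency_space_iff using psi_L2_r[OF i_not_Real] by (auto intro!: exI[of _ 1])

text \<open>
  The orthogonality conditions for \<open>h = \<nu> \<psi>(\<i>)\<close> all reduce to the one for \<open>\<psi>(\<i>)\<close>, which determines
  \<open>\<nu>\<close>. So the chosen projection is the expected one almost everywhere.
\<close>

lemma orth_proj_deficiency:
  assumes f: "f \<in> L2_r S"
  shows "L2_eq S (orth_proj S N\<^sub>i f) (\<lambda>x. (L2_inner S (\<psi> \<i>) f / psi_i_norm_sq) * \<psi> \<i> x)"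
    "orth_proj S N\<^sub>i f \<in> N\<^sub>i"
proof -
  define \<kappa> where "\<kappa> = L2_inner S (\<psi> \<i>) f / psi_i_norm_sq"
  note P = psi_L2_r[OF i_not_Real]
  let ?good = "\<lambda>h. h \<in> N\<^sub>i \<and> (\<forall>u\<in>N\<^sub>i. L2_inner S u (\<lambda>x. f x - h x) = 0)"
  have orth: "L2_inner S (\<psi> \<i>) (\<lambda>x. f x - \<nu> * \<psi> \<i> x) = L2_inner S (\<psi> \<i>) f - \<nu> * psi_i_norm_sq" for \<nu>
    using L2_inner_combination[OF P f P, of 1 "- \<nu>"] by (simp add: psi_i_inner_self)
  have "?good (\<lambda>x. \<kappa> * \<psi> \<i> x)"
  proof (intro conjI ballI)
    show "(\<lambda>x. \<kappa> * \<psi> \<i> x) \<in> N\<^sub>i"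
      unfolding deficiency_space_iff using L2_r_cmult[OF P] L2_eq_refl by blast
    fix u assume "u \<in> N\<^sub>i"
    then obtain \<mu> where u: "u \<in> L2_r S" "L2_eq S u (\<lambda>x. \<mu> * \<psi> \<i> x)" unfolding deficiency_space_iff by blast
    have fL: "(\<lambda>x. f x - \<kappa> * \<psi> \<i> x) \<in> L2_r S" using L2_r_combination[OF f P, of 1 "- \<kappa>"] by simp
    have "L2_inner S u (\<lambda>x. f x - \<kappa> * \<psi> \<i> x) = cnj \<mu> * L2_inner S (\<psi> \<i>) (\<lambda>x. f x - \<kappa> * \<psi> \<i> x)"
      unfolding L2_inner_cong[OF u(1) fL u(2) L2_eq_refl] by (rule L2_inner_cmult_left)
    also have "\<dots> = 0" unfolding orth \<kappa>_def using psi_i_norm_sq_nonzero by simp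
    finally show "L2_inner S u (\<lambda>x. f x - \<kappa> * \<psi> \<i> x) = 0" .
  qed
  then have G: "?good (orth_proj S N\<^sub>i f)"
    unfolding orth_proj_def by (rule someI[where P="?good"])
  then show "orth_proj S N\<^sub>i f \<in> N\<^sub>i" by blast
  then obtain \<nu> where h: "orth_proj S N\<^sub>i f \<in> L2_r S" "L2_eq S (orth_proj S N\<^sub>i f) (\<lambda>x. \<nu> * \<psi> \<i> x)"
    unfolding deficiency_space_iff by blast
  have hL: "(\<lambda>x. f x - orth_proj S N\<^sub>i f x) \<in> L2_r S" using L2_r_combination[OF f h(1), of 1 "-1"] by simp
  have e: "L2_eq S (\<lambda>x. f x - orth_proj S N\<^sub>i f x) (\<lambda>x. f x - \<nu> * \<psi> \<i> x)"
    using L2_eq_combination[OF L2_eq_refl[of f] h(2), of 1 "-1"] by simp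
  have "0 = L2_inner S (\<psi> \<i>) (\<lambda>x. f x - orth_proj S N\<^sub>i f x)" using G psi_in_deficiency_space by simp
  also have "\<dots> = L2_inner S (\<psi> \<i>) f - \<nu> * psi_i_norm_sq"
    unfolding L2_inner_cong[OF P hL L2_eq_refl e] orth ..
  finally have "\<nu> = \<kappa>" using psi_i_norm_sq_nonzero by (simp add: \<kappa>_def)
  then show "L2_eq S (orth_proj S N\<^sub>i f) (\<lambda>x. (L2_inner S (\<psi> \<i>) f / psi_i_norm_sq) * \<psi> \<i> x)"
    using h(2) by (simp add: \<kappa>_def)
qed

text \<open>
  The boundary condition of \<open>T_alpha\<close> is the vanishing of this form.
\<close>

definition boundary_form :: "real \<Rightarrow> (real \<Rightarrow> complex) \<Rightarrow> complex" where
  "boundary_form \<beta> g = of_real (cos \<beta>) * b0 g + of_real (sin \<beta>) * b1 g"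

lemma boundary_form_combination:
  "f \<in> dom_T_max S \<Longrightarrow> g \<in> dom_T_max S \<Longrightarrow> boundary_form \<beta> (\<lambda>x. c * f x + d * g x) = c * boundary_form \<beta> f + d * boundary_form \<beta> g"
  unfolding boundary_form_def by (simp add: b0_combination b1_combination algebra_simps)

lemma boundary_form_psi: "z \<notin> \<real> \<Longrightarrow> boundary_form \<beta> (\<psi> z) = of_real (cos \<beta>) + of_real (sin \<beta>) * b1 (\<psi> z)"
  unfolding boundary_form_def by (simp add: psi_L2_sol(2))

text \<open>
  Otherwise \<open>\<psi>(z)\<close> would be an eigenfunction of a symmetric operator with nonreal eigenvalue.
\<close>

lemma boundary_form_psi_nonzero:
  assumes z: "z \<notin> \<real>" shows "boundary_form \<beta> (\<psi> z) \<noteq> 0"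
proof
  assume "boundary_form \<beta> (\<psi> z) = 0"
  then have zero: "\<psi> z x = 0" if "x \<in> I" for x
    using L2_sol_boundary_condition_zero[OF z psi_L2_sol(1)[OF z] _ that] unfolding boundary_form_def by blast
  from b0_zero[OF psi_dom[OF z] this] have "b0 (\<psi> z) = 0" .
  then show False using psi_L2_sol(2)[OF z] by simp
qed

lemma dom_T_alpha_iff: "g \<in> dom_T_alpha S v1 v2 \<beta> \<longleftrightarrow> g \<in> dom_T_max S \<and> boundary_form \<beta> g = 0"
  unfolding dom_T_alpha_def boundary_form_def by simp

lemma T_alpha_iff: "(u, h) \<in> T_alpha S v1 v2 \<beta> \<longleftrightarrow> u \<in> L2_r S \<and> h \<in> L2_r S \<and>
    (\<exists>k. k \<in> dom_T_max S \<and> boundary_form \<beta> k = 0 \<and> L2_eq S u k \<and> L2_eq S h (tau S k))"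
  unfolding T_alpha_def tau_on_def Bex_def dom_T_alpha_iff by auto

text \<open>
  The function on the right satisfies \<open>\<tau> h - z h = f\<close>, as \<open>(\<tau> - z) \<psi>(\<i>) = (\<i> - z) \<psi>(\<i>)\<close> and
  \<open>\<psi>(z)\<close> solves the homogeneous equation; the multiple of \<open>\<psi>(z)\<close> is fitted to the boundary condition.
  Any other solution of this boundary value problem differs from it by a square integrable solution of
  \<open>\<tau> y = z y\<close> with the same boundary condition, which is zero.
\<close>

lemma resolvent_deficiency:
  assumes z: "z \<notin> \<real>" "z \<noteq> \<i>" and f: "f \<in> L2_r S" "L2_eq S f (\<lambda>x. \<kappa> * \<psi> \<i> x)"
  shows "L2_eq S (resolvent (T_alpha S v1 v2 \<beta>) z f)
    (\<lambda>x. \<kappa> / (\<i> - z) * (\<psi> \<i> x + (- (boundary_form \<beta> (\<psi> \<i>) / boundary_form \<beta> (\<psi> z))) * \<psi> z x))"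
proof -
  define c where "c = - (boundary_form \<beta> (\<psi> \<i>) / boundary_form \<beta> (\<psi> z))"
  define h where "h = (\<lambda>x. \<kappa> / (\<i> - z) * \<psi> \<i> x + (\<kappa> / (\<i> - z) * c) * \<psi> z x)"
  let ?T = "T_alpha S v1 v2 \<beta>"
  note pi = psi_dom[OF i_not_Real] and pz = psi_dom[OF z(1)]
  note ti = L2_solD(4)[OF psi_L2_sol(1)[OF i_not_Real]] and tz = L2_solD(4)[OF psi_L2_sol(1)[OF z(1)]]
  have iz: "\<i> - z \<noteq> 0" using z(2) by simp
  have hd: "h \<in> dom_T_max S" unfolding h_def by (rule dom_T_max_combination[OF pi pz])
  have hbc: "boundary_form \<beta> h = 0"
    unfolding h_def boundary_form_combination[OF pi pz] c_def using boundary_form_psi_nonzero[OF z(1)] by simp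
  note hsys = sl_system_combination[OF dom_T_maxD(1)[OF pi] dom_T_maxD(1)[OF pz], of "\<kappa> / (\<i> - z)" "\<kappa> / (\<i> - z) * c", folded h_def]
  have alg: "k * (\<i> * a) + k * c * (z * b) = k * (\<i> - z) * a + z * (k * a + k * c * b)" for k a b
    by (simp add: algebra_simps)
  have htau: "AE x in lebesgue. x \<in> I \<longrightarrow> tau S h x = \<kappa> * \<psi> \<i> x + z * h x"
    using sl_system_regular(3)[OF hsys] ti tz
  proof eventually_elim
    case (elim x)
    show ?case
    proof
      assume x: "x \<in> I"
      have "tau S h x = \<kappa> / (\<i> - z) * (\<i> * \<psi> \<i> x) + \<kappa> / (\<i> - z) * c * (z * \<psi> z x)" using elim x by simp
      also have "\<dots> = \<kappa> / (\<i> - z) * (\<i> - z) * \<psi> \<i> x + z * h x" unfolding h_def by (rule alg)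
      also have "\<dots> = \<kappa> * \<psi> \<i> x + z * h x" using iz by simp
      finally show "tau S h x = \<kappa> * \<psi> \<i> x + z * h x" .
    qed
  qed
  have "(h, \<lambda>x. f x + z * h x) \<in> ?T"
    unfolding T_alpha_def tau_on_def
  proof (clarify, intro conjI bexI)
    show "h \<in> dom_T_alpha S v1 v2 \<beta>" using hd hbc by (simp add: dom_T_alpha_iff)
    show hL: "h \<in> L2_r S" by (rule dom_T_maxD(2)[OF hd])
    show "(\<lambda>x. f x + z * h x) \<in> L2_r S" using L2_r_combination[OF f(1) hL, of 1 z] by simp
    show "L2_eq S h h" by simp
    show "L2_eq S (\<lambda>x. f x + z * h x) (tau S h)"
      using htau f(2) unfolding L2_eq_iff by eventually_elim simp
  qed
  then have "(resolvent ?T z f, \<lambda>x. f x + z * resolvent ?T z f x) \<in> ?T"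
    unfolding resolvent_def by (rule someI[where P="\<lambda>g. (g, \<lambda>x. f x + z * g x) \<in> ?T"])
  then obtain k where k: "k \<in> dom_T_max S" "boundary_form \<beta> k = 0" "L2_eq S (resolvent ?T z f) k"
    "L2_eq S (\<lambda>x. f x + z * resolvent ?T z f x) (tau S k)"
    unfolding T_alpha_iff by blast
  define y where "y = (\<lambda>x. 1 * k x + (- 1) * h x)"
  have yd: "y \<in> dom_T_max S" unfolding y_def by (rule dom_T_max_combination[OF k(1) hd])
  note ysys = sl_system_combination[OF dom_T_maxD(1)[OF k(1)] dom_T_maxD(1)[OF hd], of 1 "-1", folded y_def]
  have "AE x in lebesgue. x \<in> I \<longrightarrow> 1 * tau S k x + (- 1) * tau S h x = z * y x"
    using k(3,4) f(2) htau unfolding L2_eq_iff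
  proof eventually_elim
    case (elim x)
    show ?case
    proof
      assume x: "x \<in> I"
      have "tau S k x = \<kappa> * \<psi> \<i> x + z * k x" using elim x by auto
      moreover have "tau S h x = \<kappa> * \<psi> \<i> x + z * h x" using elim x by auto
      ultimately show "1 * tau S k x + (- 1) * tau S h x = z * y x" by (simp add: y_def algebra_simps)
    qed
  qed
  from sl_system_cong[OF ysys refl refl this]
  have ys: "L2_sol z y" by (rule L2_solI[OF _ dom_T_maxD(2)[OF yd]])
  have "boundary_form \<beta> y = 0" unfolding y_def boundary_form_combination[OF k(1) hd] using k(2) hbc by simp
  then have y0: "y x = 0" if "x \<in> I" for x
    using L2_sol_boundary_condition_zero[OF z(1) ys _ that] unfolding boundary_form_def by blast
  have kh: "L2_eq S k h"
    unfolding L2_eq_iff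
  proof (intro AE_I2 impI)
    fix x assume "x \<in> I"
    then show "k x = h x" using y0[of x] by (simp add: y_def)
  qed
  have "h = (\<lambda>x. \<kappa> / (\<i> - z) * (\<psi> \<i> x + c * \<psi> z x))"
    unfolding h_def by (rule ext) (simp add: distrib_left mult.assoc)
  then show ?thesis using L2_eq_trans[OF k(3) kh] unfolding c_def by simp
qed

section \<open>The Donoghue function\<close>

definition donoghue_factor :: "real \<Rightarrow> complex \<Rightarrow> complex" where
  "donoghue_factor \<beta> z = z + (z\<^sup>2 + 1) / (\<i> - z)
     * (1 - boundary_form \<beta> (\<psi> \<i>) / boundary_form \<beta> (\<psi> z) * (L2_inner S (\<psi> \<i>) (\<psi> z) / psi_i_norm_sq))"

text \<open>
  Apply \<open>resolvent_deficiency\<close> to \<open>g = \<kappa> \<psi>(\<i>)\<close> and project back to the line spanned by \<open>\<psi>(\<i>)\<close>.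
\<close>

lemma donoghue_eq_factor:
  assumes z: "z \<notin> \<real>" "z \<noteq> \<i>" and g: "g \<in> N\<^sub>i"
  shows "L2_eq S (donoghue S (T_alpha S v1 v2 \<beta>) z g) (\<lambda>x. donoghue_factor \<beta> z * g x)"
proof -
  let ?T = "T_alpha S v1 v2 \<beta>" and ?P = "orth_proj S N\<^sub>i"
  note Pi = psi_L2_r[OF i_not_Real] and Pz = psi_L2_r[OF z(1)]
  obtain \<kappa> where gL: "g \<in> L2_r S" and gk: "L2_eq S g (\<lambda>x. \<kappa> * \<psi> \<i> x)" using g unfolding deficiency_space_iff by blast
  have "L2_inner S (\<psi> \<i>) g = \<kappa> * psi_i_norm_sq"
    unfolding L2_inner_cong[OF Pi gL L2_eq_refl gk] L2_inner_cmult[OF Pi Pi] psi_i_inner_self ..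
  then have Pg: "L2_eq S (?P g) (\<lambda>x. \<kappa> * \<psi> \<i> x)"
    using orth_proj_deficiency(1)[OF gL] psi_i_norm_sq_nonzero by simp
  have PgL: "?P g \<in> L2_r S" using orth_proj_deficiency(2)[OF gL] unfolding deficiency_space_iff by blast
  define c where "c = - (boundary_form \<beta> (\<psi> \<i>) / boundary_form \<beta> (\<psi> z))"
  define R where "R = resolvent ?T z (?P g)"
  define h where "h = (\<lambda>x. \<kappa> / (\<i> - z) * (1 * \<psi> \<i> x + c * \<psi> z x))"
  have Rh: "L2_eq S R h"
    using resolvent_deficiency[OF z PgL Pg, of \<beta>] unfolding R_def h_def c_def by simp
  have cL: "(\<lambda>x. 1 * \<psi> \<i> x + c * \<psi> z x) \<in> L2_r S" by (rule L2_r_combination[OF Pi Pz])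
  have hL: "h \<in> L2_r S" unfolding h_def by (rule L2_r_cmult[OF cL])
  have RL: "R \<in> L2_r S" by (rule L2_eq_L2_r[OF L2_eq_sym[OF Rh] hL])
  have "L2_inner S (\<psi> \<i>) R = L2_inner S (\<psi> \<i>) h" by (rule L2_inner_cong[OF Pi RL L2_eq_refl Rh])
  also have "\<dots> = \<kappa> / (\<i> - z) * (psi_i_norm_sq + c * L2_inner S (\<psi> \<i>) (\<psi> z))"
    unfolding h_def L2_inner_cmult[OF Pi cL] L2_inner_combination[OF Pi Pi Pz] psi_i_inner_self by simp
  finally have inner: "L2_inner S (\<psi> \<i>) R / psi_i_norm_sq = \<kappa> / (\<i> - z) * (1 + c * (L2_inner S (\<psi> \<i>) (\<psi> z) / psi_i_norm_sq))"
    using psi_i_norm_sq_nonzero by (simp add: add_divide_distrib distrib_left)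
  have PR: "L2_eq S (?P R) (\<lambda>x. \<kappa> / (\<i> - z) * (1 + c * (L2_inner S (\<psi> \<i>) (\<psi> z) / psi_i_norm_sq)) * \<psi> \<i> x)"
    using orth_proj_deficiency(1)[OF RL] unfolding inner .
  have alg: "z * (\<kappa> * a) + w * (\<kappa> / e * (1 + - v * y) * a) = (z + w / e * (1 - v * y)) * (\<kappa> * a)" for a w e v y
    by (simp add: algebra_simps)
  have "L2_eq S (\<lambda>x. z * g x + (z\<^sup>2 + 1) * ?P R x) (\<lambda>x. donoghue_factor \<beta> z * g x)"
    using PR gk unfolding L2_eq_iff
  proof eventually_elim
    case (elim x)
    show ?case
    proof
      assume "x \<in> I"
      then have "?P R x = \<kappa> / (\<i> - z) * (1 + c * (L2_inner S (\<psi> \<i>) (\<psi> z) / psi_i_norm_sq)) * \<psi> \<i> x" "g x = \<kappa> * \<psi> \<i> x"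
        using elim by auto
      then show "z * g x + (z\<^sup>2 + 1) * ?P R x = donoghue_factor \<beta> z * g x"
        unfolding donoghue_factor_def c_def by (simp only: alg)
    qed
  qed
  then show ?thesis unfolding donoghue_def Let_def R_def .
qed

text \<open>
  Green's formula for \<open>cnj \<psi>(\<i>)\<close>, which is \<open>\<psi>(- \<i>)\<close>, and \<open>\<psi>(z)\<close>; both have first boundary value 1.
\<close>

lemma psi_i_inner_psi:
  assumes z: "z \<notin> \<real>"
  shows "(z + \<i>) * L2_inner S (\<psi> \<i>) (\<psi> z) = b1 (\<psi> z) - b1 (\<psi> (- \<i>))"
proof -
  have m: "b1 (\<psi> (- \<i>)) = cnj (b1 (\<psi> \<i>))" using psi_cnj(2)[OF i_not_Real] by simp
  have "(- \<i> - z) * L2_inner S (\<psi> \<i>) (\<psi> z) = b1 (\<psi> (- \<i>)) - b1 (\<psi> z)"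
    using green_solutions[OF L2_sol_cnj[OF psi_L2_sol(1)[OF i_not_Real]] psi_L2_sol(1)[OF z]]
    by (simp add: L2_inner_def m boundary_values_cnj psi_dom psi_L2_sol(2) z)
  then show ?thesis by (simp add: algebra_simps)
qed

text \<open>
  As \<open>\<psi>(cnj z) = cnj \<psi>(z)\<close>, the inner product with \<open>\<psi>(\<i>)\<close> is the bilinear integral of \<open>\<psi>(z) \<psi>(\<i>)\<close>,
  to which Green's formula applies.
\<close>

lemma psi_cnj_inner_deficiency:
  assumes z: "z \<notin> \<real>" and g: "g \<in> L2_r S" "L2_eq S g (\<lambda>x. \<kappa> * \<psi> \<i> x)"
  shows "(z - \<i>) * L2_inner S (\<psi> (cnj z)) g = \<kappa> * (b1 (\<psi> z) - b1 (\<psi> \<i>))"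
proof -
  have cz: "cnj z \<notin> \<real>" using z by (simp add: complex_is_Real_iff)
  note P = psi_L2_r[OF i_not_Real] and Pz = psi_L2_r[OF z] and Pc = psi_L2_r[OF cz]
  have "L2_inner S (\<psi> (cnj z)) g = \<kappa> * L2_inner S (\<psi> (cnj z)) (\<psi> \<i>)"
    unfolding L2_inner_cong[OF Pc g(1) L2_eq_refl g(2)] by (rule L2_inner_cmult[OF Pc P])
  also have "L2_inner S (\<psi> (cnj z)) (\<psi> \<i>) = (LINT x|weighted S. \<psi> z x * \<psi> \<i> x)"
    unfolding L2_inner_def
  proof (rule integral_weighted_cong)
    show "(\<lambda>x. cnj (\<psi> (cnj z) x) * \<psi> \<i> x) \<in> borel_measurable (lebesgue_on I)"
      using L2_r_measurable[OF L2_r_cnj[OF Pc]] L2_r_measurable[OF P] by simp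
    show "(\<lambda>x. \<psi> z x * \<psi> \<i> x) \<in> borel_measurable (lebesgue_on I)"
      using L2_r_measurable[OF Pz] L2_r_measurable[OF P] by simp
    show "AE x in lebesgue. x \<in> I \<longrightarrow> cnj (\<psi> (cnj z) x) * \<psi> \<i> x = \<psi> z x * \<psi> \<i> x"
      by (rule AE_I2) (simp add: psi_cnj(1)[OF z])
  qed
  finally have "(z - \<i>) * L2_inner S (\<psi> (cnj z)) g = \<kappa> * ((z - \<i>) * (LINT x|weighted S. \<psi> z x * \<psi> \<i> x))"
    by simp
  also have "(z - \<i>) * (LINT x|weighted S. \<psi> z x * \<psi> \<i> x) = b1 (\<psi> z) - b1 (\<psi> \<i>)"
    using green_solutions[OF psi_L2_sol(1)[OF z] psi_L2_sol(1)[OF i_not_Real]] by (simp add: psi_L2_sol(2) z)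
  finally show ?thesis .
qed

lemma donoghue_root: "z\<^sup>2 + 1 = 0 \<Longrightarrow> donoghue S T z g = (\<lambda>x. z * g x)"
  unfolding donoghue_def Let_def by simp

lemma donoghue_scalar:
  assumes z: "z \<notin> \<real>"
  shows "\<exists>\<Lambda>. \<forall>g\<in>N\<^sub>i. L2_eq S (donoghue S (T_alpha S v1 v2 \<beta>) z g) (\<lambda>x. \<Lambda> * g x)"
proof (cases "z = \<i>")
  case True
  then show ?thesis using donoghue_root[of \<i>] by (intro exI[of _ \<i>]) simp
next
  case False
  then show ?thesis using donoghue_eq_factor[OF z False] by blast
qed

lemma scalar_bounded_operator:
  assumes A: "\<And>g. g \<in> N\<^sub>i \<Longrightarrow> L2_eq S (A g) (\<lambda>x. \<Lambda> * g x)"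
  shows "bounded_operator_on S N\<^sub>i A"
proof -
  have mult: "(\<lambda>x. \<Lambda> * f x) \<in> N\<^sub>i" if "f \<in> N\<^sub>i" for f
    using deficiency_space_combination[OF that that, of \<Lambda> 0] by simp
  have AN: "A f \<in> N\<^sub>i" if "f \<in> N\<^sub>i" for f
    by (rule deficiency_space_eq[OF mult[OF that] L2_eq_sym[OF A[OF that]]])
  have lin: "L2_eq S (A (\<lambda>x. c * f x + d * g x)) (\<lambda>x. c * A f x + d * A g x)"
    if f: "f \<in> N\<^sub>i" and g: "g \<in> N\<^sub>i" for f g c d
    using A[OF deficiency_space_combination[OF f g, of c d]] A[OF f] A[OF g]
    unfolding L2_eq_def by eventually_elim (simp add: algebra_simps)
  have norm: "L2_norm S (A f) \<le> cmod \<Lambda> * L2_norm S f" if f: "f \<in> N\<^sub>i" for f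
  proof -
    have fL: "f \<in> L2_r S" and AL: "A f \<in> L2_r S" using f AN[OF f] unfolding deficiency_space_iff by blast+
    have "(LINT x|weighted S. (cmod (A f x))\<^sup>2) = (LINT x|weighted S. (cmod \<Lambda>)\<^sup>2 * (cmod (f x))\<^sup>2)"
    proof (rule integral_cong_AE)
      show "(\<lambda>x. (cmod (A f x))\<^sup>2) \<in> borel_measurable (weighted S)"
        "(\<lambda>x. (cmod \<Lambda>)\<^sup>2 * (cmod (f x))\<^sup>2) \<in> borel_measurable (weighted S)"
        using L2_r_measurable[OF AL] L2_r_measurable[OF fL] by simp_all
      show "AE x in weighted S. (cmod (A f x))\<^sup>2 = (cmod \<Lambda>)\<^sup>2 * (cmod (f x))\<^sup>2"
        using A[OF f] unfolding L2_eq_def by eventually_elim (simp add: norm_mult power_mult_distrib)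
    qed
    then have "L2_norm S (A f) = cmod \<Lambda> * L2_norm S f"
      unfolding L2_norm_def by (simp add: real_sqrt_mult)
    then show ?thesis by simp
  qed
  show ?thesis unfolding bounded_operator_on_def using AN lin norm by blast
qed

text \<open>
  For \<open>\<beta> = 0\<close> the quotient of boundary forms is 1, so the scalars differ by a multiple of one minus the
  quotient for \<open>\<alpha>\<close>, which is \<open>(m(z) - m(\<i>)) / (cot \<alpha> + m(z))\<close>. The two inner products above then turn
  \<open>z\<^sup>2 + 1 = (z - \<i>) (z + \<i>)\<close> into the stated form.
\<close>

lemma donoghue_difference:
  assumes z: "z \<notin> \<real>" "z \<noteq> \<i>" "z \<noteq> - \<i>" and \<alpha>: "0 < \<alpha>" "\<alpha> < pi"
    and g: "g \<in> L2_r S" "L2_eq S g (\<lambda>x. \<kappa> * \<psi> \<i> x)"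
  shows "(donoghue_factor \<alpha> z - donoghue_factor 0 z) * \<kappa>
    = (\<i> - z) * ((b1 (\<psi> z) - b1 (\<psi> (- \<i>))) / (of_real (cot \<alpha>) + b1 (\<psi> z)))
        * (1 / psi_i_norm_sq) * L2_inner S (\<psi> (cnj z)) g"
proof -
  define s where "s = L2_inner S (\<psi> \<i>) (\<psi> z)"
  define t where "t = L2_inner S (\<psi> (cnj z)) g"
  define A where "A = b1 (\<psi> z) - b1 (\<psi> (- \<i>))"
  define B where "B = b1 (\<psi> z) - b1 (\<psi> \<i>)"
  define D where "D = of_real (cot \<alpha>) + b1 (\<psi> z)"
  have zi: "\<i> - z \<noteq> 0" "z - \<i> \<noteq> 0" using z by auto
  have sA: "(z + \<i>) * s = A" unfolding s_def A_def by (rule psi_i_inner_psi[OF z(1)])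
  have tB: "(z - \<i>) * t = \<kappa> * B" unfolding t_def B_def by (rule psi_cnj_inner_deficiency[OF z(1) g])
  have sin: "sin \<alpha> \<noteq> 0" using sin_gt_zero[OF \<alpha>] by simp
  have bcD: "boundary_form \<alpha> (\<psi> z) = of_real (sin \<alpha>) * D"
    unfolding boundary_form_psi[OF z(1)] D_def cot_def using sin by (simp add: distrib_left)
  have D0: "D \<noteq> 0" using boundary_form_psi_nonzero[OF z(1), of \<alpha>] bcD by auto
  have "1 - boundary_form \<alpha> (\<psi> \<i>) / boundary_form \<alpha> (\<psi> z) = (boundary_form \<alpha> (\<psi> z) - boundary_form \<alpha> (\<psi> \<i>)) / boundary_form \<alpha> (\<psi> z)"
    using boundary_form_psi_nonzero[OF z(1), of \<alpha>] by (simp add: diff_divide_distrib)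
  also have "boundary_form \<alpha> (\<psi> z) - boundary_form \<alpha> (\<psi> \<i>) = of_real (sin \<alpha>) * B"
    unfolding boundary_form_psi[OF z(1)] boundary_form_psi[OF i_not_Real] B_def by (simp add: algebra_simps)
  also have "of_real (sin \<alpha>) * B / boundary_form \<alpha> (\<psi> z) = B / D" unfolding bcD using sin by simp
  finally have q: "1 - boundary_form \<alpha> (\<psi> \<i>) / boundary_form \<alpha> (\<psi> z) = B / D" .
  have bc0: "boundary_form 0 (\<psi> z) = 1" "boundary_form 0 (\<psi> \<i>) = 1" unfolding boundary_form_psi[OF z(1)] boundary_form_psi[OF i_not_Real] by simp_all
  have alg: "(z + w * (1 - v * y)) - (z + w * (1 - 1 / 1 * y)) = w * ((1 - v) * y)" for w v y :: complex
    by (simp add: algebra_simps)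
  have "donoghue_factor \<alpha> z - donoghue_factor 0 z
      = (z\<^sup>2 + 1) / (\<i> - z) * ((1 - boundary_form \<alpha> (\<psi> \<i>) / boundary_form \<alpha> (\<psi> z)) * (s / psi_i_norm_sq))"
    unfolding donoghue_factor_def bc0 s_def by (simp only: alg)
  also have "z\<^sup>2 + 1 = (z - \<i>) * (z + \<i>)" by (simp add: algebra_simps power2_eq_square)
  also have "(z - \<i>) * (z + \<i>) / (\<i> - z) = - (z + \<i>)" using zi by (simp add: field_simps)
  finally have F: "donoghue_factor \<alpha> z - donoghue_factor 0 z = - (z + \<i>) * (B / D * (s / psi_i_norm_sq))"
    unfolding q .
  have "(donoghue_factor \<alpha> z - donoghue_factor 0 z) * \<kappa> = - ((z + \<i>) * s) * (\<kappa> * B) / (D * psi_i_norm_sq)"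
  proof -
    have "- w * (B / D * (s / psi_i_norm_sq)) * \<kappa> = - (w * s) * (\<kappa> * B) / (D * psi_i_norm_sq)" for w by (simp add: mult_ac)
    then show ?thesis unfolding F .
  qed
  also have "\<dots> = - A * ((z - \<i>) * t) / (D * psi_i_norm_sq)" unfolding sA tB by simp
  also have "- A * ((z - \<i>) * t) = (\<i> - z) * A * t" by (simp add: algebra_simps)
  also have "(\<i> - z) * A * t / (D * psi_i_norm_sq) = (\<i> - z) * (A / D) * (1 / psi_i_norm_sq) * t" by simp
  finally show ?thesis unfolding A_def D_def t_def .
qed

end

theorem theorem5p2:
  fixes S :: sl_data and v1 v2 :: "real \<Rightarrow> complex" and \<alpha> :: real
  assumes "sl_problem S"
    and "limit_circle_left S"
    and "limit_point_right S"
    and "boundary_frame S v1 v2"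
    and "0 < \<alpha>" and "\<alpha> < pi"
  shows "(\<forall>z. z \<notin> \<real> \<longrightarrow>
            bounded_operator_on S (deficiency_space S \<i>) (donoghue S (T_alpha S v1 v2 \<alpha>) z))
       \<and> (\<forall>g\<in>deficiency_space S \<i>.
            L2_eq S (donoghue S (T_alpha S v1 v2 \<alpha>) \<i> g) (\<lambda>x. \<i> * g x) \<and>
            L2_eq S (donoghue S (T_alpha S v1 v2 \<alpha>) (- \<i>) g) (\<lambda>x. - \<i> * g x))
       \<and> (\<forall>z. z \<notin> \<real> \<and> z \<noteq> \<i> \<and> z \<noteq> - \<i> \<longrightarrow>
            (\<forall>g\<in>deficiency_space S \<i>.
               L2_eq S (donoghue S (T_alpha S v1 v2 \<alpha>) z g)
                 (\<lambda>x. donoghue S (T_alpha S v1 v2 0) z g x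
                    + (\<i> - z)
                      * ((bv1 S v1 (psi S v2 z) - bv1 S v1 (psi S v2 (- \<i>)))
                          / (of_real (cot \<alpha>) + bv1 S v1 (psi S v2 z)))
                      * (1 / of_real ((L2_norm S (psi S v2 \<i>))\<^sup>2))
                      * L2_inner S (psi S v2 (cnj z)) g * psi S v2 \<i> x)))"
proof (intro conjI allI ballI impI; (elim conjE)?)
  interpret limit_circle_point S v1 v2
    using assms(1-4) by unfold_locales
  show "bounded_operator_on S (deficiency_space S \<i>) (donoghue S (T_alpha S v1 v2 \<alpha>) z)" if z: "z \<notin> \<real>" for z
    using donoghue_scalar[OF z, of \<alpha>] scalar_bounded_operator by blast
  show "L2_eq S (donoghue S (T_alpha S v1 v2 \<alpha>) \<i> g) (\<lambda>x. \<i> * g x)" for g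
    by (simp add: donoghue_root)
  show "L2_eq S (donoghue S (T_alpha S v1 v2 \<alpha>) (- \<i>) g) (\<lambda>x. - \<i> * g x)" for g
    using donoghue_root[of "- \<i>"] by simp
  fix z g assume z: "z \<notin> \<real>" "z \<noteq> \<i>" "z \<noteq> - \<i>" and g: "g \<in> deficiency_space S \<i>"
  obtain \<kappa> where k: "g \<in> L2_r S" "L2_eq S g (\<lambda>x. \<kappa> * psi S v2 \<i> x)" using g unfolding deficiency_space_iff by blast
  note diff = donoghue_difference[OF z assms(5,6) k, unfolded psi_i_norm_sq_def]
  show "L2_eq S (donoghue S (T_alpha S v1 v2 \<alpha>) z g)
                 (\<lambda>x. donoghue S (T_alpha S v1 v2 0) z g x
                    + (\<i> - z)
                      * ((bv1 S v1 (psi S v2 z) - bv1 S v1 (psi S v2 (- \<i>)))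
                          / (of_real (cot \<alpha>) + bv1 S v1 (psi S v2 z)))
                      * (1 / of_real ((L2_norm S (psi S v2 \<i>))\<^sup>2))
                      * L2_inner S (psi S v2 (cnj z)) g * psi S v2 \<i> x)"
    using donoghue_eq_factor[OF z(1,2) g, of \<alpha>] donoghue_eq_factor[OF z(1,2) g, of 0] k(2)
    unfolding L2_eq_def diff[symmetric]
    by eventually_elim (simp add: algebra_simps)
qed

end
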